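(* Assume $s\ge2$, $\gamma_1>0$, $\delta_1>0$ and $\gamma=\frac{7}{48}$. Then the initial value problem $$\partial_t\eta+\partial_x\eta-\gamma_1\partial_x^2\partial_t\eta+\gamma_2\partial_x^3\eta+\delta_1\partial_x^4\partial_t\eta+\delta_2\partial_x^5\eta+\tfrac34\partial_x(\eta^2)+\gamma\,\partial_x^3(\eta^2)-\tfrac{7}{48}\partial_x\big((\partial_x\eta)^2\big)-\tfrac18\partial_x(\eta^3)=0,\qquad \eta(x,0)=\eta_0(x),$$ is globally well-posed in $H^s(\mathbb{R})$.
   Context: Coefficients. Let $\theta\in[0,1]$ and $\lambda,\mu,\lambda_1,\mu_1,\rho\in\mathbb{R}$, and put $a=\frac12(\theta^2-\frac13)\lambda$, $b=\frac12(\theta^2-\frac13)(1-\lambda)$, $c=\frac12(1-\theta^2)\mu$, $d=\frac12(1-\theta^2)(1-\mu)$, $a_1=-\frac14(\theta^2-\frac13)^2(1-\lambda)+\frac5{24}(\theta^2-\frac15)^2\lambda_1$, $b_1=-\frac5{24}(\theta^2-\frac15)^2(1-\lambda_1)$, $c_1=\frac5{24}(1-\theta^2)(\theta^2-\frac15)(1-\mu_1)$, $d_1=-\frac14(1-\theta^2)^2\mu-\frac5{24}(1-\theta^2)(\theta^2-\frac15)\mu_1$. The real coefficients of the equation are $\gamma_1=\frac12(b+d-\rho)$, $\gamma_2=\frac12(a+c+\rho)$, $\delta_1=\frac14[2(b_1+d_1)-(b-d+\rho)(\frac16-a-d)-d(c-a+\rho)]$, $\delta_2=\frac14[2(a_1+c_1)-(c-a+\rho)(\frac16-a)+\frac13\rho]$,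 $\gamma=\frac1{24}[5-9(b+d)+9\rho]$. Functions are real-valued. Put $\varphi(\xi)=1+\gamma_1\xi^2+\delta_1\xi^4$ and let $\phi(\partial_x),\psi(\partial_x),\tau(\partial_x)$ be the Fourier multipliers (i.e. $\widehat{m(\partial_x)f}(\xi)=m(\xi)\widehat f(\xi)$) with symbols $\phi(\xi)=\frac{\xi(1-\gamma_2\xi^2+\delta_2\xi^4)}{\varphi(\xi)}$, $\psi(\xi)=\frac{\xi}{\varphi(\xi)}$, $\tau(\xi)=\frac{3\xi-4\gamma\xi^3}{4\varphi(\xi)}$. Let $S(t)$ be given by $\widehat{S(t)f}(\xi)=e^{-i\phi(\xi)t}\widehat f(\xi)$. A solution in $C([0,T];H^s)$ of the initial value problem is understood as a solution of the equivalent integral equation $$\eta(t)=S(t)\eta_0-i\int_0^tS(t-t')\Big(\tau(\partial_x)\eta^2-\tfrac18\psi(\partial_x)\eta^3-\tfrac7{48}\psi(\partial_x)\eta_x^2\Big)(t')\,dt'.$$ Globally well-posed in $H^s(\mathbb{R})$ means: for every $\eta_0\in H^s(\mathbb{R})$ and every $T>0$ there is a unique solution $\eta\in C([0,T];H^s(\mathbb{R}))$, and the map $\eta_0\mapsto\eta$ is continuous from $H^s(\mathbb{R})$ to $C([0,T];H^s(\mathbb{R}))$. *)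

theory Defs
  imports "HOL-Analysis.Analysis"
begin

section \<open>The space of square integrable functions modulo null sets\<close>

definition sq_integrable :: "(real \<Rightarrow> complex) \<Rightarrow> bool" where
  "sq_integrable f \<longleftrightarrow>
     f \<in> borel_measurable lborel \<and> integrable lborel (\<lambda>x. (cmod (f x))\<^sup>2)"

definition l2_rel :: "(real \<Rightarrow> complex) \<Rightarrow> (real \<Rightarrow> complex) \<Rightarrow> bool" where
  "l2_rel f g \<longleftrightarrow> sq_integrable f \<and> sq_integrable g \<and> (AE x in lborel. f x = g x)"

lemma sq_integrable_zero [simp]: "sq_integrable (\<lambda>x. 0)"
  by (simp add: sq_integrable_def)

lemma part_equivp_l2_rel: "part_equivp l2_rel"
proof (rule part_equivpI)
  show "\<exists>f. l2_rel f f"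
    by (rule exI[of _ "\<lambda>x. 0"]) (simp add: l2_rel_def)
  show "symp l2_rel"
    by (rule sympI) (auto simp: l2_rel_def eq_commute)
  show "transp l2_rel"
    by (rule transpI) (auto simp: l2_rel_def elim: eventually_elim2)
qed

quotient_type l2 = "real \<Rightarrow> complex" / partial: l2_rel
  by (rule part_equivp_l2_rel)

lemma sq_integrable_add:
  assumes "sq_integrable f" "sq_integrable g"
  shows "sq_integrable (\<lambda>x. f x + g x)"
proof -
  have m: "f \<in> borel_measurable lborel" "g \<in> borel_measurable lborel"
    using assms by (auto simp: sq_integrable_def)
  have "integrable lborel (\<lambda>x. 2 * (cmod (f x))\<^sup>2 + 2 * (cmod (g x))\<^sup>2)"
    using assms by (auto simp: sq_integrable_def)
  moreover have "(cmod (f x + g x))\<^sup>2 \<le> 2 * (cmod (f x))\<^sup>2 + 2 * (cmod (g x))\<^sup>2" for x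
  proof -
    have "(cmod (f x + g x))\<^sup>2 \<le> (cmod (f x) + cmod (g x))\<^sup>2"
      by (intro power_mono norm_triangle_ineq) auto
    also have "\<dots> \<le> 2 * (cmod (f x))\<^sup>2 + 2 * (cmod (g x))\<^sup>2"
      using sum_squares_ge_zero[of "cmod (f x) - cmod (g x)" 0]
      by (simp add: power2_eq_square algebra_simps)
    finally show ?thesis .
  qed
  ultimately have "integrable lborel (\<lambda>x. (cmod (f x + g x))\<^sup>2)"
    using m by (elim Bochner_Integration.integrable_bound) auto
  then show ?thesis
    using m by (simp add: sq_integrable_def)
qed

lemma sq_integrable_cmult:
  "sq_integrable f \<Longrightarrow> sq_integrable (\<lambda>x. c * f x)"
  by (auto simp: sq_integrable_def norm_mult power_mult_distrib)

lemma sq_integrable_scaleR: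
  "sq_integrable f \<Longrightarrow> sq_integrable (\<lambda>x. r *\<^sub>R f x)"
  using sq_integrable_cmult[of f "of_real r"] by (simp add: scaleR_conv_of_real)

lemma sq_integrable_uminus:
  "sq_integrable f \<Longrightarrow> sq_integrable (\<lambda>x. - f x)"
  by (auto simp: sq_integrable_def)

lemma sq_integrable_diff:
  "sq_integrable f \<Longrightarrow> sq_integrable g \<Longrightarrow> sq_integrable (\<lambda>x. f x - g x)"
  using sq_integrable_add[of f "\<lambda>x. - g x"] by (simp add: sq_integrable_uminus)

lemma integrable_inner_sq_integrable:
  assumes "sq_integrable f" "sq_integrable g"
  shows "integrable lborel (\<lambda>x. f x \<bullet> g x)"
proof -
  have m: "f \<in> borel_measurable lborel" "g \<in> borel_measurable lborel"
    using assms by (auto simp: sq_integrable_def)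
  have "integrable lborel (\<lambda>x. (cmod (f x))\<^sup>2 + (cmod (g x))\<^sup>2)"
    using assms by (auto simp: sq_integrable_def)
  moreover have "\<bar>f x \<bullet> g x\<bar> \<le> (cmod (f x))\<^sup>2 + (cmod (g x))\<^sup>2" for x
  proof -
    have "\<bar>f x \<bullet> g x\<bar> \<le> cmod (f x) * cmod (g x)"
      by (rule Cauchy_Schwarz_ineq2)
    also have "\<dots> \<le> (cmod (f x))\<^sup>2 + (cmod (g x))\<^sup>2"
      using sum_squares_bound[of "cmod (f x)" "cmod (g x)"]
        mult_nonneg_nonneg[OF norm_ge_zero[of "f x"] norm_ge_zero[of "g x"]]
      by linarith
    finally show ?thesis .
  qed
  ultimately show ?thesis
    using m by (elim Bochner_Integration.integrable_bound) (auto intro!: AE_I2 order_trans[OF _ abs_ge_self])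
qed

instantiation l2 :: real_inner
begin

lift_definition zero_l2 :: l2 is "\<lambda>x. 0"
  by (simp add: l2_rel_def)

lift_definition plus_l2 :: "l2 \<Rightarrow> l2 \<Rightarrow> l2" is "\<lambda>f g x. f x + g x"
  by (auto simp: l2_rel_def intro!: sq_integrable_add)

lift_definition uminus_l2 :: "l2 \<Rightarrow> l2" is "\<lambda>f x. - f x"
  by (auto simp: l2_rel_def intro!: sq_integrable_uminus)

lift_definition minus_l2 :: "l2 \<Rightarrow> l2 \<Rightarrow> l2" is "\<lambda>f g x. f x - g x"
  by (auto simp: l2_rel_def intro!: sq_integrable_diff)

lift_definition scaleR_l2 :: "real \<Rightarrow> l2 \<Rightarrow> l2" is "\<lambda>r f x. r *\<^sub>R f x"
  by (auto simp: l2_rel_def intro!: sq_integrable_scaleR)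

text \<open>The inner product on complex numbers is the real one, so this is the real part of the
  Hermitian product; the induced norm is the usual one.\<close>

lift_definition inner_l2 :: "l2 \<Rightarrow> l2 \<Rightarrow> real" is "\<lambda>f g. LINT x|lborel. f x \<bullet> g x"
  by (rule integral_cong_AE) (auto simp: l2_rel_def sq_integrable_def)

definition norm_l2 :: "l2 \<Rightarrow> real" where
  "norm_l2 f = sqrt (f \<bullet> f)"

definition dist_l2 :: "l2 \<Rightarrow> l2 \<Rightarrow> real" where
  "dist_l2 f g = norm (f - g)"

definition sgn_l2 :: "l2 \<Rightarrow> l2" where
  "sgn_l2 f = inverse (norm f) *\<^sub>R f"

definition uniformity_l2 :: "(l2 \<times> l2) filter" where
  "uniformity_l2 = (INF e\<in>{0<..}. principal {(f, g). dist f g < e})"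

definition open_l2 :: "l2 set \<Rightarrow> bool" where
  "open_l2 U \<longleftrightarrow> (\<forall>f\<in>U. eventually (\<lambda>(f', g). f' = f \<longrightarrow> g \<in> U) uniformity)"

instance
proof
  fix f g h :: l2 and r q :: real
  show "f + g + h = f + (g + h)"
    by transfer (auto simp: l2_rel_def algebra_simps intro!: sq_integrable_add)
  show "f + g = g + f"
    by transfer (auto simp: l2_rel_def algebra_simps intro!: sq_integrable_add)
  show "0 + f = f"
    by transfer (auto simp: l2_rel_def)
  show "- f + f = 0"
    by transfer (auto simp: l2_rel_def)
  show "f - g = f + - g"
    by transfer (auto simp: l2_rel_def intro!: sq_integrable_diff)
  show "r *\<^sub>R (f + g) = r *\<^sub>R f + r *\<^sub>R g"
    by transfer (auto simp: l2_rel_def scaleR_add_right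
        intro!: sq_integrable_add sq_integrable_scaleR)
  show "(r + q) *\<^sub>R f = r *\<^sub>R f + q *\<^sub>R f"
    by transfer (auto simp: l2_rel_def scaleR_add_left
        intro!: sq_integrable_add sq_integrable_scaleR)
  show "r *\<^sub>R q *\<^sub>R f = (r * q) *\<^sub>R f"
    by transfer (auto simp: l2_rel_def intro!: sq_integrable_scaleR)
  show "1 *\<^sub>R f = f"
    by transfer (auto simp: l2_rel_def)
  show "dist f g = norm (f - g)"
    by (rule dist_l2_def)
  show "sgn f = inverse (norm f) *\<^sub>R f"
    by (rule sgn_l2_def)
  show "uniformity = (INF e\<in>{0<..}. principal {(f, g::l2). dist f g < e})"
    by (rule uniformity_l2_def)
  show "open U \<longleftrightarrow> (\<forall>f\<in>U. \<forall>\<^sub>F (f', g) in uniformity. f' = f \<longrightarrow> g \<in> U)" for U :: "l2 set"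
    by (rule open_l2_def)
  show "f \<bullet> g = g \<bullet> f"
    by transfer (simp add: inner_commute)
  show "(f + g) \<bullet> h = f \<bullet> h + g \<bullet> h"
    by transfer (simp add: l2_rel_def inner_add_left integrable_inner_sq_integrable)
  show "(r *\<^sub>R f) \<bullet> g = r * (f \<bullet> g)"
    by transfer simp
  show "0 \<le> f \<bullet> f"
    by transfer simp
  show "f \<bullet> f = 0 \<longleftrightarrow> f = 0"
    by transfer
      (auto simp: l2_rel_def integrable_inner_sq_integrable integral_nonneg_eq_0_iff_AE)
  show "norm f = sqrt (f \<bullet> f)"
    by (rule norm_l2_def)
qed

end

text \<open>The morphism \<open>rep_l2\<close> chooses some representative of a class; all uses
  below are insensitive to changes on null sets. The value \<open>0\<close> is a dummy for
  functions that are not square integrable.\<close>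

definition to_l2 :: "(real \<Rightarrow> complex) \<Rightarrow> l2" where
  "to_l2 f = (if sq_integrable f then abs_l2 f else 0)"

lemma sq_integrable_rep_l2: "sq_integrable (rep_l2 f)"
  using Quotient3_rel_rep[OF Quotient3_l2, of f f] by (simp add: l2_rel_def)

lemma to_l2_rep_l2 [simp]: "to_l2 (rep_l2 f) = f"
  by (simp add: to_l2_def sq_integrable_rep_l2 Quotient3_abs_rep[OF Quotient3_l2])

lemma l2_eq_iff: "f = g \<longleftrightarrow> (AE x in lborel. rep_l2 f x = rep_l2 g x)"
  using Quotient3_rel_rep[OF Quotient3_l2, of f g]
  by (auto simp: l2_rel_def sq_integrable_rep_l2)

lemma rep_l2_to_l2: "sq_integrable f \<Longrightarrow> AE x in lborel. rep_l2 (to_l2 f) x = f x"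
  using rep_abs_rsp_left[OF Quotient3_l2, of f f]
  by (simp add: to_l2_def l2_rel_def)

definition l2_real_valued :: "l2 \<Rightarrow> bool" where
  "l2_real_valued f \<longleftrightarrow> (AE x in lborel. rep_l2 f x \<in> \<real>)"

definition l2_cscale :: "complex \<Rightarrow> l2 \<Rightarrow> l2" where
  "l2_cscale c f = to_l2 (\<lambda>x. c * rep_l2 f x)"

definition l2_power :: "l2 \<Rightarrow> nat \<Rightarrow> l2" where
  "l2_power f n = to_l2 (\<lambda>x. rep_l2 f x ^ n)"


section \<open>Fourier transform, Fourier multipliers and Sobolev spaces\<close>

definition fourier_trunc :: "real \<Rightarrow> l2 \<Rightarrow> l2" where
  "fourier_trunc R f =
     to_l2 (\<lambda>\<xi>. LINT x:{-R..R}|lborel. exp (- \<i> * of_real (x * \<xi>)) * rep_l2 f x)"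

text \<open>The Plancherel transform: the limit in the mean of the truncated Fourier integrals.\<close>

definition fourier :: "l2 \<Rightarrow> l2" where
  "fourier f = Lim at_top (\<lambda>R. fourier_trunc R f)"

text \<open>The multiplier with symbol \<open>m\<close>; a meaningful value only if \<open>m\<close> times the
  transform of \<open>f\<close> is square integrable.\<close>

definition fourier_mult :: "(real \<Rightarrow> complex) \<Rightarrow> l2 \<Rightarrow> l2" where
  "fourier_mult m f =
     (THE g. AE \<xi> in lborel. rep_l2 (fourier g) \<xi> = m \<xi> * rep_l2 (fourier f) \<xi>)"

definition l2_deriv :: "l2 \<Rightarrow> l2" where
  "l2_deriv = fourier_mult (\<lambda>\<xi>. \<i> * of_real \<xi>)"

text \<open>The real-valued Sobolev space of order \<open>s\<close>, as a subset of the space of square integrable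
  functions, which is adequate only for \<open>s \<ge> 0\<close>.\<close>

definition sobolev :: "real \<Rightarrow> l2 set" where
  "sobolev s = {f. l2_real_valued f \<and>
     integrable lborel (\<lambda>\<xi>. (1 + \<xi>\<^sup>2) powr s * (cmod (rep_l2 (fourier f) \<xi>))\<^sup>2)}"

definition sobolev_norm :: "real \<Rightarrow> l2 \<Rightarrow> real" where
  "sobolev_norm s f =
     sqrt (LINT \<xi>|lborel. (1 + \<xi>\<^sup>2) powr s * (cmod (rep_l2 (fourier f) \<xi>))\<^sup>2)"

definition continuous_sobolev :: "real \<Rightarrow> real \<Rightarrow> (real \<Rightarrow> l2) \<Rightarrow> bool" where
  "continuous_sobolev s T u \<longleftrightarrow>
     (\<forall>t\<in>{0..T}. u t \<in> sobolev s) \<and>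
     (\<forall>t\<in>{0..T}. ((\<lambda>r. sobolev_norm s (u r - u t)) \<longlongrightarrow> 0) (at t within {0..T}))"


section \<open>The coefficients of the equation\<close>

record wave_params =
  theta :: real
  lam :: real
  mu :: real
  lam1 :: real
  mu1 :: real
  rho :: real

definition coef_a :: "wave_params \<Rightarrow> real" where
  "coef_a p = 1/2 * ((theta p)\<^sup>2 - 1/3) * lam p"

definition coef_b :: "wave_params \<Rightarrow> real" where
  "coef_b p = 1/2 * ((theta p)\<^sup>2 - 1/3) * (1 - lam p)"

definition coef_c :: "wave_params \<Rightarrow> real" where
  "coef_c p = 1/2 * (1 - (theta p)\<^sup>2) * mu p"

definition coef_d :: "wave_params \<Rightarrow> real" where
  "coef_d p = 1/2 * (1 - (theta p)\<^sup>2) * (1 - mu p)"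

definition coef_a1 :: "wave_params \<Rightarrow> real" where
  "coef_a1 p = - (1/4) * ((theta p)\<^sup>2 - 1/3)\<^sup>2 * (1 - lam p)
     + 5/24 * ((theta p)\<^sup>2 - 1/5)\<^sup>2 * lam1 p"

definition coef_b1 :: "wave_params \<Rightarrow> real" where
  "coef_b1 p = - (5/24) * ((theta p)\<^sup>2 - 1/5)\<^sup>2 * (1 - lam1 p)"

definition coef_c1 :: "wave_params \<Rightarrow> real" where
  "coef_c1 p = 5/24 * (1 - (theta p)\<^sup>2) * ((theta p)\<^sup>2 - 1/5) * (1 - mu1 p)"

definition coef_d1 :: "wave_params \<Rightarrow> real" where
  "coef_d1 p = - (1/4) * (1 - (theta p)\<^sup>2)\<^sup>2 * mu p
     - 5/24 * (1 - (theta p)\<^sup>2) * ((theta p)\<^sup>2 - 1/5) * mu1 p"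

definition gamma1 :: "wave_params \<Rightarrow> real" where
  "gamma1 p = 1/2 * (coef_b p + coef_d p - rho p)"

definition gamma2 :: "wave_params \<Rightarrow> real" where
  "gamma2 p = 1/2 * (coef_a p + coef_c p + rho p)"

definition delta1 :: "wave_params \<Rightarrow> real" where
  "delta1 p = 1/4 * (2 * (coef_b1 p + coef_d1 p)
     - (coef_b p - coef_d p + rho p) * (1/6 - coef_a p - coef_d p)
     - coef_d p * (coef_c p - coef_a p + rho p))"

definition delta2 :: "wave_params \<Rightarrow> real" where
  "delta2 p = 1/4 * (2 * (coef_a1 p + coef_c1 p)
     - (coef_c p - coef_a p + rho p) * (1/6 - coef_a p) + 1/3 * rho p)"

definition gamma0 :: "wave_params \<Rightarrow> real" where
  "gamma0 p = 1/24 * (5 - 9 * (coef_b p + coef_d p) + 9 * rho p)"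


section \<open>The integral equation\<close>

text \<open>Duhamel form of the initial value problem for
  \<open>u\<^sub>t + u\<^sub>x - \<gamma>\<^sub>1 u\<^sub>x\<^sub>x\<^sub>t + \<gamma>\<^sub>2 u\<^sub>x\<^sub>x\<^sub>x + \<delta>\<^sub>1 u\<^sub>x\<^sub>x\<^sub>x\<^sub>x\<^sub>t + \<delta>\<^sub>2 u\<^sub>x\<^sub>x\<^sub>x\<^sub>x\<^sub>x
    + 3/4 (u\<^sup>2)\<^sub>x + \<gamma> (u\<^sup>2)\<^sub>x\<^sub>x\<^sub>x - 7/48 (u\<^sub>x\<^sup>2)\<^sub>x - 1/8 (u\<^sup>3)\<^sub>x = 0\<close>.
  The coefficient \<open>\<gamma>\<close> (\<open>gamma0\<close>) enters through \<open>tau_sym\<close>. The symbols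
  \<open>phi_sym\<close>, \<open>psi_sym\<close>, \<open>tau_sym\<close> are real; the factor \<open>\<i>\<close> of the symbol \<open>\<i> \<xi>\<close> of
  \<open>\<partial>\<^sub>x\<close> is written separately, in \<open>propagator\<close> and in front of the time integral.\<close>

definition varphi_sym :: "wave_params \<Rightarrow> real \<Rightarrow> real" where
  "varphi_sym p \<xi> = 1 + gamma1 p * \<xi>\<^sup>2 + delta1 p * \<xi> ^ 4"

definition phi_sym :: "wave_params \<Rightarrow> real \<Rightarrow> real" where
  "phi_sym p \<xi> = \<xi> * (1 - gamma2 p * \<xi>\<^sup>2 + delta2 p * \<xi> ^ 4) / varphi_sym p \<xi>"

definition psi_sym :: "wave_params \<Rightarrow> real \<Rightarrow> real" where
  "psi_sym p \<xi> = \<xi> / varphi_sym p \<xi>"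

definition tau_sym :: "wave_params \<Rightarrow> real \<Rightarrow> real" where
  "tau_sym p \<xi> = (3 * \<xi> - 4 * gamma0 p * \<xi> ^ 3) / (4 * varphi_sym p \<xi>)"

definition propagator :: "wave_params \<Rightarrow> real \<Rightarrow> l2 \<Rightarrow> l2" where
  "propagator p t = fourier_mult (\<lambda>\<xi>. exp (- \<i> * of_real (phi_sym p \<xi> * t)))"

definition nonlinearity :: "wave_params \<Rightarrow> l2 \<Rightarrow> l2" where
  "nonlinearity p f =
     fourier_mult (\<lambda>\<xi>. of_real (tau_sym p \<xi>)) (l2_power f 2)
     - (1/8) *\<^sub>R fourier_mult (\<lambda>\<xi>. of_real (psi_sym p \<xi>)) (l2_power f 3)
     - (7/48) *\<^sub>R fourier_mult (\<lambda>\<xi>. of_real (psi_sym p \<xi>)) (l2_power (l2_deriv f) 2)"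

text \<open>For \<open>s \<ge> 2\<close> the integrand below is continuous in time with values in the Sobolev space of
  order \<open>s\<close>, which embeds continuously into \<^typ>\<open>l2\<close>, so its integral may be taken in
  \<^typ>\<open>l2\<close>.\<close>

definition is_solution ::
  "wave_params \<Rightarrow> real \<Rightarrow> real \<Rightarrow> l2 \<Rightarrow> (real \<Rightarrow> l2) \<Rightarrow> bool" where
  "is_solution p s T u0 u \<longleftrightarrow>
     continuous_sobolev s T u \<and>
     (\<forall>t\<in>{0..T}. \<exists>I.
        ((\<lambda>r. propagator p (t - r) (nonlinearity p (u r))) has_integral I) {0..t} \<and>
        u t = propagator p t u0 - l2_cscale \<i> I)"

definition globally_well_posed :: "wave_params \<Rightarrow> real \<Rightarrow> bool" where
  "globally_well_posed p s \<longleftrightarrow>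
     (\<forall>u0\<in>sobolev s. \<forall>T>0.
        (\<exists>u. is_solution p s T u0 u \<and>
             (\<forall>v. is_solution p s T u0 v \<longrightarrow> (\<forall>t\<in>{0..T}. v t = u t)))) \<and>
     (\<forall>u0\<in>sobolev s. \<forall>T>0. \<forall>\<epsilon>>0. \<exists>\<delta>>0. \<forall>v0\<in>sobolev s.
        sobolev_norm s (v0 - u0) < \<delta> \<longrightarrow>
        (\<forall>u v. is_solution p s T u0 u \<longrightarrow> is_solution p s T v0 v \<longrightarrow>
           (\<forall>t\<in>{0..T}. sobolev_norm s (v t - u t) < \<epsilon>)))"

end

theory Submission
  imports Defs "HOL-Probability.Characteristic_Functions" "HOL-Probability.Sinc_Integral"
begin

text \<open>
  The proof lives on the Fourier side. A function \<open>u\<close> in the Sobolev space of order \<open>s\<close> is encoded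
  by \<open>w = (1 + \<xi>\<^sup>2)\<^bsup>s/2\<^esup> \<cdot> \<F> u\<close>, which is an arbitrary square integrable function; the map \<open>low s\<close>
  recovers \<open>u\<close> from \<open>w\<close>. The Sobolev norm becomes the norm of \<^typ>\<open>l2\<close>, one Hilbert space serves
  all \<open>s\<close>, and the real-valued \<open>u\<close> correspond to the fixed points of the involution
  \<open>l2_star\<close>, \<open>w(\<xi>) \<mapsto> cnj (w(-\<xi>))\<close>. Under this encoding (\<open>is_solution_low\<close>) the integral equation is
  \<open>w(t) = U(t) w\<^sub>0 + \<integral> U(t - r) M(w(r)) dr\<close> with a unitary group \<open>U\<close> of multipliers.

  \<^emph>\<open>The nonlinearity is smooth.\<close> As \<open>varphi_sym\<close> grows like \<open>\<xi>\<^sup>4\<close>, the multipliers \<open>\<tau>\<close> and \<open>\<psi>\<close> have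
  the orders \<open>-1\<close> and \<open>-3\<close>: they pay for the derivative in \<open>u\<^sub>x\<^sup>2\<close>. What remains is multiplication in
  the Sobolev space of order \<open>s - 1 \<ge> 1\<close>, which is an algebra (\<open>weighted_conv\<close>): Young's inequality
  for \<open>L\<^sup>1 * L\<^sup>2\<close> together with the subadditivity of the weight up to a constant. Hence \<open>M\<close> is locally
  Lipschitz. The same estimate is tame: in each product only one factor is measured in the full norm,
  the others in \<open>L\<^sup>1\<close> on the Fourier side, which the norm of order \<open>2\<close> of \<open>u\<close> controls. So
  \<open>\<parallel>M w\<parallel> \<le> K(\<parallel>u\<parallel>\<^bsub>2\<^esub>) \<parallel>w\<parallel>\<close> (\<open>M_tame\<close>).

  \<^emph>\<open>A conserved energy.\<close> Let \<open>E\<close> be the integral of \<open>u\<^sup>2 + \<gamma>\<^sub>1 u\<^sub>x\<^sup>2 + \<delta>\<^sub>1 u\<^sub>x\<^sub>x\<^sup>2\<close>, an equivalent of the squared norm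
  of order \<open>2\<close>. Its derivative along the flow is a multiple of \<open>(\<gamma> - 7/48) \<integral> u\<^sub>x\<^sup>3\<close>, which vanishes for
  \<open>\<gamma> = 7/48\<close> (\<open>energy\<close>). For \<open>s = 2\<close> the function \<open>u\<^sub>x\<^sub>x\<close> is only square integrable, so the integrations by
  parts are carried out as symmetries of an absolutely convergent trilinear form in the Fourier
  variables (\<open>tri\<close>). The dispersive part of the equation may cost a derivative; it
  disappears in the interaction picture \<open>U(-t) w(t)\<close>, whose time derivative exists in the norm.

  \<^emph>\<open>Globalisation.\<close> The energy bounds \<open>u\<close> in order \<open>2\<close>, and then the tame estimate and Gronwall's
  inequality bound \<open>w\<close> on \<open>[0, T]\<close> in terms of \<open>T\<close> and \<open>\<parallel>w\<^sub>0\<parallel>\<close> alone (\<open>a_priori_bound\<close>). This holds as well if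
  \<open>M\<close> is evaluated at \<open>c(w) w\<close> instead of \<open>w\<close>, with scalars \<open>0 < c(w) \<le> 1\<close>, because both the energy
  identity and the tame estimate survive a rescaling of the argument. Let \<open>c(w) w\<close> be the radial projection of \<open>w\<close> onto
  the ball given by the a priori bound. This truncated nonlinearity is globally Lipschitz, so Picard iteration in an
  exponentially weighted norm gives a solution on all of \<open>[0, T]\<close> at once, and by the bound it never feels the
  truncation (\<open>mild_exists\<close>). Uniqueness and Lipschitz dependence on the data follow from the a priori
  bound and Gronwall's inequality (\<open>mild_dependence\<close>).

  \<^emph>\<open>Fourier analysis.\<close> The transform of \<^typ>\<open>l2\<close> has to be shown bijective (\<open>fourier_inversion\<close>) and to turn
  products into convolutions (\<open>fourier_product\<close>). Gaussian regularisation bounds the transform on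
  \<open>L\<^sup>1 \<inter> L\<^sup>2\<close>, and inverts it on indicator functions of intervals; self-adjointness carries the inversion
  formula over to all of \<^typ>\<open>l2\<close>.
\<close>

section \<open>The Hilbert space of square integrable functions\<close>

lemma sq_integrable_measurable [simp, measurable_dest]:
  "sq_integrable f \<Longrightarrow> f \<in> borel_measurable borel"
  by (simp add: sq_integrable_def)

lemma sq_integrableD: "sq_integrable f \<Longrightarrow> integrable lborel (\<lambda>x. (cmod (f x))\<^sup>2)"
  by (simp add: sq_integrable_def)

lemma measurable_rep_l2 [measurable, simp]: "rep_l2 f \<in> borel_measurable borel"
  using sq_integrable_rep_l2[of f] by (simp add: sq_integrable_def)

lemma integrable_rep_l2: "integrable lborel (\<lambda>x. (cmod (rep_l2 f x))\<^sup>2)"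
  using sq_integrable_rep_l2 sq_integrableD by blast

lemma sq_integrable_cong_AE:
  assumes "sq_integrable f" "g \<in> borel_measurable borel" "AE x in lborel. f x = g x"
  shows "sq_integrable g"
proof -
  have "integrable lborel (\<lambda>x. (cmod (g x))\<^sup>2)"
    using assms by (intro integrable_cong_AE_imp[OF sq_integrableD[OF assms(1)]]) auto
  then show ?thesis using assms by (simp add: sq_integrable_def)
qed

lemma sq_integrable_bound:
  assumes "sq_integrable f" "g \<in> borel_measurable borel"
    and "AE x in lborel. cmod (g x) \<le> C * cmod (f x)"
  shows "sq_integrable g"
proof -
  have "integrable lborel (\<lambda>x. (cmod (C * f x))\<^sup>2)"
    using sq_integrable_cmult[OF assms(1), of "of_real C"] by (rule sq_integrableD)
  moreover have "AE x in lborel. norm ((cmod (g x))\<^sup>2) \<le> norm ((cmod (C * f x))\<^sup>2)"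
    using assms(3)
  proof eventually_elim
    case (elim x)
    also have "C * cmod (f x) \<le> cmod (C * f x)"
      by (simp add: norm_mult mult_right_mono)
    finally show ?case by (simp add: power_mono)
  qed
  ultimately have "integrable lborel (\<lambda>x. (cmod (g x))\<^sup>2)"
    using assms(2) by (elim Bochner_Integration.integrable_bound) auto
  then show ?thesis using assms by (simp add: sq_integrable_def)
qed

lemma to_l2_eq_iff:
  "sq_integrable f \<Longrightarrow> sq_integrable g \<Longrightarrow> to_l2 f = to_l2 g \<longleftrightarrow> (AE x in lborel. f x = g x)"
  using Quotient3_rel[OF Quotient3_l2, of f g] by (auto simp: to_l2_def l2_rel_def)

lemma to_l2_cong_AE:
  assumes "f \<in> borel_measurable borel" "g \<in> borel_measurable borel" "AE x in lborel. f x = g x"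
  shows "to_l2 f = to_l2 g"
proof (cases "sq_integrable f")
  case True
  then show ?thesis using sq_integrable_cong_AE[OF True assms(2,3)] assms(3) to_l2_eq_iff by blast
next
  case False
  have "AE x in lborel. g x = f x" using assms(3) by eventually_elim simp
  then have "\<not> sq_integrable g"
    using False sq_integrable_cong_AE assms(1) by blast
  then show ?thesis using False by (simp add: to_l2_def)
qed

lemma to_l2_eqI:
  assumes "g \<in> borel_measurable borel" "AE x in lborel. rep_l2 f x = g x"
  shows "to_l2 g = f"
  using to_l2_cong_AE[OF _ assms] by simp

lemma to_l2_add:
  assumes "sq_integrable f" "sq_integrable g"
  shows "to_l2 (\<lambda>x. f x + g x) = to_l2 f + to_l2 g"
  using assms sq_integrable_add[OF assms]
  by (simp add: to_l2_def plus_l2.abs_eq l2_rel_def eq_onp_def)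

lemma to_l2_diff:
  assumes "sq_integrable f" "sq_integrable g"
  shows "to_l2 (\<lambda>x. f x - g x) = to_l2 f - to_l2 g"
  using assms sq_integrable_diff[OF assms]
  by (simp add: to_l2_def minus_l2.abs_eq l2_rel_def)

lemma to_l2_scaleR:
  assumes "sq_integrable f"
  shows "to_l2 (\<lambda>x. c *\<^sub>R f x) = c *\<^sub>R to_l2 f"
  using assms sq_integrable_scaleR[OF assms, of c]
  by (simp add: to_l2_def scaleR_l2.abs_eq l2_rel_def)

lemma to_l2_zero: "to_l2 (\<lambda>x. 0) = 0"
  by (simp add: to_l2_def zero_l2.abs_eq zero_l2_def)

lemma rep_l2_add: "AE x in lborel. rep_l2 (f + g) x = rep_l2 f x + rep_l2 g x"
  using rep_l2_to_l2[OF sq_integrable_add[OF sq_integrable_rep_l2[of f] sq_integrable_rep_l2[of g]]]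
  by (simp add: to_l2_add sq_integrable_rep_l2)

lemma rep_l2_diff: "AE x in lborel. rep_l2 (f - g) x = rep_l2 f x - rep_l2 g x"
  using rep_l2_to_l2[OF sq_integrable_diff[OF sq_integrable_rep_l2[of f] sq_integrable_rep_l2[of g]]]
  by (simp add: to_l2_diff sq_integrable_rep_l2)

lemma rep_l2_scaleR: "AE x in lborel. rep_l2 (c *\<^sub>R f) x = c *\<^sub>R rep_l2 f x"
  using rep_l2_to_l2[OF sq_integrable_scaleR[OF sq_integrable_rep_l2[of f]], of c]
  by (simp add: to_l2_scaleR sq_integrable_rep_l2)

lemma inner_l2_rep: "f \<bullet> g = (LINT x|lborel. rep_l2 f x \<bullet> rep_l2 g x)"
  by (simp add: inner_l2_def)

lemma inner_to_l2:
  assumes "sq_integrable f" "sq_integrable g"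
  shows "to_l2 f \<bullet> to_l2 g = (LINT x|lborel. f x \<bullet> g x)"
  using assms by (simp add: to_l2_def inner_l2.abs_eq l2_rel_def)

lemma norm_l2_sq: "(norm f)\<^sup>2 = (LINT x|lborel. (cmod (rep_l2 f x))\<^sup>2)"
  by (simp add: power2_norm_eq_inner inner_l2_rep)

lemma norm_to_l2_sq: "sq_integrable f \<Longrightarrow> (norm (to_l2 f))\<^sup>2 = (LINT x|lborel. (cmod (f x))\<^sup>2)"
  by (simp add: power2_norm_eq_inner inner_to_l2)

lemma norm_to_l2_le:
  assumes "sq_integrable f" "sq_integrable g" "0 \<le> C"
    and "AE x in lborel. cmod (f x) \<le> C * cmod (g x)"
  shows "norm (to_l2 f) \<le> C * norm (to_l2 g)"
proof -
  have "(norm (to_l2 f))\<^sup>2 = (LINT x|lborel. (cmod (f x))\<^sup>2)"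
    by (simp add: norm_to_l2_sq assms)
  also have "\<dots> \<le> (LINT x|lborel. C\<^sup>2 * (cmod (g x))\<^sup>2)"
  proof (rule integral_mono_AE)
    show "AE x in lborel. (cmod (f x))\<^sup>2 \<le> C\<^sup>2 * (cmod (g x))\<^sup>2"
      using assms(4)
    proof eventually_elim
      case (elim x)
      then show ?case using power_mono[of "cmod (f x)" "C * cmod (g x)" 2]
        by (simp add: power_mult_distrib)
    qed
  qed (use assms sq_integrableD in auto)
  also have "\<dots> = (C * norm (to_l2 g))\<^sup>2"
    by (simp add: norm_to_l2_sq assms power_mult_distrib)
  finally show ?thesis
    by (rule power2_le_imp_le) (simp add: assms)
qed

lemma integrable_mult_sq_integrable:
  assumes "sq_integrable f" "sq_integrable g"
  shows "integrable lborel (\<lambda>x. f x * g x)"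
proof -
  have "integrable lborel (\<lambda>x. (cmod (f x))\<^sup>2 + (cmod (g x))\<^sup>2)"
    using assms sq_integrableD by auto
  moreover have "cmod (f x * g x) \<le> (cmod (f x))\<^sup>2 + (cmod (g x))\<^sup>2" for x
    using sum_squares_bound[of "cmod (f x)" "cmod (g x)"]
      mult_nonneg_nonneg[OF norm_ge_zero[of "f x"] norm_ge_zero[of "g x"]]
    unfolding norm_mult by linarith
  ultimately show ?thesis
    using assms by (elim Bochner_Integration.integrable_bound)
      (auto intro!: AE_I2 order_trans[OF _ abs_ge_self])
qed

lemma norm_integral_mult_le:
  assumes "sq_integrable f" "sq_integrable g"
  shows "(LINT x|lborel. cmod (f x * g x)) \<le> norm (to_l2 f) * norm (to_l2 g)"
proof -
  let ?F = "\<lambda>x. complex_of_real (cmod (f x))" and ?G = "\<lambda>x. complex_of_real (cmod (g x))"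
  have s: "sq_integrable ?F" "sq_integrable ?G"
    using assms by (auto simp: sq_integrable_def)
  have "(LINT x|lborel. cmod (f x * g x)) = to_l2 ?F \<bullet> to_l2 ?G"
    using s by (simp add: inner_to_l2 norm_mult inner_complex_def)
  also have "\<dots> \<le> norm (to_l2 ?F) * norm (to_l2 ?G)"
    by (rule norm_cauchy_schwarz)
  also have "norm (to_l2 ?F) = norm (to_l2 f)"
    by (rule power2_eq_imp_eq) (simp_all add: norm_to_l2_sq s assms)
  also have "norm (to_l2 ?G) = norm (to_l2 g)"
    by (rule power2_eq_imp_eq) (simp_all add: norm_to_l2_sq s assms)
  finally show ?thesis .
qed

subsection \<open>Completeness\<close>

text \<open>
  Fatou's lemma in the index \<open>m\<close>, applied to \<open>\<bar>X m - X n\<bar>\<^sup>2\<close>, turns pointwise convergence into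
  convergence in norm; the Cauchy property supplies the bound that a dominating function would give.
\<close>

lemma l2_limit_of_AE_convergent:
  assumes "Cauchy X" "AE x in lborel. convergent (\<lambda>n. rep_l2 (X n) x)"
  shows "\<exists>g. X \<longlonglongrightarrow> g \<and> (AE x in lborel. (\<lambda>n. rep_l2 (X n) x) \<longlonglongrightarrow> rep_l2 g x)"
proof -
  define f where "f x = lim (\<lambda>n. rep_l2 (X n) x)" for x
  have lim: "AE x in lborel. (\<lambda>n. rep_l2 (X n) x) \<longlonglongrightarrow> f x"
    using assms(2) by eventually_elim (simp add: convergent_LIMSEQ_iff f_def)
  have [measurable]: "f \<in> borel_measurable borel"
    unfolding f_def by measurable
  have key: "(\<integral>\<^sup>+x. ennreal ((cmod (f x - rep_l2 (X n) x))\<^sup>2) \<partial>lborel) \<le> ennreal (e\<^sup>2)"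
    if "\<And>m. m \<ge> n \<Longrightarrow> norm (X m - X n) \<le> e" "e \<ge> 0" for n e
  proof -
    have "(\<integral>\<^sup>+x. ennreal ((cmod (f x - rep_l2 (X n) x))\<^sup>2) \<partial>lborel)
        = (\<integral>\<^sup>+x. liminf (\<lambda>m. ennreal ((cmod (rep_l2 (X m) x - rep_l2 (X n) x))\<^sup>2)) \<partial>lborel)"
    proof (rule nn_integral_cong_AE)
      show "AE x in lborel. ennreal ((cmod (f x - rep_l2 (X n) x))\<^sup>2)
        = liminf (\<lambda>m. ennreal ((cmod (rep_l2 (X m) x - rep_l2 (X n) x))\<^sup>2))"
        using lim
      proof eventually_elim
        case (elim x)
        have "(\<lambda>m. ennreal ((cmod (rep_l2 (X m) x - rep_l2 (X n) x))\<^sup>2))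
          \<longlonglongrightarrow> ennreal ((cmod (f x - rep_l2 (X n) x))\<^sup>2)"
          by (intro tendsto_intros tendsto_ennrealI elim)
        then show ?case by (metis lim_imp_Liminf sequentially_bot)
      qed
    qed
    also have "\<dots> \<le> liminf (\<lambda>m. \<integral>\<^sup>+x. ennreal ((cmod (rep_l2 (X m) x - rep_l2 (X n) x))\<^sup>2) \<partial>lborel)"
      by (rule nn_integral_liminf) measurable
    also have "\<dots> \<le> ennreal (e\<^sup>2)"
    proof (rule Liminf_le)
      show "\<forall>\<^sub>F m in sequentially.
        (\<integral>\<^sup>+x. ennreal ((cmod (rep_l2 (X m) x - rep_l2 (X n) x))\<^sup>2) \<partial>lborel) \<le> ennreal (e\<^sup>2)"
        using eventually_ge_at_top[of n]
      proof eventually_elim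
        case (elim m)
        have "(\<integral>\<^sup>+x. ennreal ((cmod (rep_l2 (X m) x - rep_l2 (X n) x))\<^sup>2) \<partial>lborel)
          = (\<integral>\<^sup>+x. ennreal ((cmod (rep_l2 (X m - X n) x))\<^sup>2) \<partial>lborel)"
          using rep_l2_diff[of "X m" "X n"] by (intro nn_integral_cong_AE) auto
        also have "\<dots> = ennreal ((norm (X m - X n))\<^sup>2)"
          by (simp add: norm_l2_sq nn_integral_eq_integral integrable_rep_l2)
        finally show ?case using that elim by (simp add: power_mono)
      qed
    qed simp
    finally show ?thesis .
  qed
  have fin: "sq_integrable (\<lambda>x. f x - rep_l2 (X n) x) \<and> norm (to_l2 (\<lambda>x. f x - rep_l2 (X n) x)) \<le> e"
    if "\<And>m. m \<ge> n \<Longrightarrow> norm (X m - X n) \<le> e" "e \<ge> 0" for n e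
  proof -
    have "(\<integral>\<^sup>+x. ennreal ((cmod (f x - rep_l2 (X n) x))\<^sup>2) \<partial>lborel) < \<infinity>"
      using key[OF that] ennreal_less_top le_less_trans by fastforce
    then have i: "integrable lborel (\<lambda>x. (cmod (f x - rep_l2 (X n) x))\<^sup>2)"
      by (intro integrableI_nonneg) auto
    then have s: "sq_integrable (\<lambda>x. f x - rep_l2 (X n) x)"
      by (simp add: sq_integrable_def)
    have "ennreal ((norm (to_l2 (\<lambda>x. f x - rep_l2 (X n) x)))\<^sup>2) \<le> ennreal (e\<^sup>2)"
      using key[OF that] by (simp add: norm_to_l2_sq s nn_integral_eq_integral i)
    then show ?thesis using s that(2) by (auto intro: power2_le_imp_le)
  qed
  have cau: "\<exists>N. \<forall>n\<ge>N. \<forall>m\<ge>n. norm (X m - X n) \<le> e" if "e > 0" for e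
    using assms(1) that unfolding Cauchy_iff by (meson less_imp_le order_trans)
  obtain N where "\<forall>m\<ge>N. norm (X m - X N) \<le> 1" using cau[of 1] by auto
  then have "sq_integrable (\<lambda>x. f x - rep_l2 (X N) x)" using fin[of N 1] by auto
  from sq_integrable_add[OF this sq_integrable_rep_l2[of "X N"]] have sf: "sq_integrable f" by simp
  have conv: "X \<longlonglongrightarrow> to_l2 f"
  proof (rule LIMSEQ_I)
    fix r :: real assume "r > 0"
    then obtain N where N: "\<forall>n\<ge>N. \<forall>m\<ge>n. norm (X m - X n) \<le> r/2" using cau[of "r/2"] by auto
    have "norm (X n - to_l2 f) < r" if "n \<ge> N" for n
    proof -
      have "norm (to_l2 (\<lambda>x. f x - rep_l2 (X n) x)) \<le> r/2"
        using fin[of n "r/2"] N that \<open>r > 0\<close> by auto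
      then show ?thesis using \<open>r > 0\<close>
        by (simp add: to_l2_diff sf sq_integrable_rep_l2 norm_minus_commute)
    qed
    then show "\<exists>N. \<forall>n\<ge>N. norm (X n - to_l2 f) < r" by blast
  qed
  have "AE x in lborel. (\<lambda>n. rep_l2 (X n) x) \<longlonglongrightarrow> rep_l2 (to_l2 f) x"
    using lim rep_l2_to_l2[OF sf] by eventually_elim simp
  with conv show ?thesis by blast
qed

text \<open>
  Let \<open>d n\<close> be the increments. The function \<open>\<Sum>n. 2\<^sup>n \<bar>d n\<bar>\<^sup>2\<close> has a finite integral, so it is finite
  almost everywhere, and at such points \<open>\<bar>d n\<bar>\<close> decays geometrically. The weight \<open>2\<^sup>n\<close> is affordable
  because the squared norms decay like \<open>4\<^bsup>-n\<^esup>\<close>; it takes the place of Minkowski's inequality for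
  infinite sums.
\<close>

lemma l2_fast_Cauchy_AE_convergent:
  assumes "\<And>n. norm (X (Suc n) - X n) \<le> (1/2)^n"
  shows "AE x in lborel. convergent (\<lambda>n. rep_l2 (X n) x)"
proof -
  define d where "d n x = rep_l2 (X (Suc n)) x - rep_l2 (X n) x" for n x
  have [measurable]: "d n \<in> borel_measurable borel" for n unfolding d_def by measurable
  have nn: "(\<integral>\<^sup>+x. ennreal (2^n * (cmod (d n x))\<^sup>2) \<partial>lborel) \<le> ennreal ((1/2)^n)" for n
  proof -
    have "(\<integral>\<^sup>+x. ennreal (2^n * (cmod (d n x))\<^sup>2) \<partial>lborel)
       = (\<integral>\<^sup>+x. ennreal (2^n * (cmod (rep_l2 (X (Suc n) - X n) x))\<^sup>2) \<partial>lborel)"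
      using rep_l2_diff[of "X (Suc n)" "X n"] by (intro nn_integral_cong_AE) (auto simp: d_def)
    also have "\<dots> = ennreal (2^n * (norm (X (Suc n) - X n))\<^sup>2)"
      by (simp add: norm_l2_sq nn_integral_eq_integral integrable_rep_l2)
    also have "2^n * (norm (X (Suc n) - X n))\<^sup>2 \<le> 2^n * ((1/2)^n)\<^sup>2"
      using assms[of n] by (intro mult_left_mono power_mono) auto
    also have "\<dots> = (1/2)^n"
      by (simp add: power2_eq_square power_mult_distrib[symmetric] flip: mult.assoc)
    finally show ?thesis by (simp add: ennreal_leI)
  qed
  have "(\<integral>\<^sup>+x. (\<Sum>n. ennreal (2^n * (cmod (d n x))\<^sup>2)) \<partial>lborel)
     = (\<Sum>n. \<integral>\<^sup>+x. ennreal (2^n * (cmod (d n x))\<^sup>2) \<partial>lborel)"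
    by (rule nn_integral_suminf) simp
  also have "\<dots> \<le> (\<Sum>n. ennreal ((1/2)^n))"
    by (intro suminf_le nn) auto
  also have "\<dots> < \<infinity>"
    by (subst suminf_ennreal2) (auto simp: summable_geometric)
  finally have "AE x in lborel. (\<Sum>n. ennreal (2^n * (cmod (d n x))\<^sup>2)) \<noteq> \<infinity>"
    by (intro nn_integral_PInf_AE) auto
  then show ?thesis
  proof eventually_elim
    case (elim x)
    then have "summable (\<lambda>n. 2^n * (cmod (d n x))\<^sup>2)"
      by (intro summable_suminf_not_top) auto
    then have "bounded (range (\<lambda>n. 2^n * (cmod (d n x))\<^sup>2))"
      using convergent_imp_bounded summable_LIMSEQ_zero by blast
    then obtain K where K: "\<And>n. \<bar>2^n * (cmod (d n x))\<^sup>2\<bar> \<le> K" unfolding bounded_iff by auto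
    have K': "(sqrt 2 ^ n * cmod (d n x))\<^sup>2 \<le> K" for n
    proof -
      have "(sqrt 2 ^ n)\<^sup>2 = ((sqrt 2)\<^sup>2)^n"
        by (simp only: power_mult[symmetric] mult.commute)
      then have "(sqrt 2 ^ n)\<^sup>2 = (2::real)^n" by simp
      then show ?thesis using K[of n] by (simp add: power_mult_distrib)
    qed
    have "cmod (d n x) \<le> sqrt K * (1 / sqrt 2)^n" for n
    proof -
      have "sqrt 2 ^ n * cmod (d n x) \<le> sqrt K"
        using K'[of n] by (rule real_le_rsqrt)
      then show ?thesis by (simp add: field_simps power_divide)
    qed
    then have le: "norm (d n x) \<le> sqrt K * (1 / sqrt 2)^n" if "n \<ge> 0" for n
      by simp
    have "summable (\<lambda>n. sqrt K * (1 / sqrt 2)^n)"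
      by (rule summable_mult, rule summable_geometric) simp
    then have "summable (\<lambda>n. d n x)"
      using le by (rule summable_comparison_test')
    then have "convergent (\<lambda>n. \<Sum>i<n. d i x)"
      by (simp add: summable_iff_convergent)
    then have "convergent (\<lambda>n. rep_l2 (X 0) x + (\<Sum>i<n. d i x))"
      by (intro convergent_add convergent_const)
    moreover have "rep_l2 (X 0) x + (\<Sum>i<n. d i x) = rep_l2 (X n) x" for n
      by (induction n) (simp_all add: d_def algebra_simps)
    ultimately show ?case by simp
  qed
qed

lemma Cauchy_fast_subseq:
  fixes X :: "nat \<Rightarrow> 'a::real_normed_vector"
  assumes "Cauchy X"
  shows "\<exists>r. strict_mono r \<and> (\<forall>n. norm (X (r (Suc n)) - X (r n)) \<le> (1/2)^n)"
proof -
  have "\<exists>N. \<forall>m\<ge>N. \<forall>n\<ge>N. norm (X m - X n) < (1/2)^k" for k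
    using CauchyD[OF assms, of "(1/2)^k"] by auto
  then obtain N where N: "\<And>k m n. m \<ge> N k \<Longrightarrow> n \<ge> N k \<Longrightarrow> norm (X m - X n) < (1/2)^k" by metis
  \<comment> \<open>the sum dominates \<open>N n\<close>, the summand \<open>n\<close> makes \<open>r\<close> strictly increasing\<close>
  define r where "r n = n + (\<Sum>k\<le>n. N k)" for n
  have "strict_mono r" unfolding strict_mono_Suc_iff r_def by simp
  moreover have "norm (X (r (Suc n)) - X (r n)) \<le> (1/2)^n" for n
  proof -
    have "N n \<le> (\<Sum>k\<le>n. N k)" by (rule member_le_sum) auto
    then have "N n \<le> r n" "N n \<le> r (Suc n)" by (auto simp: r_def)
    then show ?thesis using N[of n "r (Suc n)" "r n"] by simp
  qed
  ultimately show ?thesis by blast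
qed

instance l2 :: banach
proof
  fix X :: "nat \<Rightarrow> l2" assume C: "Cauchy X"
  obtain r where r: "strict_mono r" "\<And>n. norm (X (r (Suc n)) - X (r n)) \<le> (1/2)^n"
    using Cauchy_fast_subseq[OF C] by blast
  have c: "Cauchy (X \<circ> r)" using C r(1) by (rule Cauchy_subseq_Cauchy)
  have "norm ((X \<circ> r) (Suc n) - (X \<circ> r) n) \<le> (1/2)^n" for n
    using r(2)[of n] by (simp only: o_apply)
  then have "AE x in lborel. convergent (\<lambda>n. rep_l2 ((X \<circ> r) n) x)"
    by (rule l2_fast_Cauchy_AE_convergent)
  from l2_limit_of_AE_convergent[OF c this] obtain g where "(X \<circ> r) \<longlonglongrightarrow> g"
    by (elim exE conjE)
  from Cauchy_converges_subseq[OF C r(1) this] show "convergent X"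
    by (rule convergentI)
qed

text \<open>
  Identifies a limit in the mean that is computed pointwise, as with Gaussian approximations below.
\<close>

lemma l2_tendsto_AE_unique:
  assumes "X \<longlonglongrightarrow> g" "AE x in lborel. (\<lambda>n. rep_l2 (X n) x) \<longlonglongrightarrow> f x" "f \<in> borel_measurable borel"
  shows "to_l2 f = g"
proof -
  have "AE x in lborel. convergent (\<lambda>n. rep_l2 (X n) x)"
    using assms(2) by eventually_elim (auto simp: convergent_def)
  from l2_limit_of_AE_convergent[OF LIMSEQ_imp_Cauchy[OF assms(1)] this]
  obtain h where h: "X \<longlonglongrightarrow> h" "AE x in lborel. (\<lambda>n. rep_l2 (X n) x) \<longlonglongrightarrow> rep_l2 h x"
    by (elim exE conjE)
  have eq: "h = g" using h(1) assms(1) by (rule LIMSEQ_unique)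
  have "AE x in lborel. rep_l2 g x = f x"
    using assms(2) h(2)
  proof eventually_elim
    case (elim x)
    from LIMSEQ_unique[OF elim(2,1)] show ?case by (simp only: eq)
  qed
  with assms(3) show ?thesis by (rule to_l2_eqI)
qed

subsection \<open>Multiplication operators\<close>

definition l2_mult :: "(real \<Rightarrow> complex) \<Rightarrow> l2 \<Rightarrow> l2" where
  "l2_mult m f = to_l2 (\<lambda>x. m x * rep_l2 f x)"

definition bdd_symbol :: "(real \<Rightarrow> complex) \<Rightarrow> bool" where
  "bdd_symbol m \<longleftrightarrow> m \<in> borel_measurable borel \<and> (\<exists>C. \<forall>x. cmod (m x) \<le> C)"

lemma bdd_symbolI: "m \<in> borel_measurable borel \<Longrightarrow> (\<And>x. cmod (m x) \<le> C) \<Longrightarrow> bdd_symbol m"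
  by (auto simp: bdd_symbol_def)

lemma bdd_symbol_measurable [simp, measurable_dest]: "bdd_symbol m \<Longrightarrow> m \<in> borel_measurable borel"
  by (simp add: bdd_symbol_def)

lemma bdd_symbol_const [simp]: "bdd_symbol (\<lambda>_. c)"
  by (auto simp: bdd_symbol_def)

lemma bdd_symbol_mult: "bdd_symbol m \<Longrightarrow> bdd_symbol n \<Longrightarrow> bdd_symbol (\<lambda>x. m x * n x)"
proof -
  assume a: "bdd_symbol m" "bdd_symbol n"
  then obtain C D where "\<And>x. cmod (m x) \<le> C" "\<And>x. cmod (n x) \<le> D" by (auto simp: bdd_symbol_def)
  then have "cmod (m x * n x) \<le> C * D" for x
    unfolding norm_mult by (intro mult_mono) (auto intro: order_trans[OF norm_ge_zero])
  with a show ?thesis by (intro bdd_symbolI[where C="C*D"]) auto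
qed

lemma borel_measurable_cnj [measurable (raw)]:
  "f \<in> borel_measurable M \<Longrightarrow> (\<lambda>x. cnj (f x)) \<in> borel_measurable M"
  by (rule borel_measurable_continuous_on[OF continuous_on_cnj[OF continuous_on_id]])

lemma bdd_symbol_cnj: "bdd_symbol m \<Longrightarrow> bdd_symbol (\<lambda>x. cnj (m x))"
  by (auto simp: bdd_symbol_def)

lemma sq_integrable_mult_bdd:
  assumes "bdd_symbol m" "sq_integrable f"
  shows "sq_integrable (\<lambda>x. m x * f x)"
proof -
  obtain C where "\<And>x. cmod (m x) \<le> C" using assms by (auto simp: bdd_symbol_def)
  then show ?thesis using assms
    by (intro sq_integrable_bound[OF assms(2), where C=C]) (auto simp: norm_mult mult_right_mono)
qed

lemma sq_integrable_mult_rep: "bdd_symbol m \<Longrightarrow> sq_integrable (\<lambda>x. m x * rep_l2 f x)"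
  by (simp add: sq_integrable_mult_bdd sq_integrable_rep_l2)

lemma rep_l2_mult: "bdd_symbol m \<Longrightarrow> AE x in lborel. rep_l2 (l2_mult m f) x = m x * rep_l2 f x"
  unfolding l2_mult_def by (intro rep_l2_to_l2 sq_integrable_mult_rep)

lemma l2_mult_to_l2:
  assumes "m \<in> borel_measurable borel" "sq_integrable f"
  shows "l2_mult m (to_l2 f) = to_l2 (\<lambda>x. m x * f x)"
  unfolding l2_mult_def using assms rep_l2_to_l2[OF assms(2)] by (intro to_l2_cong_AE) auto

lemma norm_l2_mult_le:
  assumes "m \<in> borel_measurable borel" "\<And>x. cmod (m x) \<le> C"
  shows "norm (l2_mult m f) \<le> C * norm f"
proof -
  have C: "0 \<le> C" using assms(2)[of 0] norm_ge_zero order_trans by blast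
  have "norm (l2_mult m f) \<le> C * norm (to_l2 (rep_l2 f))"
    unfolding l2_mult_def using assms C
    by (intro norm_to_l2_le sq_integrable_mult_rep sq_integrable_rep_l2 bdd_symbolI)
       (auto simp: norm_mult mult_right_mono)
  then show ?thesis by simp
qed

lemma bounded_linear_l2_mult:
  assumes "bdd_symbol m"
  shows "bounded_linear (l2_mult m)"
proof -
  obtain C where C: "m \<in> borel_measurable borel" "\<And>x. cmod (m x) \<le> C"
    using assms by (auto simp: bdd_symbol_def)
  show ?thesis
  proof (rule bounded_linear_intro)
    fix f g :: l2 and r :: real
    show "l2_mult m (f + g) = l2_mult m f + l2_mult m g"
      unfolding l2_mult_def using rep_l2_add[of f g] C(1)
      by (subst to_l2_add[symmetric])
         (auto intro!: to_l2_cong_AE sq_integrable_mult_rep assms simp: algebra_simps elim: eventually_mono)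
    show "l2_mult m (r *\<^sub>R f) = r *\<^sub>R l2_mult m f"
      unfolding l2_mult_def using rep_l2_scaleR[of r f] C(1)
      by (subst to_l2_scaleR[symmetric])
         (auto intro!: to_l2_cong_AE sq_integrable_mult_rep assms simp: algebra_simps elim: eventually_mono)
    show "norm (l2_mult m f) \<le> norm f * C"
      using norm_l2_mult_le[OF C] by (simp add: mult.commute)
  qed
qed

lemma l2_mult_l2_mult:
  assumes "m \<in> borel_measurable borel" "bdd_symbol n"
  shows "l2_mult m (l2_mult n f) = l2_mult (\<lambda>x. m x * n x) f"
  unfolding l2_mult_def[of n]
  by (subst l2_mult_to_l2) (auto simp: l2_mult_def mult.assoc assms sq_integrable_mult_rep)

lemma l2_mult_one [simp]: "l2_mult (\<lambda>_. 1) f = f"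
  by (simp add: l2_mult_def)

lemma norm_l2_mult_unimodular:
  assumes "m \<in> borel_measurable borel" "\<And>x. cmod (m x) = 1"
  shows "norm (l2_mult m f) = norm f"
proof -
  have b: "bdd_symbol m" using assms by (intro bdd_symbolI[where C=1]) auto
  show ?thesis
    unfolding l2_mult_def
    by (rule power2_eq_imp_eq) (simp_all add: norm_to_l2_sq sq_integrable_mult_rep b norm_mult assms flip: norm_l2_sq)
qed

lemma inner_l2_mult:
  assumes "bdd_symbol m"
  shows "l2_mult m f \<bullet> g = (LINT x|lborel. (m x * rep_l2 f x) \<bullet> rep_l2 g x)"
proof -
  have "l2_mult m f \<bullet> to_l2 (rep_l2 g) = (LINT x|lborel. (m x * rep_l2 f x) \<bullet> rep_l2 g x)"
    unfolding l2_mult_def by (intro inner_to_l2 sq_integrable_mult_rep sq_integrable_rep_l2 assms)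
  then show ?thesis by simp
qed

lemma inner_l2_mult_cnj:
  assumes "bdd_symbol m"
  shows "l2_mult m f \<bullet> g = f \<bullet> l2_mult (\<lambda>x. cnj (m x)) g"
proof -
  have "bdd_symbol (\<lambda>x. cnj (m x))" using assms by (rule bdd_symbol_cnj)
  then have "f \<bullet> l2_mult (\<lambda>x. cnj (m x)) g = (LINT x|lborel. (cnj (m x) * rep_l2 g x) \<bullet> rep_l2 f x)"
    by (subst inner_commute) (rule inner_l2_mult)
  also have "\<dots> = (LINT x|lborel. (m x * rep_l2 f x) \<bullet> rep_l2 g x)"
    by (intro Bochner_Integration.integral_cong refl) (simp add: inner_complex_def algebra_simps)
  finally show ?thesis by (simp add: inner_l2_mult assms)
qed

text \<open>
  Dominated convergence, with a multiple of \<open>\<bar>f\<bar>\<^sup>2\<close> as the dominating function. The symbols are compared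
  pointwise, so this yields truncation to bounded intervals, Gaussian damping and the strong
  continuity of the group of the equation alike.
\<close>

lemma tendsto_l2_mult:
  assumes "\<And>n. m n \<in> borel_measurable borel" "\<And>n x. cmod (m n x) \<le> C"
    and m0: "m0 \<in> borel_measurable borel" "\<And>x. cmod (m0 x) \<le> C"
    and lim: "AE x in lborel. (\<lambda>n. m n x) \<longlonglongrightarrow> m0 x"
  shows "(\<lambda>n. l2_mult (m n) f) \<longlonglongrightarrow> l2_mult m0 f"
proof -
  have [measurable]: "m n \<in> borel_measurable borel" "m0 \<in> borel_measurable borel" for n
    using assms by auto
  have b: "bdd_symbol (m n)" "bdd_symbol m0" for n
    by (rule bdd_symbolI[where C=C]; fact)+
  have C: "cmod (m n x - m0 x) \<le> 2 * C" for n x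
    using norm_triangle_ineq4[of "m n x" "m0 x"] assms(2)[of n x] m0(2)[of x] by linarith
  have eq: "(norm (l2_mult (m n) f - l2_mult m0 f))\<^sup>2
     = (LINT x|lborel. (cmod ((m n x - m0 x) * rep_l2 f x))\<^sup>2)" for n
  proof -
    have e: "l2_mult (m n) f - l2_mult m0 f = to_l2 (\<lambda>x. m n x * rep_l2 f x - m0 x * rep_l2 f x)"
      by (simp add: l2_mult_def to_l2_diff sq_integrable_mult_rep b)
    have i: "sq_integrable (\<lambda>x. m n x * rep_l2 f x - m0 x * rep_l2 f x)"
      by (rule sq_integrable_diff; rule sq_integrable_mult_rep; rule b)
    show ?thesis
      unfolding e norm_to_l2_sq[OF i] left_diff_distrib ..
  qed
  define h where "h n x = (cmod ((m n x - m0 x) * rep_l2 f x))\<^sup>2" for n x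
  have [measurable]: "h n \<in> borel_measurable borel" for n
    unfolding h_def by measurable
  have h_lim: "AE x in lborel. (\<lambda>n. h n x) \<longlonglongrightarrow> 0"
    using lim
  proof eventually_elim
    case (elim x)
    have "(\<lambda>n. h n x) \<longlonglongrightarrow> (cmod ((m0 x - m0 x) * rep_l2 f x))\<^sup>2"
      unfolding h_def by (intro tendsto_intros elim)
    then show ?case by simp
  qed
  have h_le: "norm (h n x) \<le> (2 * C)\<^sup>2 * (cmod (rep_l2 f x))\<^sup>2" for n x
  proof -
    have "(cmod (m n x - m0 x))\<^sup>2 \<le> (2*C)\<^sup>2" using C[of n x] by (rule power_mono) simp
    then have "(cmod (m n x - m0 x))\<^sup>2 * (cmod (rep_l2 f x))\<^sup>2 \<le> (2*C)\<^sup>2 * (cmod (rep_l2 f x))\<^sup>2"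
      by (rule mult_right_mono) simp
    moreover have "norm (h n x) = (cmod (m n x - m0 x))\<^sup>2 * (cmod (rep_l2 f x))\<^sup>2"
      by (simp add: h_def norm_mult power_mult_distrib)
    ultimately show ?thesis by simp
  qed
  have "(\<lambda>n. integral\<^sup>L lborel (h n)) \<longlonglongrightarrow> integral\<^sup>L lborel (\<lambda>x::real. 0 :: real)"
  proof (rule integral_dominated_convergence[where w="\<lambda>x. (2 * C)\<^sup>2 * (cmod (rep_l2 f x))\<^sup>2"])
    show "integrable lborel (\<lambda>x. (2 * C)\<^sup>2 * (cmod (rep_l2 f x))\<^sup>2)"
      by (rule integrable_mult_right[OF integrable_rep_l2])
    show "AE x in lborel. (\<lambda>n. h n x) \<longlonglongrightarrow> 0" by (rule h_lim)
    show "AE x in lborel. norm (h n x) \<le> (2 * C)\<^sup>2 * (cmod (rep_l2 f x))\<^sup>2" for n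
      by (rule AE_I2) (rule h_le)
  qed simp_all
  then have lim0: "(\<lambda>n. integral\<^sup>L lborel (h n)) \<longlonglongrightarrow> 0"
    by (simp only: Bochner_Integration.integral_zero)
  have eq': "norm (l2_mult (m n) f - l2_mult m0 f) = sqrt (integral\<^sup>L lborel (h n))" for n
    using eq[of n] unfolding h_def by (simp add: real_sqrt_unique)
  have "(\<lambda>n. sqrt (integral\<^sup>L lborel (h n))) \<longlonglongrightarrow> 0"
    using tendsto_real_sqrt[OF lim0] by (simp only: real_sqrt_zero)
  then have "(\<lambda>n. norm (l2_mult (m n) f - l2_mult m0 f)) \<longlonglongrightarrow> 0"
    by (simp only: eq')
  then have "(\<lambda>n. l2_mult (m n) f - l2_mult m0 f) \<longlonglongrightarrow> 0"
    by (rule tendsto_norm_zero_cancel)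
  then show ?thesis by (rule LIM_zero_cancel)
qed

section \<open>Convolution\<close>

text \<open>
  The exceptional set is replaced by a Borel null set that contains it, so \<open>P\<close> may be any predicate.
\<close>

lemma AE_lborel_affine:
  fixes c t :: real
  assumes "c \<noteq> 0" "AE x in lborel. P x"
  shows "AE x in lborel. P (t + c * x)"
proof -
  from assms(2) obtain N where N: "{x \<in> space lborel. \<not> P x} \<subseteq> N" "emeasure lborel N = 0" "N \<in> sets lborel"
    by (rule AE_E)
  have "AE x in lborel. x \<notin> N" using N by (intro AE_not_in) auto
  then have "AE x in lborel. t + c * x \<notin> N"
    using N(3) by (intro AE_borel_affine assms) auto
  then show ?thesis by eventually_elim (use N(1) in auto)
qed

lemma AE_lborel_uminus: "AE x in lborel. P x \<Longrightarrow> AE x in lborel. P (- x :: real)"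
  using AE_lborel_affine[of "-1" P 0] by simp

lemma integral_lborel_reflect:
  fixes f :: "real \<Rightarrow> 'a :: {banach, second_countable_topology}"
  shows "(LINT y|lborel. f (t - y)) = integral\<^sup>L lborel f"
  using lborel_integral_real_affine[of "-1" f t] by simp

lemma integrable_lborel_reflect_iff:
  fixes f :: "real \<Rightarrow> 'a :: {banach, second_countable_topology}"
  shows "integrable lborel (\<lambda>y. f (t - y)) \<longleftrightarrow> integrable lborel f"
  using lborel_integrable_real_affine_iff[of "-1" f t] by simp

lemma integral_lborel_shift:
  fixes f :: "real \<Rightarrow> 'a :: {banach, second_countable_topology}"
  shows "(LINT y|lborel. f (y - t)) = integral\<^sup>L lborel f"
  using lborel_integral_real_affine[of 1 f "-t"] by simp

lemma integrable_lborel_shift_iff: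
  fixes f :: "real \<Rightarrow> 'a :: {banach, second_countable_topology}"
  shows "integrable lborel (\<lambda>y. f (y - t)) \<longleftrightarrow> integrable lborel f"
  using lborel_integrable_real_affine_iff[of 1 f "-t"] by simp

lemma integrable_conv_kernel:
  fixes a b :: "real \<Rightarrow> 'a :: {real_normed_field, banach, second_countable_topology}"
  assumes "integrable lborel a" "integrable lborel b"
  shows "integrable (lborel \<Otimes>\<^sub>M lborel) (\<lambda>(y, x). a y * b (x - y))"
proof (rule lborel_pair.Fubini_integrable)
  have [measurable]: "a \<in> borel_measurable borel" "b \<in> borel_measurable borel"
    using assms by auto
  show "(\<lambda>(y, x). a y * b (x - y)) \<in> borel_measurable (lborel \<Otimes>\<^sub>M lborel)"
    by measurable
  have "(\<lambda>y. LINT x|lborel. norm (case (y, x) of (y, x) \<Rightarrow> a y * b (x - y)))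
      = (\<lambda>y. norm (a y) * (LINT x|lborel. norm (b x)))"
    using integral_lborel_shift[of "\<lambda>x. norm (b x)"] by (simp add: norm_mult)
  then show "integrable lborel (\<lambda>y. LINT x|lborel. norm (case (y, x) of (y, x) \<Rightarrow> a y * b (x - y)))"
    using assms(1) by simp
  show "AE y in lborel. integrable lborel (\<lambda>x. case (y, x) of (y, x) \<Rightarrow> a y * b (x - y))"
    using assms(2) by (intro AE_I2) (simp add: integrable_lborel_shift_iff)
qed

definition conv :: "(real \<Rightarrow> complex) \<Rightarrow> (real \<Rightarrow> complex) \<Rightarrow> real \<Rightarrow> complex" where
  "conv a b x = (LINT y|lborel. a y * b (x - y))"

lemma conv_measurable [measurable (raw)]:
  assumes [measurable]: "a \<in> borel_measurable borel" "b \<in> borel_measurable borel"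
  shows "conv a b \<in> borel_measurable borel"
proof -
  have "(\<lambda>x. LINT y|lborel. a y * b (x - y)) \<in> borel_measurable borel"
    by measurable
  then show ?thesis by (simp add: conv_def[abs_def])
qed

lemma conv_commute: "conv a b x = conv b a x"
  using integral_lborel_reflect[of "\<lambda>y. a y * b (x - y)" x]
  by (simp add: conv_def mult.commute)

lemma conv_cong_AE:
  assumes "a \<in> borel_measurable borel" "a' \<in> borel_measurable borel"
    and "b \<in> borel_measurable borel" "b' \<in> borel_measurable borel"
    and "AE x in lborel. a x = a' x" "AE x in lborel. b x = b' x"
  shows "conv a b x = conv a' b' x"
proof -
  have [measurable]: "a \<in> borel_measurable borel" "a' \<in> borel_measurable borel"
    "b \<in> borel_measurable borel" "b' \<in> borel_measurable borel"
    by fact+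
  have "AE y in lborel. b (x - y) = b' (x - y)"
    using AE_lborel_affine[of "-1" _ x, OF _ assms(6)] by simp
  then have "AE y in lborel. a y * b (x - y) = a' y * b' (x - y)"
    using assms(5) by eventually_elim simp
  then show ?thesis
    unfolding conv_def by (intro integral_cong_AE) auto
qed

lemma integrable_conv:
  assumes "integrable lborel a" "integrable lborel b"
  shows "integrable lborel (conv a b)"
  using lborel_pair.integrable_snd[OF integrable_conv_kernel[OF assms]]
  by (simp add: conv_def[abs_def])

lemma sq_integrable_reflect:
  assumes "sq_integrable b"
  shows "sq_integrable (\<lambda>y. b (t - y))"
  using assms integrable_lborel_reflect_iff[of "\<lambda>y. (cmod (b y))\<^sup>2" t]
  unfolding sq_integrable_def by auto

lemma norm_to_l2_reflect:
  assumes "sq_integrable b"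
  shows "norm (to_l2 (\<lambda>y. b (t - y))) = norm (to_l2 b)"
  by (rule power2_eq_imp_eq)
     (simp_all add: norm_to_l2_sq sq_integrable_reflect assms integral_lborel_reflect[of "\<lambda>y. (cmod (b y))\<^sup>2" t])

lemma integrable_conv_integrand:
  assumes "sq_integrable a" "sq_integrable b"
  shows "integrable lborel (\<lambda>y. a y * b (x - y))"
  by (rule integrable_mult_sq_integrable[OF assms(1) sq_integrable_reflect[OF assms(2)]])

text \<open>
  Cauchy-Schwarz for the factorisation of the integrand into \<open>\<bar>a\<bar>\<^bsup>1/2\<^esup>\<close> and \<open>\<bar>a\<bar>\<^bsup>1/2\<^esup> \<bar>b\<bar>\<close>.
\<close>

lemma Young_pointwise:
  assumes a: "integrable lborel a" and b: "b \<in> borel_measurable borel"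
    and ab: "integrable lborel (\<lambda>y. cmod (a y) * (cmod (b (x - y)))\<^sup>2)"
  shows "(cmod (conv a b x))\<^sup>2
    \<le> (LINT y|lborel. cmod (a y)) * (LINT y|lborel. cmod (a y) * (cmod (b (x - y)))\<^sup>2)"
proof -
  let ?f = "\<lambda>y. complex_of_real (sqrt (cmod (a y)))"
  let ?g = "\<lambda>y. complex_of_real (sqrt (cmod (a y)) * cmod (b (x - y)))"
  have [measurable]: "a \<in> borel_measurable borel" "b \<in> borel_measurable borel" using a b by auto
  have f: "sq_integrable ?f" using a by (simp add: sq_integrable_def)
  have g: "sq_integrable ?g" using ab
    by (simp add: sq_integrable_def power_mult_distrib norm_mult del: of_real_mult)
  have "cmod (conv a b x) \<le> (LINT y|lborel. cmod (a y * b (x - y)))"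
    unfolding conv_def by (rule integral_norm_bound)
  also have "\<dots> = (LINT y|lborel. cmod (?f y * ?g y))"
    by (rule Bochner_Integration.integral_cong) (simp_all add: norm_mult flip: mult.assoc)
  also have "\<dots> \<le> norm (to_l2 ?f) * norm (to_l2 ?g)"
    by (rule norm_integral_mult_le[OF f g])
  finally have "(cmod (conv a b x))\<^sup>2 \<le> (norm (to_l2 ?f) * norm (to_l2 ?g))\<^sup>2"
    by (rule power_mono) simp
  also have "\<dots> = (LINT y|lborel. cmod (a y)) * (LINT y|lborel. cmod (a y) * (cmod (b (x - y)))\<^sup>2)"
    by (simp add: power_mult_distrib norm_to_l2_sq[OF f] norm_to_l2_sq[OF g] norm_mult del: of_real_mult)
  finally show ?thesis .
qed

lemma Young_L1_L2:
  assumes a: "integrable lborel a" and b: "sq_integrable b"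
  shows "sq_integrable (conv a b)"
    and "norm (to_l2 (conv a b)) \<le> (LINT y|lborel. cmod (a y)) * norm (to_l2 b)"
proof -
  let ?A = "LINT y|lborel. cmod (a y)"
  have A0: "0 \<le> ?A" by simp
  have [measurable]: "a \<in> borel_measurable borel" "b \<in> borel_measurable borel" using a b by auto
  let ?h = "\<lambda>x. LINT y|lborel. cmod (a y) * (cmod (b (x - y)))\<^sup>2"
  have k: "integrable (lborel \<Otimes>\<^sub>M lborel) (\<lambda>(y, x). cmod (a y) * (cmod (b (x - y)))\<^sup>2)"
    using integrable_conv_kernel[of "\<lambda>y. cmod (a y)" "\<lambda>x. (cmod (b x))\<^sup>2"] a sq_integrableD[OF b] by simp
  have h: "integrable lborel ?h"
    using lborel_pair.integrable_snd[OF k] .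
  have ae: "AE x in lborel. (cmod (conv a b x))\<^sup>2 \<le> ?A * ?h x"
    using lborel_pair.AE_integrable_snd[OF k]
  proof eventually_elim
    case (elim x)
    show ?case using a elim by (intro Young_pointwise) auto
  qed
  have "integrable lborel (\<lambda>x. (cmod (conv a b x))\<^sup>2)"
  proof (rule Bochner_Integration.integrable_bound)
    show "integrable lborel (\<lambda>x. ?A * ?h x)" using h by (rule integrable_mult_right)
    show "(\<lambda>x. (cmod (conv a b x))\<^sup>2) \<in> borel_measurable lborel" by measurable
    show "AE x in lborel. norm ((cmod (conv a b x))\<^sup>2) \<le> norm (?A * ?h x)"
      using ae
    proof eventually_elim
      case (elim x)
      show ?case
        unfolding real_norm_def abs_of_nonneg[OF zero_le_power2] by (rule order_trans[OF elim abs_ge_self])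
    qed
  qed
  then show s: "sq_integrable (conv a b)" by (simp add: sq_integrable_def)
  have "(norm (to_l2 (conv a b)))\<^sup>2 = (LINT x|lborel. (cmod (conv a b x))\<^sup>2)"
    by (rule norm_to_l2_sq[OF s])
  also have "\<dots> \<le> (LINT x|lborel. ?A * ?h x)"
    using ae h sq_integrableD[OF s] by (intro integral_mono_AE integrable_mult_right) auto
  also have "\<dots> = ?A * (LINT x|lborel. ?h x)"
    by simp
  also have "(LINT x|lborel. ?h x) = (LINT y|lborel. LINT x|lborel. cmod (a y) * (cmod (b (x - y)))\<^sup>2)"
    using lborel_pair.Fubini_integral[OF k] .
  also have "\<dots> = ?A * (norm (to_l2 b))\<^sup>2"
    using integral_lborel_shift[of "\<lambda>x. (cmod (b x))\<^sup>2"] by (simp add: norm_to_l2_sq[OF b])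
  finally have "(norm (to_l2 (conv a b)))\<^sup>2 \<le> (?A * norm (to_l2 b))\<^sup>2"
    by (simp add: power2_eq_square mult_ac)
  then show "norm (to_l2 (conv a b)) \<le> ?A * norm (to_l2 b)"
    by (rule power2_le_imp_le) (simp add: A0)
qed

section \<open>The Fourier integral\<close>

text \<open>
  The character \<open>e\<^bsup>-iy\<^esup>\<close>. With this sign \<open>ft\<close> is the transform, and inverse transforms are values of \<open>ft\<close> at reflected
  arguments, up to the factor \<open>2\<pi>\<close>.
\<close>

definition chr :: "real \<Rightarrow> complex" where
  "chr y = exp (- \<i> * of_real y)"

lemma norm_chr [simp]: "cmod (chr y) = 1"
  by (simp add: chr_def norm_exp_eq_Re)

lemma chr_add: "chr (x + y) = chr x * chr y"
  by (simp add: chr_def exp_add[symmetric] algebra_simps)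

lemma chr_0 [simp]: "chr 0 = 1"
  by (simp add: chr_def)

lemma cnj_chr [simp]: "cnj (chr y) = chr (- y)"
  by (simp add: chr_def exp_cnj)

lemma chr_measurable [measurable (raw)]:
  "f \<in> borel_measurable M \<Longrightarrow> (\<lambda>x. chr (f x)) \<in> borel_measurable M"
  unfolding chr_def by measurable

definition ft :: "(real \<Rightarrow> complex) \<Rightarrow> real \<Rightarrow> complex" where
  "ft f \<xi> = (LINT x|lborel. chr (x * \<xi>) * f x)"

lemma ft_measurable [measurable (raw)]:
  assumes [measurable]: "f \<in> borel_measurable borel"
  shows "ft f \<in> borel_measurable borel"
proof -
  have "(\<lambda>\<xi>. LINT x|lborel. chr (x * \<xi>) * f x) \<in> borel_measurable borel"
    by measurable
  then show ?thesis by (simp add: ft_def[abs_def])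
qed

lemma integrable_chr_mult:
  assumes "integrable lborel f"
  shows "integrable lborel (\<lambda>x. chr (x * \<xi>) * f x)"
proof (rule Bochner_Integration.integrable_bound[OF assms])
  have [measurable]: "f \<in> borel_measurable borel" using assms by auto
  show "(\<lambda>x. chr (x * \<xi>) * f x) \<in> borel_measurable lborel" by measurable
qed (simp add: norm_mult)

lemma ft_add: "integrable lborel f \<Longrightarrow> integrable lborel g \<Longrightarrow> ft (\<lambda>x. f x + g x) \<xi> = ft f \<xi> + ft g \<xi>"
  by (simp add: ft_def distrib_left integrable_chr_mult)

lemma ft_diff: "integrable lborel f \<Longrightarrow> integrable lborel g \<Longrightarrow> ft (\<lambda>x. f x - g x) \<xi> = ft f \<xi> - ft g \<xi>"
  by (simp add: ft_def right_diff_distrib integrable_chr_mult)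

lemma ft_cmult: "ft (\<lambda>x. c * f x) \<xi> = c * ft f \<xi>"
  by (simp add: ft_def mult.left_commute[of _ c])

lemma ft_cong_AE:
  assumes "f \<in> borel_measurable borel" "g \<in> borel_measurable borel" "AE x in lborel. f x = g x"
  shows "ft f \<xi> = ft g \<xi>"
proof -
  have [measurable]: "f \<in> borel_measurable borel" "g \<in> borel_measurable borel" by fact+
  show ?thesis unfolding ft_def using assms(3) by (intro integral_cong_AE) auto
qed

lemma norm_ft_le: "integrable lborel f \<Longrightarrow> cmod (ft f \<xi>) \<le> (LINT x|lborel. cmod (f x))"
  using integral_norm_bound[of lborel "\<lambda>x. chr (x * \<xi>) * f x"] by (simp add: ft_def norm_mult)

lemma ft_reflect: "ft (\<lambda>x. f (- x)) \<xi> = ft f (- \<xi>)"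
  using integral_lborel_reflect[of "\<lambda>x. chr (x * - \<xi>) * f x" 0] by (simp add: ft_def)

lemma ft_cnj: "ft (\<lambda>x. cnj (f x)) \<xi> = cnj (ft f (- \<xi>))"
  unfolding ft_def Bochner_Integration.integral_cnj[symmetric] by simp

lemma integrable_prod_kernel:
  assumes "integrable lborel f" "integrable lborel g"
  shows "integrable (lborel \<Otimes>\<^sub>M lborel) (\<lambda>(x, \<xi>). chr (x * \<xi>) * (f x * g \<xi>))"
proof (rule lborel_pair.Fubini_integrable)
  have [measurable]: "f \<in> borel_measurable borel" "g \<in> borel_measurable borel"
    using assms by auto
  show "(\<lambda>(x, \<xi>). chr (x * \<xi>) * (f x * g \<xi>)) \<in> borel_measurable (lborel \<Otimes>\<^sub>M lborel)"
    by measurable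
  have "(\<lambda>x. LINT \<xi>|lborel. norm (case (x, \<xi>) of (x, \<xi>) \<Rightarrow> chr (x * \<xi>) * (f x * g \<xi>)))
      = (\<lambda>x. cmod (f x) * (LINT \<xi>|lborel. cmod (g \<xi>)))"
    by (simp add: norm_mult)
  then show "integrable lborel (\<lambda>x. LINT \<xi>|lborel. norm (case (x, \<xi>) of (x, \<xi>) \<Rightarrow> chr (x * \<xi>) * (f x * g \<xi>)))"
    using assms(1) by simp
  show "AE x in lborel. integrable lborel (\<lambda>\<xi>. case (x, \<xi>) of (x, \<xi>) \<Rightarrow> chr (x * \<xi>) * (f x * g \<xi>))"
  proof (rule AE_I2)
    fix x
    have "integrable lborel (\<lambda>\<xi>. f x * (chr (\<xi> * x) * g \<xi>))"
      by (intro integrable_mult_right integrable_chr_mult assms)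
    then show "integrable lborel (\<lambda>\<xi>. case (x, \<xi>) of (x, \<xi>) \<Rightarrow> chr (x * \<xi>) * (f x * g \<xi>))"
      by (simp add: mult_ac)
  qed
qed

text \<open>
  Fubini's theorem for the kernel \<open>chr (x \<xi>)\<close>. It moves the transform from one factor to the other and
  is the source of both the regularised inversion formula and the adjoint of the transform.
\<close>

lemma ft_multiplication_formula:
  assumes "integrable lborel f" "integrable lborel g"
  shows "(LINT \<xi>|lborel. ft f \<xi> * g \<xi>) = (LINT x|lborel. f x * ft g x)"
proof -
  have "(LINT \<xi>|lborel. ft f \<xi> * g \<xi>) = (LINT \<xi>|lborel. LINT x|lborel. chr (x * \<xi>) * (f x * g \<xi>))"
    unfolding ft_def by (simp flip: integral_mult_left_zero add: mult.assoc)
  also have "\<dots> = (LINT x|lborel. LINT \<xi>|lborel. chr (x * \<xi>) * (f x * g \<xi>))"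
    using lborel_pair.Fubini_integral[OF integrable_prod_kernel[OF assms]] .
  also have "\<dots> = (LINT x|lborel. f x * ft g x)"
    unfolding ft_def by (simp flip: integral_mult_right_zero add: mult_ac)
  finally show ?thesis .
qed

subsection \<open>Gaussian regularisation\<close>

text \<open>
  The damping factor on the Fourier side. Its transform is \<open>2\<pi>\<close> times \<open>nd e\<close>, the normal density of
  standard deviation \<open>e\<close>, so that damping by \<open>gs e\<close> with \<open>e\<close> near \<open>0\<close> amounts to averaging over a
  small scale.
\<close>

definition gs :: "real \<Rightarrow> real \<Rightarrow> complex" where
  "gs e \<xi> = of_real (exp (- (e * \<xi>)\<^sup>2 / 2))"

lemma gs_measurable [measurable]: "gs e \<in> borel_measurable borel"
  unfolding gs_def by measurable

lemma norm_gs_le: "cmod (gs e \<xi>) \<le> 1"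
  by (simp add: gs_def)

lemma gs_eq_density: "gs e \<xi> = of_real (sqrt (2 * pi)) * of_real (std_normal_density (e * \<xi>))"
proof -
  have "exp (- (e * \<xi>)\<^sup>2 / 2) = sqrt (2 * pi) * std_normal_density (e * \<xi>)"
    by (simp add: std_normal_density_def)
  then show ?thesis by (simp only: gs_def of_real_mult)
qed

lemma integrable_gs:
  assumes "e > 0" shows "integrable lborel (gs e)"
proof -
  have "integrable lborel (\<lambda>\<xi>. std_normal_density (0 + e * \<xi>))"
    using assms by (intro lborel_integrable_real_affine) auto
  then have "integrable lborel (\<lambda>\<xi>. complex_of_real (sqrt (2 * pi)) * of_real (std_normal_density (e * \<xi>)))"
    by (intro integrable_mult_right integrable_of_real) simp
  then show ?thesis by (simp add: gs_eq_density[abs_def])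
qed

lemma integrable_gs_mult:
  assumes "e > 0" "h \<in> borel_measurable borel" "\<And>\<xi>. cmod (h \<xi>) \<le> C"
  shows "integrable lborel (\<lambda>\<xi>. gs e \<xi> * h \<xi>)"
proof (rule Bochner_Integration.integrable_bound)
  have [measurable]: "h \<in> borel_measurable borel" by fact
  show "integrable lborel (\<lambda>\<xi>. C *\<^sub>R gs e \<xi>)" by (intro integrable_scaleR_right integrable_gs assms)
  show "(\<lambda>\<xi>. gs e \<xi> * h \<xi>) \<in> borel_measurable lborel" by measurable
  have "cmod (gs e \<xi>) * cmod (h \<xi>) \<le> cmod (gs e \<xi>) * \<bar>C\<bar>" for \<xi>
    by (intro mult_left_mono order_trans[OF assms(3) abs_ge_self]) simp
  then show "AE \<xi> in lborel. norm (gs e \<xi> * h \<xi>) \<le> norm (C *\<^sub>R gs e \<xi>)"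
    by (intro AE_I2) (simp add: norm_mult mult.commute)
qed

lemma ft_std_normal: "(LINT y|lborel. chr (y * t) * of_real (std_normal_density y)) = of_real (exp (- t\<^sup>2 / 2))"
proof -
  have "char std_normal_distribution (- t) = (LINT y|lborel. std_normal_density y *\<^sub>R exp (\<i> * of_real (- t * y)))"
    unfolding char_def by (subst integral_density) auto
  also have "\<dots> = (LINT y|lborel. chr (y * t) * of_real (std_normal_density y))"
    by (rule Bochner_Integration.integral_cong) (simp_all add: chr_def scaleR_conv_of_real mult_ac)
  finally show ?thesis by (simp add: char_std_normal_distribution)
qed

lemma ft_gs:
  assumes "e > 0" shows "ft (gs e) x = of_real (2 * pi * normal_density 0 e x)"
proof -
  have "ft (gs e) x = (LINT \<xi>|lborel. of_real (sqrt (2 * pi)) * (chr ((0 + e * \<xi>) * (x / e)) * of_real (std_normal_density (0 + e * \<xi>))))"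
    unfolding ft_def using assms
    by (intro Bochner_Integration.integral_cong) (simp_all add: gs_eq_density mult_ac)
  also have "\<dots> = of_real (sqrt (2 * pi)) * (LINT \<xi>|lborel. chr ((0 + e * \<xi>) * (x / e)) * of_real (std_normal_density (0 + e * \<xi>)))"
    by simp
  also have "(LINT \<xi>|lborel. chr ((0 + e * \<xi>) * (x / e)) * of_real (std_normal_density (0 + e * \<xi>)))
     = of_real (1 / e) * of_real (exp (- (x / e)\<^sup>2 / 2))"
    using lborel_integral_real_affine[of e "\<lambda>y. chr (y * (x / e)) * of_real (std_normal_density y)" 0] assms
    by (simp only: ft_std_normal) (simp add: scaleR_conv_of_real)
  also have "of_real (sqrt (2 * pi)) * (of_real (1 / e) * of_real (exp (- (x / e)\<^sup>2 / 2)))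
    = complex_of_real (2 * pi * normal_density 0 e x)"
  proof -
    have "sqrt (2 * pi) * (1 / e * exp (- (x / e)\<^sup>2 / 2)) = 2 * pi * normal_density 0 e x"
      using assms by (simp add: normal_density_def real_sqrt_mult power_divide field_simps)
    then show ?thesis by (simp only: flip: of_real_mult)
  qed
  finally show ?thesis .
qed

definition nd :: "real \<Rightarrow> real \<Rightarrow> complex" where
  "nd e x = of_real (normal_density 0 e x)"

lemma nd_measurable [measurable]: "nd e \<in> borel_measurable borel"
  unfolding nd_def by measurable

lemma nd_minus: "nd e (- x) = nd e x"
  by (simp add: nd_def normal_density_def)

lemma integrable_nd: "e > 0 \<Longrightarrow> integrable lborel (nd e)"
  unfolding nd_def by (intro integrable_of_real) simp

lemma integral_norm_nd: "e > 0 \<Longrightarrow> (LINT x|lborel. cmod (nd e x)) = 1"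
  by (simp add: nd_def)

text \<open>
  The multiplication formula for \<open>f\<close> and the damped character \<open>\<xi> \<mapsto> chr (- x \<xi>) \<cdot> gs e \<xi>\<close>, whose transform is a
  translated Gaussian.
\<close>

lemma ft_regularised:
  assumes "integrable lborel f" "e > 0"
  shows "ft (\<lambda>\<xi>. gs e \<xi> * ft f \<xi>) (- x) = 2 * pi * conv f (nd e) x"
proof -
  have g: "integrable lborel (\<lambda>\<xi>. chr (\<xi> * - x) * gs e \<xi>)"
    by (intro integrable_chr_mult integrable_gs assms)
  have "ft (\<lambda>\<xi>. gs e \<xi> * ft f \<xi>) (- x) = (LINT \<xi>|lborel. ft f \<xi> * (chr (\<xi> * - x) * gs e \<xi>))"
    unfolding ft_def[of "\<lambda>\<xi>. gs e \<xi> * ft f \<xi>"]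
    by (intro Bochner_Integration.integral_cong refl) (simp only: mult_ac)
  also have "\<dots> = (LINT y|lborel. f y * ft (\<lambda>\<xi>. chr (\<xi> * - x) * gs e \<xi>) y)"
    by (rule ft_multiplication_formula[OF assms(1) g])
  also have "\<dots> = (LINT y|lborel. 2 * pi * (f y * nd e (x - y)))"
  proof (rule Bochner_Integration.integral_cong[OF refl])
    fix y
    have "ft (\<lambda>\<xi>. chr (\<xi> * - x) * gs e \<xi>) y = ft (gs e) (y - x)"
      unfolding ft_def
    proof (rule Bochner_Integration.integral_cong[OF refl])
      fix \<xi>
      have "chr (\<xi> * (y - x)) = chr (\<xi> * y) * chr (\<xi> * - x)"
        unfolding chr_add[symmetric] by (simp add: right_diff_distrib)
      then show "chr (\<xi> * y) * (chr (\<xi> * - x) * gs e \<xi>) = chr (\<xi> * (y - x)) * gs e \<xi>"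
        by (simp only: mult.assoc)
    qed
    also have "\<dots> = 2 * pi * nd e (x - y)"
      using nd_minus[of e "x - y"] by (simp add: ft_gs assms nd_def)
    finally show "f y * ft (\<lambda>\<xi>. chr (\<xi> * - x) * gs e \<xi>) y = 2 * pi * (f y * nd e (x - y))"
      by simp
  qed
  also have "\<dots> = 2 * pi * conv f (nd e) x"
    by (simp add: conv_def)
  finally show ?thesis .
qed

text \<open>
  Applying the multiplication formula to \<open>f\<close> and \<open>gs e \<cdot> cnj (ft f)\<close> rewrites the damped integral of
  \<open>\<bar>ft f\<bar>\<^sup>2\<close> as \<open>2\<pi>\<close> times the inner product of \<open>f\<close> with \<open>nd e * f\<close>. Cauchy-Schwarz and Young's inequality finish, as
  \<open>nd e\<close> has total mass \<open>1\<close>.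
\<close>

lemma integral_gs_ft_le:
  assumes f: "integrable lborel f" "sq_integrable f" and e: "e > 0"
  shows "integrable lborel (\<lambda>\<xi>. exp (- (e * \<xi>)\<^sup>2 / 2) * (cmod (ft f \<xi>))\<^sup>2)"
    and "(LINT \<xi>|lborel. exp (- (e * \<xi>)\<^sup>2 / 2) * (cmod (ft f \<xi>))\<^sup>2) \<le> 2 * pi * (norm (to_l2 f))\<^sup>2"
proof -
  have [measurable]: "f \<in> borel_measurable borel" using f by auto
  let ?B = "LINT x|lborel. cmod (f x)"
  have B: "cmod (ft f \<xi>) \<le> ?B" for \<xi> by (rule norm_ft_le[OF f(1)])
  have g: "integrable lborel (\<lambda>\<xi>. gs e \<xi> * cnj (ft f \<xi>))"
    by (rule integrable_gs_mult[OF e, where C="?B"]) (measurable, simp add: B)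
  have eq: "ft f \<xi> * (gs e \<xi> * cnj (ft f \<xi>)) = of_real (exp (- (e * \<xi>)\<^sup>2 / 2) * (cmod (ft f \<xi>))\<^sup>2)" for \<xi>
  proof -
    have "ft f \<xi> * (gs e \<xi> * cnj (ft f \<xi>)) = gs e \<xi> * (ft f \<xi> * cnj (ft f \<xi>))" by (simp only: mult_ac)
    then show ?thesis by (simp only: complex_norm_square[symmetric] gs_def of_real_mult)
  qed
  have "integrable lborel (\<lambda>\<xi>. gs e \<xi> * of_real ((cmod (ft f \<xi>))\<^sup>2))"
  proof (rule integrable_gs_mult[OF e, where C="?B\<^sup>2"])
    show "cmod (of_real ((cmod (ft f \<xi>))\<^sup>2)) \<le> ?B\<^sup>2" for \<xi>
      using power_mono[OF B norm_ge_zero, of \<xi> 2] by (simp add: norm_power)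
  qed measurable
  from Bochner_Integration.integrable_Re[OF this]
  show "integrable lborel (\<lambda>\<xi>. exp (- (e * \<xi>)\<^sup>2 / 2) * (cmod (ft f \<xi>))\<^sup>2)"
    by (simp add: gs_def)
  have c: "sq_integrable (conv (nd e) f)" and cn: "norm (to_l2 (conv (nd e) f)) \<le> norm (to_l2 f)"
    using Young_L1_L2[OF integrable_nd[OF e] f(2)] by (simp_all add: integral_norm_nd e)
  have cc: "sq_integrable (\<lambda>x. cnj (conv (nd e) f x))" using c by (auto simp: sq_integrable_def)
  have "complex_of_real (LINT \<xi>|lborel. exp (- (e * \<xi>)\<^sup>2 / 2) * (cmod (ft f \<xi>))\<^sup>2)
     = (LINT \<xi>|lborel. ft f \<xi> * (gs e \<xi> * cnj (ft f \<xi>)))"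
    unfolding eq by (simp only: integral_complex_of_real)
  also have "\<dots> = (LINT x|lborel. f x * ft (\<lambda>\<xi>. gs e \<xi> * cnj (ft f \<xi>)) x)"
    by (rule ft_multiplication_formula[OF f(1) g])
  also have "\<dots> = (LINT x|lborel. 2 * pi * (f x * cnj (conv (nd e) f x)))"
  proof (rule Bochner_Integration.integral_cong[OF refl])
    fix x
    have "ft (\<lambda>\<xi>. gs e \<xi> * cnj (ft f \<xi>)) x = ft (\<lambda>\<xi>. cnj (gs e \<xi> * ft f \<xi>)) x"
      by (simp add: gs_def)
    also have "\<dots> = cnj (2 * pi * conv f (nd e) x)"
      by (subst ft_cnj) (simp only: ft_regularised[OF f(1) e])
    finally show "f x * ft (\<lambda>\<xi>. gs e \<xi> * cnj (ft f \<xi>)) x = 2 * pi * (f x * cnj (conv (nd e) f x))"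
      by (simp add: conv_commute[of f "nd e"])
  qed
  finally have "complex_of_real (LINT \<xi>|lborel. exp (- (e * \<xi>)\<^sup>2 / 2) * (cmod (ft f \<xi>))\<^sup>2)
     = (LINT x|lborel. 2 * pi * (f x * cnj (conv (nd e) f x)))" .
  from arg_cong[OF this, of Re]
  have "(LINT \<xi>|lborel. exp (- (e * \<xi>)\<^sup>2 / 2) * (cmod (ft f \<xi>))\<^sup>2)
     = Re (LINT x|lborel. 2 * pi * (f x * cnj (conv (nd e) f x)))"
    by (simp only: Re_complex_of_real)
  also have "\<dots> \<le> cmod (LINT x|lborel. 2 * pi * (f x * cnj (conv (nd e) f x)))"
    by (rule complex_Re_le_cmod)
  also have "\<dots> = 2 * pi * cmod (LINT x|lborel. f x * cnj (conv (nd e) f x))"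
    by (simp add: norm_mult)
  also have "cmod (LINT x|lborel. f x * cnj (conv (nd e) f x)) \<le> (LINT x|lborel. cmod (f x * cnj (conv (nd e) f x)))"
    by (rule integral_norm_bound)
  also have "\<dots> \<le> norm (to_l2 f) * norm (to_l2 (\<lambda>x. cnj (conv (nd e) f x)))"
    by (rule norm_integral_mult_le[OF f(2) cc])
  also have "norm (to_l2 (\<lambda>x. cnj (conv (nd e) f x))) = norm (to_l2 (conv (nd e) f))"
    by (rule power2_eq_imp_eq) (simp_all add: norm_to_l2_sq c cc)
  also have "norm (to_l2 f) * norm (to_l2 (conv (nd e) f)) \<le> norm (to_l2 f) * norm (to_l2 f)"
    by (intro mult_left_mono cn) simp
  finally show "(LINT \<xi>|lborel. exp (- (e * \<xi>)\<^sup>2 / 2) * (cmod (ft f \<xi>))\<^sup>2) \<le> 2 * pi * (norm (to_l2 f))\<^sup>2"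
    by (simp add: power2_eq_square)
qed

text \<open>
  Fatou's lemma as the damping is removed.
\<close>

lemma integrable_of_damped:
  fixes h :: "real \<Rightarrow> real"
  assumes [measurable]: "h \<in> borel_measurable borel" and h0: "\<And>x. 0 \<le> h x"
    and i: "\<And>n::nat. integrable lborel (\<lambda>x. exp (- (1 / Suc n * x)\<^sup>2 / 2) * h x)"
    and le: "\<And>n::nat. (LINT x|lborel. exp (- (1 / Suc n * x)\<^sup>2 / 2) * h x) \<le> C"
  shows "integrable lborel h \<and> integral\<^sup>L lborel h \<le> C"
proof -
  let ?k = "\<lambda>n x. exp (- (1 / real (Suc n) * x)\<^sup>2 / 2)"
  have "0 \<le> (LINT x|lborel. ?k 0 x * h x)" using h0 by (intro integral_nonneg_AE AE_I2) simp
  then have C: "0 \<le> C" using le[of 0] by linarith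
  have k: "(\<lambda>n. ?k n x * h x) \<longlonglongrightarrow> h x" for x
  proof -
    have "(\<lambda>n. ?k n x * h x) \<longlonglongrightarrow> exp (- (0 * x)\<^sup>2 / 2) * h x"
      by (intro tendsto_intros LIMSEQ_Suc[OF lim_1_over_n]) auto
    then show ?thesis by simp
  qed
  have "(\<integral>\<^sup>+x. ennreal (h x) \<partial>lborel) = (\<integral>\<^sup>+x. liminf (\<lambda>n. ennreal (?k n x * h x)) \<partial>lborel)"
  proof (rule nn_integral_cong)
    fix x
    have "(\<lambda>n. ennreal (?k n x * h x)) \<longlonglongrightarrow> ennreal (h x)" by (intro tendsto_ennrealI k)
    then show "ennreal (h x) = liminf (\<lambda>n. ennreal (?k n x * h x))"
      by (metis lim_imp_Liminf sequentially_bot)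
  qed
  also have "\<dots> \<le> liminf (\<lambda>n. \<integral>\<^sup>+x. ennreal (?k n x * h x) \<partial>lborel)"
    by (rule nn_integral_liminf) measurable
  also have "\<dots> \<le> ennreal C"
  proof (rule Liminf_le)
    show "\<forall>\<^sub>F n in sequentially. (\<integral>\<^sup>+x. ennreal (?k n x * h x) \<partial>lborel) \<le> ennreal C"
    proof (rule always_eventually, rule allI)
      fix n
      have "(\<integral>\<^sup>+x. ennreal (?k n x * h x) \<partial>lborel) = ennreal (LINT x|lborel. ?k n x * h x)"
        using i[of n] h0 by (intro nn_integral_eq_integral AE_I2) auto
      then show "(\<integral>\<^sup>+x. ennreal (?k n x * h x) \<partial>lborel) \<le> ennreal C"
        using le[of n] by (simp add: ennreal_leI)
    qed
  qed simp
  finally have *: "(\<integral>\<^sup>+x. ennreal (h x) \<partial>lborel) \<le> ennreal C" .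
  then have "(\<integral>\<^sup>+x. ennreal (h x) \<partial>lborel) < \<infinity>"
    using ennreal_less_top le_less_trans by fastforce
  then have ih: "integrable lborel h" using h0 by (intro integrableI_nonneg) auto
  then have "ennreal (integral\<^sup>L lborel h) \<le> ennreal C"
    using * h0 by (simp add: nn_integral_eq_integral)
  then show ?thesis using ih C by simp
qed

text \<open>
  The bound by which the transform extends from \<open>L\<^sup>1 \<inter> L\<^sup>2\<close> to all square integrable functions.
\<close>

lemma ft_L2:
  assumes f: "integrable lborel f" "sq_integrable f"
  shows "sq_integrable (ft f)" and "norm (to_l2 (ft f)) \<le> sqrt (2 * pi) * norm (to_l2 f)"
proof -
  have [measurable]: "f \<in> borel_measurable borel" using f by auto
  have *: "integrable lborel (\<lambda>\<xi>. (cmod (ft f \<xi>))\<^sup>2) \<and> (LINT \<xi>|lborel. (cmod (ft f \<xi>))\<^sup>2) \<le> 2 * pi * (norm (to_l2 f))\<^sup>2"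
  proof (rule integrable_of_damped)
    fix n :: nat
    have "0 < 1 / real (Suc n)" by simp
    from integral_gs_ft_le[OF f this]
    show "integrable lborel (\<lambda>\<xi>. exp (- (1 / real (Suc n) * \<xi>)\<^sup>2 / 2) * (cmod (ft f \<xi>))\<^sup>2)"
      and "(LINT \<xi>|lborel. exp (- (1 / real (Suc n) * \<xi>)\<^sup>2 / 2) * (cmod (ft f \<xi>))\<^sup>2) \<le> 2 * pi * (norm (to_l2 f))\<^sup>2"
      .
  next
    show "(\<lambda>\<xi>. (cmod (ft f \<xi>))\<^sup>2) \<in> borel_measurable borel" by measurable
  qed simp
  then show s: "sq_integrable (ft f)" by (simp add: sq_integrable_def)
  have "(norm (to_l2 (ft f)))\<^sup>2 \<le> (sqrt (2 * pi) * norm (to_l2 f))\<^sup>2"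
    using * by (simp add: norm_to_l2_sq[OF s] power_mult_distrib)
  then show "norm (to_l2 (ft f)) \<le> sqrt (2 * pi) * norm (to_l2 f)"
    by (rule power2_le_imp_le) simp
qed

section \<open>The Fourier transform on square integrable functions\<close>

definition window :: "real \<Rightarrow> real \<Rightarrow> complex" where
  "window R x = indicator {-R..R} x"

lemma window_measurable [measurable]: "window R \<in> borel_measurable borel"
  unfolding window_def by measurable

lemma norm_window_le: "cmod (window R x) \<le> 1"
  by (simp add: window_def indicator_def)

lemma bdd_symbol_window [simp]: "bdd_symbol (window R)"
  by (rule bdd_symbolI[OF window_measurable norm_window_le])

lemma sq_integrable_window: "sq_integrable (window R)"
proof -
  have "integrable lborel (indicator {-R..R} :: real \<Rightarrow> real)"
    by (rule integrable_real_indicator) (auto simp: emeasure_lborel_Icc_eq)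
  moreover have "(cmod (window R x))\<^sup>2 = indicator {-R..R} x" for x
    by (simp add: window_def indicator_def)
  ultimately show ?thesis by (simp add: sq_integrable_def)
qed

lemma integrable_window_mult:
  assumes "sq_integrable f" shows "integrable lborel (\<lambda>x. window R x * f x)"
  by (rule integrable_mult_sq_integrable[OF sq_integrable_window assms])

lemma sq_integrable_window_mult: "sq_integrable f \<Longrightarrow> sq_integrable (\<lambda>x. window R x * f x)"
  by (rule sq_integrable_mult_bdd) simp_all

lemma tendsto_window: "((\<lambda>R. l2_mult (window R) f) \<longlongrightarrow> f) at_top"
proof (rule tendsto_at_topI_sequentially)
  fix X :: "nat \<Rightarrow> real" assume X: "filterlim X at_top sequentially"
  have "(\<lambda>n. l2_mult (window (X n)) f) \<longlonglongrightarrow> l2_mult (\<lambda>_. 1) f"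
  proof (rule tendsto_l2_mult[where C=1])
    show "AE x in lborel. (\<lambda>n. window (X n) x) \<longlonglongrightarrow> 1"
    proof (rule AE_I2)
      fix x :: real
      have "\<forall>\<^sub>F n in sequentially. \<bar>x\<bar> \<le> X n"
        using X by (simp add: filterlim_at_top)
      then have "\<forall>\<^sub>F n in sequentially. window (X n) x = 1"
        by eventually_elim (auto simp: window_def indicator_def)
      then show "(\<lambda>n. window (X n) x) \<longlonglongrightarrow> 1" by (rule tendsto_eventually)
    qed
  qed (simp_all add: norm_window_le)
  then show "(\<lambda>n. l2_mult (window (X n)) f) \<longlonglongrightarrow> f" by simp
qed

lemma fourier_trunc_eq: "fourier_trunc R f = to_l2 (ft (\<lambda>x. window R x * rep_l2 f x))"
proof -
  have "(\<lambda>\<xi>. LINT x:{-R..R}|lborel. exp (- \<i> * of_real (x * \<xi>)) * rep_l2 f x) = ft (\<lambda>x. window R x * rep_l2 f x)"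
    unfolding ft_def set_lebesgue_integral_def chr_def window_def
    by (intro ext Bochner_Integration.integral_cong) (auto simp: indicator_def)
  then show ?thesis by (simp add: fourier_trunc_def)
qed

lemma to_l2_ft_diff_le:
  assumes "integrable lborel f" "sq_integrable f" "integrable lborel g" "sq_integrable g"
  shows "norm (to_l2 (ft f) - to_l2 (ft g)) \<le> sqrt (2 * pi) * norm (to_l2 f - to_l2 g)"
proof -
  have "to_l2 (ft f) - to_l2 (ft g) = to_l2 (ft (\<lambda>x. f x - g x))"
    using to_l2_diff[OF ft_L2(1)[OF assms(1,2)] ft_L2(1)[OF assms(3,4)]]
    by (simp add: ft_diff[OF assms(1,3), symmetric])
  then show ?thesis
    using ft_L2(2)[of "\<lambda>x. f x - g x"] assms by (simp add: sq_integrable_diff to_l2_diff)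
qed

lemma fourier_trunc_diff_le:
  assumes "integrable lborel g" "sq_integrable g"
  shows "norm (fourier_trunc R f - to_l2 (ft g)) \<le> sqrt (2 * pi) * norm (l2_mult (window R) f - to_l2 g)"
  unfolding fourier_trunc_eq l2_mult_def
  by (intro to_l2_ft_diff_le integrable_window_mult sq_integrable_window_mult sq_integrable_rep_l2 assms)

lemma fourier_trunc_dist_le:
  "norm (fourier_trunc R f - fourier_trunc R' g) \<le> sqrt (2 * pi) * norm (l2_mult (window R) f - l2_mult (window R') g)"
  unfolding fourier_trunc_eq[of R' g] l2_mult_def[of "window R'"]
  by (intro fourier_trunc_diff_le integrable_window_mult sq_integrable_window_mult sq_integrable_rep_l2)

lemma tendsto_of_norm_bound:
  fixes f :: "'a \<Rightarrow> 'b::real_normed_vector"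
  assumes "(g \<longlongrightarrow> g') F" "\<And>x. norm (f x - l) \<le> C * norm (g x - g')"
  shows "(f \<longlongrightarrow> l) F"
proof -
  have "((\<lambda>x. C * norm (g x - g')) \<longlongrightarrow> C * norm (g' - g')) F"
    by (intro tendsto_intros assms(1))
  then have "((\<lambda>x. C * norm (g x - g')) \<longlongrightarrow> 0) F" by simp
  then have "((\<lambda>x. f x - l) \<longlongrightarrow> 0) F"
    by (rule Lim_null_comparison[rotated]) (simp add: assms(2))
  then show ?thesis by (rule LIM_zero_cancel)
qed

text \<open>
  By \<open>ft_L2\<close> the truncated transforms differ by at most \<open>(2\<pi>)\<^bsup>1/2\<^esup>\<close> times the difference of the
  truncations of \<open>f\<close>, and these converge to \<open>f\<close>; so the limit in the mean of the definition exists.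
\<close>

lemma fourier_tendsto: "((\<lambda>R. fourier_trunc R f) \<longlongrightarrow> fourier f) at_top"
proof -
  let ?X = "\<lambda>n::nat. fourier_trunc (real n) f" and ?Y = "\<lambda>n::nat. l2_mult (window (real n)) f"
  have Y: "?Y \<longlonglongrightarrow> f"
    using filterlim_compose[OF tendsto_window[of f] filterlim_real_sequentially] .
  have "Cauchy ?X"
  proof (rule CauchyI)
    fix e :: real assume e: "e > 0"
    then have "e / sqrt (2 * pi) > 0" by simp
    from CauchyD[OF LIMSEQ_imp_Cauchy[OF Y] this]
    obtain M where M: "\<And>m n. m \<ge> M \<Longrightarrow> n \<ge> M \<Longrightarrow> norm (?Y m - ?Y n) < e / sqrt (2 * pi)" by auto
    have "norm (?X m - ?X n) < e" if "m \<ge> M" "n \<ge> M" for m n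
    proof -
      have "norm (?X m - ?X n) \<le> sqrt (2 * pi) * norm (?Y m - ?Y n)" by (rule fourier_trunc_dist_le)
      also have "\<dots> < sqrt (2 * pi) * (e / sqrt (2 * pi))"
        by (intro mult_strict_left_mono M that) simp
      finally show ?thesis by simp
    qed
    then show "\<exists>M. \<forall>m\<ge>M. \<forall>n\<ge>M. norm (?X m - ?X n) < e" by blast
  qed
  then obtain L where L: "?X \<longlonglongrightarrow> L" using Cauchy_convergent convergent_def by metis
  have "((\<lambda>R. fourier_trunc R f) \<longlongrightarrow> L) at_top"
  proof (rule tendsto_of_norm_bound[OF tendsto_window[of f]])
    fix R
    have "(\<lambda>n. norm (fourier_trunc R f - ?X n)) \<longlonglongrightarrow> norm (fourier_trunc R f - L)"
      by (intro tendsto_intros L)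
    moreover have "(\<lambda>n. sqrt (2 * pi) * norm (l2_mult (window R) f - ?Y n)) \<longlonglongrightarrow> sqrt (2 * pi) * norm (l2_mult (window R) f - f)"
      by (intro tendsto_intros Y)
    ultimately show "norm (fourier_trunc R f - L) \<le> sqrt (2 * pi) * norm (l2_mult (window R) f - f)"
      by (rule LIMSEQ_le) (simp add: fourier_trunc_dist_le)
  qed
  moreover from this have "fourier f = L"
    unfolding fourier_def by (intro tendsto_Lim) auto
  ultimately show ?thesis by simp
qed

lemma fourier_to_l2:
  assumes "integrable lborel f" "sq_integrable f"
  shows "fourier (to_l2 f) = to_l2 (ft f)"
proof -
  have "((\<lambda>R. fourier_trunc R (to_l2 f)) \<longlongrightarrow> to_l2 (ft f)) at_top"
    by (rule tendsto_of_norm_bound[OF tendsto_window[of "to_l2 f"]]) (rule fourier_trunc_diff_le[OF assms])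
  then show ?thesis
    using fourier_tendsto[of "to_l2 f"] by (intro tendsto_unique[OF trivial_limit_at_top_linorder])
qed

lemma fourier_trunc_add: "fourier_trunc R (f + g) = fourier_trunc R f + fourier_trunc R g"
proof -
  have i: "integrable lborel (\<lambda>x. window R x * rep_l2 h x)" "sq_integrable (\<lambda>x. window R x * rep_l2 h x)" for h
    by (intro integrable_window_mult sq_integrable_window_mult sq_integrable_rep_l2)+
  have "ft (\<lambda>x. window R x * rep_l2 (f + g) x) \<xi>
    = ft (\<lambda>x. window R x * rep_l2 f x) \<xi> + ft (\<lambda>x. window R x * rep_l2 g x) \<xi>" for \<xi>
  proof -
    have "ft (\<lambda>x. window R x * rep_l2 (f + g) x) \<xi> = ft (\<lambda>x. window R x * rep_l2 f x + window R x * rep_l2 g x) \<xi>"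
    proof (rule ft_cong_AE)
      show "AE x in lborel. window R x * rep_l2 (f + g) x = window R x * rep_l2 f x + window R x * rep_l2 g x"
        using rep_l2_add[of f g] by eventually_elim (simp add: distrib_left)
    qed measurable
    then show ?thesis by (simp add: ft_add i)
  qed
  then have "ft (\<lambda>x. window R x * rep_l2 (f + g) x)
    = (\<lambda>\<xi>. ft (\<lambda>x. window R x * rep_l2 f x) \<xi> + ft (\<lambda>x. window R x * rep_l2 g x) \<xi>)"
    by (rule ext)
  then show ?thesis
    unfolding fourier_trunc_eq by (simp only: to_l2_add ft_L2(1) i)
qed

lemma fourier_trunc_scaleR: "fourier_trunc R (c *\<^sub>R f) = c *\<^sub>R fourier_trunc R f"
proof -
  have i: "integrable lborel (\<lambda>x. window R x * rep_l2 h x)" "sq_integrable (\<lambda>x. window R x * rep_l2 h x)" for h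
    by (intro integrable_window_mult sq_integrable_window_mult sq_integrable_rep_l2)+
  have "ft (\<lambda>x. window R x * rep_l2 (c *\<^sub>R f) x) \<xi> = c *\<^sub>R ft (\<lambda>x. window R x * rep_l2 f x) \<xi>" for \<xi>
  proof -
    have "ft (\<lambda>x. window R x * rep_l2 (c *\<^sub>R f) x) \<xi> = ft (\<lambda>x. of_real c * (window R x * rep_l2 f x)) \<xi>"
    proof (rule ft_cong_AE)
      show "AE x in lborel. window R x * rep_l2 (c *\<^sub>R f) x = of_real c * (window R x * rep_l2 f x)"
        using rep_l2_scaleR[of c f] by eventually_elim (simp add: scaleR_conv_of_real)
    qed measurable
    then show ?thesis by (simp only: ft_cmult scaleR_conv_of_real)
  qed
  then have "ft (\<lambda>x. window R x * rep_l2 (c *\<^sub>R f) x)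
    = (\<lambda>\<xi>. c *\<^sub>R ft (\<lambda>x. window R x * rep_l2 f x) \<xi>)"
    by (rule ext)
  then show ?thesis
    unfolding fourier_trunc_eq by (simp only: to_l2_scaleR ft_L2(1) i)
qed

lemma norm_fourier_le: "norm (fourier f) \<le> sqrt (2 * pi) * norm f"
proof (rule tendsto_le[OF trivial_limit_at_top_linorder])
  show "((\<lambda>R. norm (fourier_trunc R f)) \<longlongrightarrow> norm (fourier f)) at_top"
    by (intro tendsto_intros fourier_tendsto)
  show "((\<lambda>R. sqrt (2 * pi) * norm (l2_mult (window R) f)) \<longlongrightarrow> sqrt (2 * pi) * norm f) at_top"
    by (intro tendsto_intros tendsto_window)
  show "\<forall>\<^sub>F R in at_top. norm (fourier_trunc R f) \<le> sqrt (2 * pi) * norm (l2_mult (window R) f)"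
    unfolding fourier_trunc_eq l2_mult_def
    by (intro always_eventually allI ft_L2(2) integrable_window_mult sq_integrable_window_mult sq_integrable_rep_l2)
qed

lemma bounded_linear_fourier: "bounded_linear fourier"
proof (rule bounded_linear_intro)
  fix f g :: l2 and c :: real
  show "fourier (f + g) = fourier f + fourier g"
  proof (rule tendsto_unique[OF trivial_limit_at_top_linorder fourier_tendsto])
    show "((\<lambda>R. fourier_trunc R (f + g)) \<longlongrightarrow> fourier f + fourier g) at_top"
      unfolding fourier_trunc_add by (intro tendsto_add fourier_tendsto)
  qed
  show "fourier (c *\<^sub>R f) = c *\<^sub>R fourier f"
  proof (rule tendsto_unique[OF trivial_limit_at_top_linorder fourier_tendsto])
    show "((\<lambda>R. fourier_trunc R (c *\<^sub>R f)) \<longlongrightarrow> c *\<^sub>R fourier f) at_top"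
      unfolding fourier_trunc_scaleR by (intro tendsto_scaleR tendsto_const fourier_tendsto)
  qed
  show "norm (fourier f) \<le> norm f * sqrt (2 * pi)"
    using norm_fourier_le[of f] by (simp add: mult.commute)
qed

subsection \<open>Reflection and conjugation\<close>

definition l2_reflect :: "l2 \<Rightarrow> l2" where
  "l2_reflect f = to_l2 (\<lambda>x. rep_l2 f (- x))"

definition l2_cnj :: "l2 \<Rightarrow> l2" where
  "l2_cnj f = to_l2 (\<lambda>x. cnj (rep_l2 f x))"

lemma sq_integrable_uminus_arg: "sq_integrable f \<Longrightarrow> sq_integrable (\<lambda>x. f (- x))"
  using sq_integrable_reflect[of f 0] by simp

lemma sq_integrable_cnj: "sq_integrable f \<Longrightarrow> sq_integrable (\<lambda>x. cnj (f x))"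
  by (auto simp: sq_integrable_def)

lemma l2_reflect_to_l2:
  assumes "sq_integrable f" shows "l2_reflect (to_l2 f) = to_l2 (\<lambda>x. f (- x))"
  unfolding l2_reflect_def
proof (rule to_l2_cong_AE)
  have [measurable]: "f \<in> borel_measurable borel" using assms by simp
  show "(\<lambda>x. rep_l2 (to_l2 f) (- x)) \<in> borel_measurable borel" by measurable
  show "(\<lambda>x. f (- x)) \<in> borel_measurable borel" by measurable
  show "AE x in lborel. rep_l2 (to_l2 f) (- x) = f (- x)"
    by (rule AE_lborel_uminus[OF rep_l2_to_l2[OF assms]])
qed

lemma l2_cnj_to_l2:
  assumes "sq_integrable f" shows "l2_cnj (to_l2 f) = to_l2 (\<lambda>x. cnj (f x))"
  unfolding l2_cnj_def
proof (rule to_l2_cong_AE)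
  have [measurable]: "f \<in> borel_measurable borel" using assms by simp
  show "(\<lambda>x. cnj (rep_l2 (to_l2 f) x)) \<in> borel_measurable borel" by measurable
  show "(\<lambda>x. cnj (f x)) \<in> borel_measurable borel" by measurable
  show "AE x in lborel. cnj (rep_l2 (to_l2 f) x) = cnj (f x)"
    using rep_l2_to_l2[OF assms] by eventually_elim simp
qed

lemma l2_reflect_reflect [simp]: "l2_reflect (l2_reflect f) = f"
proof -
  have "l2_reflect (l2_reflect f) = to_l2 (\<lambda>x. rep_l2 f (- (- x)))"
    unfolding l2_reflect_def[of f]
    by (rule l2_reflect_to_l2[OF sq_integrable_uminus_arg[OF sq_integrable_rep_l2]])
  then show ?thesis by simp
qed

lemma norm_l2_reflect [simp]: "norm (l2_reflect f) = norm f"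
  using norm_to_l2_reflect[OF sq_integrable_rep_l2[of f], of 0] by (simp add: l2_reflect_def)

lemma norm_l2_cnj [simp]: "norm (l2_cnj f) = norm f"
  by (rule power2_eq_imp_eq)
     (simp_all add: l2_cnj_def norm_to_l2_sq sq_integrable_cnj sq_integrable_rep_l2 norm_l2_sq[of f])

lemma bounded_linear_l2_reflect: "bounded_linear l2_reflect"
proof (rule bounded_linear_intro)
  fix f g :: l2 and c :: real
  have s: "sq_integrable (\<lambda>x. rep_l2 h (- x))" for h
    by (intro sq_integrable_uminus_arg sq_integrable_rep_l2)
  show "l2_reflect (f + g) = l2_reflect f + l2_reflect g"
    using AE_lborel_uminus[OF rep_l2_add[of f g]]
    unfolding l2_reflect_def to_l2_add[OF s s, symmetric] by (intro to_l2_cong_AE) auto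
  show "l2_reflect (c *\<^sub>R f) = c *\<^sub>R l2_reflect f"
    using AE_lborel_uminus[OF rep_l2_scaleR[of c f]]
    unfolding l2_reflect_def to_l2_scaleR[OF s, symmetric] by (intro to_l2_cong_AE) auto
  show "norm (l2_reflect f) \<le> norm f * 1" by simp
qed

lemma bounded_linear_l2_cnj: "bounded_linear l2_cnj"
proof (rule bounded_linear_intro)
  fix f g :: l2 and c :: real
  have s: "sq_integrable (\<lambda>x. cnj (rep_l2 h x))" for h
    by (intro sq_integrable_cnj sq_integrable_rep_l2)
  show "l2_cnj (f + g) = l2_cnj f + l2_cnj g"
    using rep_l2_add[of f g]
    unfolding l2_cnj_def to_l2_add[OF s s, symmetric] by (intro to_l2_cong_AE) auto
  show "l2_cnj (c *\<^sub>R f) = c *\<^sub>R l2_cnj f"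
    using rep_l2_scaleR[of c f]
    unfolding l2_cnj_def to_l2_scaleR[OF s, symmetric] by (intro to_l2_cong_AE) auto
  show "norm (l2_cnj f) \<le> norm f * 1" by simp
qed

lemma inner_l2_reflect: "l2_reflect f \<bullet> g = f \<bullet> l2_reflect g"
proof -
  have "l2_reflect f \<bullet> g = (LINT x|lborel. rep_l2 f (- x) \<bullet> rep_l2 g x)"
    using inner_to_l2[OF sq_integrable_uminus_arg[OF sq_integrable_rep_l2[of f]] sq_integrable_rep_l2[of g]]
    by (simp add: l2_reflect_def)
  also have "\<dots> = (LINT x|lborel. rep_l2 f x \<bullet> rep_l2 g (- x))"
    using integral_lborel_reflect[of "\<lambda>x. rep_l2 f x \<bullet> rep_l2 g (- x)" 0] by simp
  also have "\<dots> = f \<bullet> l2_reflect g"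
    using inner_to_l2[OF sq_integrable_rep_l2[of f] sq_integrable_uminus_arg[OF sq_integrable_rep_l2[of g]]]
    by (simp add: l2_reflect_def)
  finally show ?thesis .
qed

text \<open>
  Truncations lie in \<open>L\<^sup>1 \<inter> L\<^sup>2\<close>, where the transform is an integral, and they are dense. Identities
  between operators built from the transform are checked on them.
\<close>

lemma bounded_linear_eq_on_window:
  assumes "bounded_linear S" "bounded_linear T" "\<And>R. S (l2_mult (window R) f) = T (l2_mult (window R) f)"
  shows "S f = T f"
proof (rule tendsto_unique[OF trivial_limit_at_top_linorder])
  show "((\<lambda>R. S (l2_mult (window R) f)) \<longlongrightarrow> S f) at_top"
    by (rule bounded_linear.tendsto[OF assms(1) tendsto_window])
  show "((\<lambda>R. S (l2_mult (window R) f)) \<longlongrightarrow> T f) at_top"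
    unfolding assms(3) by (rule bounded_linear.tendsto[OF assms(2) tendsto_window])
qed

lemma fourier_reflect: "fourier (l2_reflect f) = l2_reflect (fourier f)"
proof (rule bounded_linear_eq_on_window[where S="\<lambda>f. fourier (l2_reflect f)" and T="\<lambda>f. l2_reflect (fourier f)"])
  fix R
  let ?g = "\<lambda>x. window R x * rep_l2 f x"
  have g: "integrable lborel ?g" "sq_integrable ?g"
    by (intro integrable_window_mult sq_integrable_window_mult sq_integrable_rep_l2)+
  have g': "integrable lborel (\<lambda>x. ?g (- x))"
    using g(1) integrable_lborel_reflect_iff[of ?g 0] by simp
  show "fourier (l2_reflect (l2_mult (window R) f)) = l2_reflect (fourier (l2_mult (window R) f))"
    unfolding l2_mult_def l2_reflect_to_l2[OF g(2)] fourier_to_l2[OF g]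
      fourier_to_l2[OF g' sq_integrable_uminus_arg[OF g(2)]] l2_reflect_to_l2[OF ft_L2(1)[OF g]]
    by (simp add: ft_reflect[of ?g, abs_def])
qed (intro bounded_linear_compose[OF bounded_linear_fourier bounded_linear_l2_reflect]
      bounded_linear_compose[OF bounded_linear_l2_reflect bounded_linear_fourier])+

lemma fourier_cnj: "fourier (l2_cnj f) = l2_reflect (l2_cnj (fourier f))"
proof (rule bounded_linear_eq_on_window[where S="\<lambda>f. fourier (l2_cnj f)" and T="\<lambda>f. l2_reflect (l2_cnj (fourier f))"])
  fix R
  let ?g = "\<lambda>x. window R x * rep_l2 f x"
  have g: "integrable lborel ?g" "sq_integrable ?g"
    by (intro integrable_window_mult sq_integrable_window_mult sq_integrable_rep_l2)+
  have g': "integrable lborel (\<lambda>x. cnj (?g x))"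
    using g(1) by (rule integrable_cnj)
  show "fourier (l2_cnj (l2_mult (window R) f)) = l2_reflect (l2_cnj (fourier (l2_mult (window R) f)))"
    unfolding l2_mult_def l2_cnj_to_l2[OF g(2)] fourier_to_l2[OF g]
      fourier_to_l2[OF g' sq_integrable_cnj[OF g(2)]] l2_cnj_to_l2[OF ft_L2(1)[OF g]]
      l2_reflect_to_l2[OF sq_integrable_cnj[OF ft_L2(1)[OF g]]]
    by (simp only: ft_cnj[of ?g, abs_def])
qed (intro bounded_linear_compose[OF bounded_linear_fourier bounded_linear_l2_cnj]
      bounded_linear_compose[OF bounded_linear_l2_reflect bounded_linear_compose[OF bounded_linear_l2_cnj bounded_linear_fourier]])+

subsection \<open>Fourier inversion\<close>

lemma inner_fourier_L1:
  assumes f: "integrable lborel f" "sq_integrable f" and g: "integrable lborel g" "sq_integrable g"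
  shows "fourier (to_l2 f) \<bullet> to_l2 g = to_l2 f \<bullet> l2_reflect (fourier (to_l2 g))"
proof -
  have cg: "integrable lborel (\<lambda>x. cnj (g x))" using g(1) by (rule integrable_cnj)
  have i1: "integrable lborel (\<lambda>\<xi>. ft f \<xi> * cnj (g \<xi>))"
    by (intro integrable_mult_sq_integrable ft_L2 f sq_integrable_cnj g)
  have i2: "integrable lborel (\<lambda>x. f x * cnj (ft g (- x)))"
    by (intro integrable_mult_sq_integrable sq_integrable_cnj sq_integrable_uminus_arg ft_L2 f g)
  have "fourier (to_l2 f) \<bullet> to_l2 g = (LINT \<xi>|lborel. ft f \<xi> \<bullet> g \<xi>)"
    unfolding fourier_to_l2[OF f] by (rule inner_to_l2[OF ft_L2(1)[OF f] g(2)])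
  also have "\<dots> = (LINT \<xi>|lborel. Re (ft f \<xi> * cnj (g \<xi>)))"
    by (intro Bochner_Integration.integral_cong refl) (simp add: inner_complex_def)
  also have "\<dots> = Re (LINT \<xi>|lborel. ft f \<xi> * cnj (g \<xi>))"
    by (rule Bochner_Integration.integral_Re[OF i1])
  also have "(LINT \<xi>|lborel. ft f \<xi> * cnj (g \<xi>)) = (LINT x|lborel. f x * cnj (ft g (- x)))"
    unfolding ft_multiplication_formula[OF f(1) cg] by (simp only: ft_cnj)
  also have "Re \<dots> = (LINT x|lborel. Re (f x * cnj (ft g (- x))))"
    by (rule Bochner_Integration.integral_Re[OF i2, symmetric])
  also have "\<dots> = (LINT x|lborel. f x \<bullet> ft g (- x))"
    by (intro Bochner_Integration.integral_cong refl) (simp add: inner_complex_def)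
  also have "\<dots> = to_l2 f \<bullet> l2_reflect (fourier (to_l2 g))"
    unfolding fourier_to_l2[OF g] l2_reflect_to_l2[OF ft_L2(1)[OF g]]
    by (rule inner_to_l2[OF f(2) sq_integrable_uminus_arg[OF ft_L2(1)[OF g]], symmetric])
  finally show ?thesis .
qed

text \<open>
  The adjoint of the transform is the transform followed by reflection.
\<close>

lemma inner_fourier: "fourier f \<bullet> g = f \<bullet> l2_reflect (fourier g)"
proof (rule tendsto_unique[OF trivial_limit_at_top_linorder])
  let ?c = "\<lambda>R. l2_mult (window R)"
  show "((\<lambda>R. fourier (?c R f) \<bullet> ?c R g) \<longlongrightarrow> fourier f \<bullet> g) at_top"
    by (intro tendsto_inner bounded_linear.tendsto[OF bounded_linear_fourier] tendsto_window)
  have "fourier (?c R f) \<bullet> ?c R g = ?c R f \<bullet> l2_reflect (fourier (?c R g))" for R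
    unfolding l2_mult_def
    by (intro inner_fourier_L1 integrable_window_mult sq_integrable_window_mult sq_integrable_rep_l2)
  moreover have "((\<lambda>R. ?c R f \<bullet> l2_reflect (fourier (?c R g))) \<longlongrightarrow> f \<bullet> l2_reflect (fourier g)) at_top"
    by (intro tendsto_inner bounded_linear.tendsto[OF bounded_linear_fourier]
          bounded_linear.tendsto[OF bounded_linear_l2_reflect] tendsto_window)
  ultimately show "((\<lambda>R. fourier (?c R f) \<bullet> ?c R g) \<longlongrightarrow> f \<bullet> l2_reflect (fourier g)) at_top"
    by simp
qed

lemma normal_density_scaling:
  assumes "e > 0" shows "normal_density 0 e (e * z) = std_normal_density z / e"
  using assms by (simp add: normal_density_def power_mult_distrib real_sqrt_mult)

text \<open>
  The substitution \<open>y = e z\<close> exhibits the Gaussian average as the mean of \<open>f(x - e Z)\<close> for a standard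
  normal \<open>Z\<close>, so that the limit \<open>e \<rightarrow> 0\<close> becomes a dominated convergence.
\<close>

lemma conv_nd_eq:
  assumes "e > 0"
  shows "conv f (nd e) x = (LINT z|lborel. f (x - e * z) * of_real (std_normal_density z))"
proof -
  have "conv f (nd e) x = (LINT y|lborel. nd e y * f (x - y))"
    by (subst conv_commute) (simp add: conv_def)
  also have "\<dots> = e *\<^sub>R (LINT z|lborel. nd e (0 + e * z) * f (x - (0 + e * z)))"
    using lborel_integral_real_affine[of e "\<lambda>y. nd e y * f (x - y)" 0] assms by simp
  also have "\<dots> = (LINT z|lborel. e *\<^sub>R (nd e (0 + e * z) * f (x - (0 + e * z))))"
    by simp
  also have "\<dots> = (LINT z|lborel. f (x - e * z) * of_real (std_normal_density z))"
  proof (rule Bochner_Integration.integral_cong[OF refl])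
    fix z
    have "complex_of_real e * of_real (std_normal_density z / e) = of_real (std_normal_density z)"
      unfolding of_real_mult[symmetric] using assms by (simp only: nonzero_mult_div_cancel_left times_divide_eq_right less_irrefl)
    then show "e *\<^sub>R (nd e (0 + e * z) * f (x - (0 + e * z))) = f (x - e * z) * of_real (std_normal_density z)"
      using assms by (simp add: nd_def normal_density_scaling scaleR_conv_of_real)
  qed
  finally show ?thesis .
qed

lemma conv_nd_tendsto:
  fixes f :: "real \<Rightarrow> complex"
  assumes [measurable]: "f \<in> borel_measurable borel" and B: "\<And>x. cmod (f x) \<le> B" and cont: "isCont f x"
  shows "(\<lambda>n. conv f (nd (1 / Suc n)) x) \<longlonglongrightarrow> f x"
proof -
  let ?s = "\<lambda>n z. f (x - (1 / real (Suc n)) * z) * complex_of_real (std_normal_density z)"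
  have "(\<lambda>n. LINT z|lborel. ?s n z) \<longlonglongrightarrow> (LINT z|lborel. f x * complex_of_real (std_normal_density z))"
  proof (rule integral_dominated_convergence[where w="\<lambda>z. B * std_normal_density z"])
    show "integrable lborel (\<lambda>z. B * std_normal_density z)" by (intro integrable_mult_right) simp
    show "AE z in lborel. (\<lambda>n. ?s n z) \<longlonglongrightarrow> f x * complex_of_real (std_normal_density z)"
    proof (rule AE_I2)
      fix z
      have "(\<lambda>n. x - (1 / real (Suc n)) * z) \<longlonglongrightarrow> x - 0 * z"
        by (intro tendsto_intros LIMSEQ_Suc[OF lim_1_over_n])
      then have "(\<lambda>n. f (x - (1 / real (Suc n)) * z)) \<longlonglongrightarrow> f x"
        by (intro isCont_tendsto_compose[OF cont]) simp
      then show "(\<lambda>n. ?s n z) \<longlonglongrightarrow> f x * complex_of_real (std_normal_density z)"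
        by (intro tendsto_mult tendsto_const)
    qed
    show "AE z in lborel. norm (?s n z) \<le> B * std_normal_density z" for n
      by (rule AE_I2) (simp add: norm_mult mult_right_mono B)
  qed measurable
  also have "(LINT z|lborel. f x * complex_of_real (std_normal_density z)) = f x"
  proof -
    have "(LINT z|lborel. complex_of_real (std_normal_density z)) = 1"
      by (subst integral_complex_of_real) simp
    then show ?thesis by (simp only: Bochner_Integration.integral_mult_right_zero mult_1_right)
  qed
  finally show ?thesis by (simp only: conv_nd_eq[OF divide_pos_pos[OF zero_less_one of_nat_0_less_iff[THEN iffD2, OF zero_less_Suc]]])
qed

definition stepf :: "complex \<Rightarrow> real \<Rightarrow> real \<Rightarrow> real \<Rightarrow> complex" where
  "stepf c a b x = c * indicator {a..b} x"

lemma stepf_L1_L2: "integrable lborel (stepf c a b)" "sq_integrable (stepf c a b)"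
proof -
  have [measurable]: "stepf c a b \<in> borel_measurable borel" unfolding stepf_def by measurable
  have i: "integrable lborel (indicator {a..b} :: real \<Rightarrow> real)"
    by (rule integrable_real_indicator) (auto simp: emeasure_lborel_Icc_eq)
  have "integrable lborel (\<lambda>x. (indicator {a..b} x :: real) *\<^sub>R c)"
    using i by (rule integrable_scaleR_left)
  then show "integrable lborel (stepf c a b)"
    by (rule Bochner_Integration.integrable_bound) (auto simp: stepf_def indicator_def)
  have "integrable lborel (\<lambda>x. (cmod c)\<^sup>2 * (indicator {a..b} x :: real))"
    using i by (rule integrable_mult_right)
  moreover have "(cmod (stepf c a b x))\<^sup>2 = (cmod c)\<^sup>2 * indicator {a..b} x" for x
    by (simp add: stepf_def indicator_def)
  ultimately show "sq_integrable (stepf c a b)" by (simp add: sq_integrable_def)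
qed

lemma isCont_stepf: "x \<noteq> a \<Longrightarrow> x \<noteq> b \<Longrightarrow> isCont (stepf c a b) x"
proof -
  assume x: "x \<noteq> a" "x \<noteq> b"
  have "open (- {a, b})" by (intro open_Compl finite_imp_closed) simp
  then have ev: "\<forall>\<^sub>F y in nhds x. y \<in> - {a, b}" using x by (intro eventually_nhds_in_open) auto
  consider "x < a" | "x > b" | "a < x" "x < b" using x by linarith
  then have "\<exists>k. \<forall>\<^sub>F y in nhds x. stepf c a b y = k"
  proof cases
    case 1
    have "\<forall>\<^sub>F y in nhds x. y \<in> {..<a}" using 1 by (intro eventually_nhds_in_open) auto
    then have "\<forall>\<^sub>F y in nhds x. stepf c a b y = 0" by eventually_elim (auto simp: stepf_def)
    then show ?thesis by blast
  next
    case 2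
    have "\<forall>\<^sub>F y in nhds x. y \<in> {b<..}" using 2 by (intro eventually_nhds_in_open) auto
    then have "\<forall>\<^sub>F y in nhds x. stepf c a b y = 0" by eventually_elim (auto simp: stepf_def)
    then show ?thesis by blast
  next
    case 3
    have "\<forall>\<^sub>F y in nhds x. y \<in> {a<..<b}" using 3 by (intro eventually_nhds_in_open) auto
    then have "\<forall>\<^sub>F y in nhds x. stepf c a b y = c" by eventually_elim (auto simp: stepf_def)
    then show ?thesis by blast
  qed
  then obtain k where "\<forall>\<^sub>F y in nhds x. stepf c a b y = k" by blast
  then show ?thesis using isCont_cong[of "stepf c a b" "\<lambda>_. k" x] by simp
qed

text \<open>
  Damping the transform by \<open>gs (1/n)\<close> gives a sequence that converges to the left-hand side in the mean. By
  \<open>ft_regularised\<close> its members are Gaussian averages, which converge pointwise to the step function off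
  its two jumps. Both limits agree.
\<close>

lemma fourier_inversion_stepf:
  "l2_reflect (fourier (fourier (to_l2 (stepf c a b)))) = (2 * pi) *\<^sub>R to_l2 (stepf c a b)"
proof -
  let ?f = "stepf c a b" and ?e = "\<lambda>n. 1 / real (Suc n)"
  note f = stepf_L1_L2[of c a b]
  have [measurable]: "?f \<in> borel_measurable borel" using f by auto
  have e: "?e n > 0" for n by simp
  let ?X = "\<lambda>n. l2_reflect (fourier (l2_mult (gs (?e n)) (fourier (to_l2 ?f))))"
  have lim: "(\<lambda>n. l2_mult (gs (?e n)) (fourier (to_l2 ?f))) \<longlonglongrightarrow> l2_mult (\<lambda>_. 1) (fourier (to_l2 ?f))"
  proof (rule tendsto_l2_mult[where C=1])
    show "AE x in lborel. (\<lambda>n. gs (?e n) x) \<longlonglongrightarrow> 1"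
    proof (rule AE_I2)
      fix x :: real
      have "(\<lambda>n. gs (?e n) x) \<longlonglongrightarrow> of_real (exp (- (0 * x)\<^sup>2 / 2))"
        unfolding gs_def by (intro tendsto_intros LIMSEQ_Suc[OF lim_1_over_n]) auto
      then show "(\<lambda>n. gs (?e n) x) \<longlonglongrightarrow> 1" by simp
    qed
  qed (simp_all add: norm_gs_le)
  have X: "?X \<longlonglongrightarrow> l2_reflect (fourier (fourier (to_l2 ?f)))"
    using bounded_linear.tendsto[OF bounded_linear_l2_reflect bounded_linear.tendsto[OF bounded_linear_fourier lim]]
    by simp
  have bg: "bdd_symbol (gs r)" for r by (rule bdd_symbolI[OF gs_measurable norm_gs_le])
  have rep: "AE x in lborel. rep_l2 (?X n) x = 2 * pi * conv ?f (nd (?e n)) x" for n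
  proof -
    let ?h = "\<lambda>\<xi>. gs (?e n) \<xi> * ft ?f \<xi>"
    have h2: "sq_integrable ?h" by (intro sq_integrable_mult_bdd bg ft_L2 f)
    have h1: "integrable lborel ?h"
      by (rule integrable_gs_mult[OF e _ norm_ft_le[OF f(1)]]) measurable
    have eq: "?X n = to_l2 (\<lambda>x. ft ?h (- x))"
      unfolding fourier_to_l2[OF f] l2_mult_to_l2[OF gs_measurable ft_L2(1)[OF f]]
        fourier_to_l2[OF h1 h2] l2_reflect_to_l2[OF ft_L2(1)[OF h1 h2]] ..
    have "AE x in lborel. rep_l2 (to_l2 (\<lambda>x. ft ?h (- x))) x = ft ?h (- x)"
      by (rule rep_l2_to_l2[OF sq_integrable_uminus_arg[OF ft_L2(1)[OF h1 h2]]])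
    then show ?thesis unfolding eq[symmetric] by (simp only: ft_regularised[OF f(1) e])
  qed
  have "AE x in lborel. \<forall>n. rep_l2 (?X n) x = 2 * pi * conv ?f (nd (?e n)) x"
    unfolding AE_all_countable by (intro allI rep)
  moreover have "AE x in lborel. x \<noteq> a" "AE x in lborel. x \<noteq> b"
    by (rule AE_lborel_singleton)+
  ultimately have "AE x in lborel. (\<lambda>n. rep_l2 (?X n) x) \<longlonglongrightarrow> 2 * pi * ?f x"
  proof eventually_elim
    case (elim x)
    have "(\<lambda>n. conv ?f (nd (?e n)) x) \<longlonglongrightarrow> ?f x"
      using isCont_stepf[OF elim(2,3)]
      by (intro conv_nd_tendsto[where B="cmod c"]) (auto simp: stepf_def indicator_def)
    then have "(\<lambda>n. 2 * pi * conv ?f (nd (?e n)) x) \<longlonglongrightarrow> 2 * pi * ?f x"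
      by (intro tendsto_mult tendsto_const)
    then show ?case by (simp only: elim)
  qed
  from l2_tendsto_AE_unique[OF X this]
  have "l2_reflect (fourier (fourier (to_l2 ?f))) = to_l2 (\<lambda>x. 2 * pi * ?f x)"
    by simp
  also have "\<dots> = (2 * pi) *\<^sub>R to_l2 ?f"
    using to_l2_scaleR[OF f(2), of "2 * pi"] by (simp add: scaleR_conv_of_real)
  finally show ?thesis .
qed

text \<open>
  The integrals of \<open>g\<close> over intervals vanish, hence so do those over all Borel subsets of a bounded window: these
  form a Dynkin class over the intervals. A function all of whose set integrals vanish is zero.
\<close>

lemma l2_zero_if_stepf_orthogonal:
  assumes "\<And>c a b. g \<bullet> to_l2 (stepf c a b) = 0"
  shows "g = 0"
proof -
  have eq: "(LINT x|lborel. indicator {a..b} x *\<^sub>R rep_l2 g x) = 0" for a b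
  proof -
    have i: "integrable lborel (\<lambda>x. indicator {a..b} x *\<^sub>R rep_l2 g x)"
      using integrable_mult_sq_integrable[OF stepf_L1_L2(2)[of 1 a b] sq_integrable_rep_l2[of g]]
      by (rule Bochner_Integration.integrable_bound) (auto simp: stepf_def indicator_def)
    have *: "g \<bullet> to_l2 (stepf c a b) = (LINT x|lborel. c \<bullet> (indicator {a..b} x *\<^sub>R rep_l2 g x))" for c
    proof -
      have "g \<bullet> to_l2 (stepf c a b) = (LINT x|lborel. rep_l2 g x \<bullet> stepf c a b x)"
        using inner_to_l2[OF sq_integrable_rep_l2[of g] stepf_L1_L2(2)[of c a b]] by simp
      also have "\<dots> = (LINT x|lborel. c \<bullet> (indicator {a..b} x *\<^sub>R rep_l2 g x))"
        by (intro Bochner_Integration.integral_cong refl) (auto simp: stepf_def indicator_def inner_commute)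
      finally show ?thesis .
    qed
    have "c \<bullet> (LINT x|lborel. indicator {a..b} x *\<^sub>R rep_l2 g x) = 0" for c
      using *[of c] assms[of c a b] integral_inner_right[of c lborel "\<lambda>x. indicator {a..b} x *\<^sub>R rep_l2 g x"] i
      by simp
    then show ?thesis using inner_eq_zero_iff by metis
  qed
  have "AE x in lborel. indicator {-real n..real n} x *\<^sub>R rep_l2 g x = 0" for n :: nat
  proof (rule sigma_finite_measure.density_zero[OF sigma_finite_lborel])
    let ?h = "\<lambda>x. indicator {-real n..real n} x *\<^sub>R rep_l2 g x"
    show i: "integrable lborel ?h"
      using integrable_mult_sq_integrable[OF stepf_L1_L2(2)[of 1 "-real n" "real n"] sq_integrable_rep_l2[of g]]
      by (rule Bochner_Integration.integrable_bound) (auto simp: stepf_def indicator_def)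
    have si: "set_integrable lborel A ?h" if "A \<in> sets borel" for A
      unfolding set_integrable_def using that by (intro integrable_mult_indicator i) simp
    fix A :: "real set" assume "A \<in> sets lborel"
    then have "A \<in> sets borel" by simp
    then show "set_lebesgue_integral lborel A ?h = 0"
    proof (induction rule: borel_set_induct)
      case empty
      show ?case by (simp add: set_lebesgue_integral_def)
    next
      case (interval a b)
      have "set_lebesgue_integral lborel {a..b} ?h
        = (LINT x|lborel. indicator {max a (-real n)..min b (real n)} x *\<^sub>R rep_l2 g x)"
        unfolding set_lebesgue_integral_def
        by (intro Bochner_Integration.integral_cong refl) (auto simp: indicator_def)
      then show ?case by (simp only: eq)
    next
      case (compl A)
      have "set_lebesgue_integral lborel (A \<union> - A) ?h = set_lebesgue_integral lborel A ?h + set_lebesgue_integral lborel (-A) ?h"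
        using compl by (intro set_integral_Un si) auto
      moreover have "set_lebesgue_integral lborel (A \<union> - A) ?h = 0"
        unfolding set_lebesgue_integral_def using eq[of "-real n" "real n"] by simp
      ultimately show ?case using compl by simp
    next
      case (union f)
      have "set_lebesgue_integral lborel (\<Union>i. f i) ?h = (\<Sum>i. set_lebesgue_integral lborel (f i) ?h)"
        using union by (intro lebesgue_integral_countable_add si) (auto simp: disjoint_family_on_def)
      then show ?case by (simp add: union)
    qed
  qed
  then have "AE x in lborel. \<forall>n::nat. indicator {-real n..real n} x *\<^sub>R rep_l2 g x = 0"
    unfolding AE_all_countable by (rule allI)
  then have "AE x in lborel. rep_l2 g x = 0"
  proof eventually_elim
    case (elim x)
    obtain n :: nat where "\<bar>x\<bar> \<le> real n" using real_arch_simple by blast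
    then have "indicator {-real n..real n} x = (1::real)" by (auto simp: indicator_def)
    then show ?case using elim[rule_format, of n] by simp
  qed
  then have "to_l2 (\<lambda>x. 0) = g" by (intro to_l2_eqI) auto
  then show ?thesis by (simp add: to_l2_zero)
qed

text \<open>
  The operator \<open>A\<close> on the left is self-adjoint and equals \<open>2\<pi>\<close> on step functions. Therefore \<open>A f - 2\<pi> f\<close> is
  orthogonal to all step functions.
\<close>

theorem fourier_inversion: "l2_reflect (fourier (fourier f)) = (2 * pi) *\<^sub>R f"
proof -
  let ?A = "\<lambda>f. l2_reflect (fourier (fourier f))"
  have adj: "?A f \<bullet> h = f \<bullet> ?A h" for h
  proof -
    have "?A f \<bullet> h = fourier (fourier f) \<bullet> l2_reflect h"
      by (rule inner_l2_reflect)
    also have "\<dots> = fourier f \<bullet> fourier h"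
      by (simp add: inner_fourier fourier_reflect)
    also have "\<dots> = f \<bullet> ?A h"
      by (rule inner_fourier)
    finally show ?thesis .
  qed
  have "?A f - (2 * pi) *\<^sub>R f = 0"
    by (rule l2_zero_if_stepf_orthogonal)
       (simp add: inner_diff_left adj fourier_inversion_stepf)
  then show ?thesis by simp
qed

definition fourier_inv :: "l2 \<Rightarrow> l2" where
  "fourier_inv g = (1 / (2 * pi)) *\<^sub>R l2_reflect (fourier g)"

lemma fourier_inv_fourier [simp]: "fourier_inv (fourier f) = f"
  by (simp add: fourier_inv_def fourier_inversion)

lemma fourier_fourier_inv [simp]: "fourier (fourier_inv g) = g"
proof -
  have "fourier (fourier_inv g) = (1 / (2 * pi)) *\<^sub>R fourier (l2_reflect (fourier g))"
    unfolding fourier_inv_def by (rule linear_cmul[OF bounded_linear.linear[OF bounded_linear_fourier]])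
  then show ?thesis by (simp add: fourier_reflect fourier_inversion)
qed

lemma bounded_linear_fourier_inv: "bounded_linear fourier_inv"
  unfolding fourier_inv_def[abs_def]
  by (intro bounded_linear_const_scaleR bounded_linear_compose[OF bounded_linear_l2_reflect bounded_linear_fourier])

lemma fourier_inject: "fourier f = fourier g \<Longrightarrow> f = g"
  using fourier_inv_fourier by metis

lemma fourier_mult_eq:
  assumes "m \<in> borel_measurable borel" "sq_integrable (\<lambda>\<xi>. m \<xi> * rep_l2 (fourier f) \<xi>)"
  shows "fourier_mult m f = fourier_inv (to_l2 (\<lambda>\<xi>. m \<xi> * rep_l2 (fourier f) \<xi>))"
  unfolding fourier_mult_def
proof (rule the_equality)
  have [measurable]: "m \<in> borel_measurable borel" by fact
  show "AE \<xi> in lborel. rep_l2 (fourier (fourier_inv (to_l2 (\<lambda>\<xi>. m \<xi> * rep_l2 (fourier f) \<xi>)))) \<xi> = m \<xi> * rep_l2 (fourier f) \<xi>"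
    unfolding fourier_fourier_inv by (rule rep_l2_to_l2[OF assms(2)])
  fix g assume g: "AE \<xi> in lborel. rep_l2 (fourier g) \<xi> = m \<xi> * rep_l2 (fourier f) \<xi>"
  have "to_l2 (\<lambda>\<xi>. m \<xi> * rep_l2 (fourier f) \<xi>) = fourier g"
    using g by (intro to_l2_eqI) auto
  then show "g = fourier_inv (to_l2 (\<lambda>\<xi>. m \<xi> * rep_l2 (fourier f) \<xi>))" by simp
qed

lemma fourier_mult_bdd: "bdd_symbol m \<Longrightarrow> fourier_mult m f = fourier_inv (l2_mult m (fourier f))"
  unfolding l2_mult_def by (rule fourier_mult_eq[OF bdd_symbol_measurable sq_integrable_mult_rep])

section \<open>Products and convolution\<close>

lemma conv_add_left:
  assumes "sq_integrable f" "sq_integrable f'" "sq_integrable g"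
  shows "conv (\<lambda>y. f y + f' y) g x = conv f g x + conv f' g x"
  using integrable_conv_integrand[OF assms(1,3), of x] integrable_conv_integrand[OF assms(2,3), of x]
  by (simp add: conv_def distrib_right)

lemma conv_cmult_left: "conv (\<lambda>y. c * f y) g x = c * conv f g x"
  by (simp add: conv_def mult.assoc)

lemma conv_cmult_right: "conv f (\<lambda>y. c * g y) x = c * conv f g x"
  by (simp add: conv_commute[of f] conv_cmult_left)

lemma integral_conv:
  assumes "integrable lborel a" "integrable lborel b"
  shows "integral\<^sup>L lborel (conv a b) = integral\<^sup>L lborel a * integral\<^sup>L lborel b"
proof -
  have "integral\<^sup>L lborel (conv a b) = (LINT x|lborel. LINT y|lborel. a y * b (x - y))"
    by (simp add: conv_def[abs_def])
  also have "\<dots> = (LINT y|lborel. LINT x|lborel. a y * b (x - y))"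
    using lborel_pair.Fubini_integral[OF integrable_conv_kernel[OF assms]] .
  also have "\<dots> = (LINT y|lborel. a y * integral\<^sup>L lborel b)"
    by (simp add: integral_lborel_shift)
  finally show ?thesis by simp
qed

lemma integral_norm_conv_le:
  assumes "integrable lborel a" "integrable lborel b"
  shows "(LINT x|lborel. cmod (conv a b x)) \<le> (LINT x|lborel. cmod (a x)) * (LINT x|lborel. cmod (b x))"
proof -
  let ?a = "\<lambda>x. complex_of_real (cmod (a x))" and ?b = "\<lambda>x. complex_of_real (cmod (b x))"
  have i: "integrable lborel ?a" "integrable lborel ?b" using assms by auto
  have eq: "conv ?a ?b x = of_real (LINT y|lborel. cmod (a y * b (x - y)))" for x
    unfolding conv_def by (simp add: norm_mult flip: of_real_mult)
  have "(LINT x|lborel. cmod (conv a b x)) \<le> (LINT x|lborel. cmod (conv ?a ?b x))"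
  proof (rule integral_mono)
    show "integrable lborel (\<lambda>x. cmod (conv a b x))" by (intro integrable_norm integrable_conv assms)
    show "integrable lborel (\<lambda>x. cmod (conv ?a ?b x))" by (intro integrable_norm integrable_conv i)
    show "cmod (conv a b x) \<le> cmod (conv ?a ?b x)" for x
      unfolding eq conv_def[of a] norm_of_real
      by (rule order_trans[OF integral_norm_bound abs_ge_self])
  qed
  also have "\<dots> = cmod (integral\<^sup>L lborel (conv ?a ?b))"
  proof -
    have "complex_of_real (LINT x|lborel. cmod (conv ?a ?b x)) = integral\<^sup>L lborel (conv ?a ?b)"
      unfolding integral_complex_of_real[symmetric]
      by (intro Bochner_Integration.integral_cong refl) (simp add: eq)
    then have "cmod (integral\<^sup>L lborel (conv ?a ?b)) = \<bar>LINT x|lborel. cmod (conv ?a ?b x)\<bar>"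
      by (metis norm_of_real)
    then show ?thesis by simp
  qed
  also have "\<dots> = (LINT x|lborel. cmod (a x)) * (LINT x|lborel. cmod (b x))"
    by (simp add: integral_conv i norm_mult)
  finally show ?thesis .
qed

text \<open>
  The factor \<open>chr (x \<xi>) = chr (y \<xi>) \<cdot> chr ((x - y) \<xi>)\<close> distributes over the two arguments of the
  convolution; the integral of a convolution is the product of the integrals.
\<close>

lemma ft_conv:
  assumes "integrable lborel a" "integrable lborel b"
  shows "ft (conv a b) \<xi> = ft a \<xi> * ft b \<xi>"
proof -
  let ?a = "\<lambda>x. chr (x * \<xi>) * a x" and ?b = "\<lambda>x. chr (x * \<xi>) * b x"
  have "chr (x * \<xi>) * conv a b x = conv ?a ?b x" for x
  proof -
    have "chr (x * \<xi>) * conv a b x = (LINT y|lborel. chr (x * \<xi>) * (a y * b (x - y)))"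
      by (simp add: conv_def)
    also have "\<dots> = conv ?a ?b x"
      unfolding conv_def
    proof (rule Bochner_Integration.integral_cong[OF refl])
      fix y
      have "chr (x * \<xi>) = chr (y * \<xi>) * chr ((x - y) * \<xi>)"
        unfolding chr_add[symmetric] by (simp add: left_diff_distrib)
      then show "chr (x * \<xi>) * (a y * b (x - y)) = chr (y * \<xi>) * a y * (chr ((x - y) * \<xi>) * b (x - y))"
        by simp
    qed
    finally show ?thesis .
  qed
  then have "ft (conv a b) \<xi> = integral\<^sup>L lborel (conv ?a ?b)"
    by (simp add: ft_def)
  also have "\<dots> = ft a \<xi> * ft b \<xi>"
    by (subst integral_conv) (simp_all add: integrable_chr_mult assms ft_def)
  finally show ?thesis .
qed

lemma rep_l2_eq_ft:
  assumes "integrable lborel (rep_l2 (fourier u))"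
  shows "AE x in lborel. rep_l2 u x = 1 / (2 * pi) * ft (rep_l2 (fourier u)) (- x)"
proof -
  let ?U = "rep_l2 (fourier u)"
  have s: "sq_integrable (\<lambda>x. ft ?U (- x))"
    by (intro sq_integrable_uminus_arg ft_L2 assms sq_integrable_rep_l2)
  have "u = (1 / (2 * pi)) *\<^sub>R l2_reflect (fourier (to_l2 ?U))"
    using fourier_inv_fourier[of u] by (simp add: fourier_inv_def)
  also have "\<dots> = (1 / (2 * pi)) *\<^sub>R to_l2 (\<lambda>x. ft ?U (- x))"
    by (simp only: fourier_to_l2[OF assms sq_integrable_rep_l2] l2_reflect_to_l2[OF ft_L2(1)[OF assms sq_integrable_rep_l2]])
  also have "\<dots> = to_l2 (\<lambda>x. (1 / (2 * pi)) *\<^sub>R ft ?U (- x))"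
    by (rule to_l2_scaleR[OF s, symmetric])
  finally have e: "u = to_l2 (\<lambda>x. (1 / (2 * pi)) *\<^sub>R ft ?U (- x))" .
  have "AE x in lborel. rep_l2 u x = (1 / (2 * pi)) *\<^sub>R ft ?U (- x)"
    using rep_l2_to_l2[OF sq_integrable_scaleR[OF s, of "1 / (2 * pi)"]] unfolding e[symmetric] .
  then show ?thesis by eventually_elim (simp add: scaleR_conv_of_real)
qed

text \<open>
  When the transforms are integrable, both functions are given by their inversion integrals almost
  everywhere, and by \<open>ft_conv\<close> the product of these is the inversion integral of the convolution. Convolving preserves
  \<open>L\<^sup>1 \<inter> L\<^sup>2\<close>, so the inversion formula applies to the result.
\<close>

theorem fourier_product:
  assumes u: "integrable lborel (rep_l2 (fourier u))" and v: "integrable lborel (rep_l2 (fourier v))"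
  shows "sq_integrable (\<lambda>x. rep_l2 u x * rep_l2 v x)"
    and "fourier (to_l2 (\<lambda>x. rep_l2 u x * rep_l2 v x))
      = (1 / (2 * pi)) *\<^sub>R to_l2 (conv (rep_l2 (fourier u)) (rep_l2 (fourier v)))"
proof -
  let ?U = "rep_l2 (fourier u)" and ?V = "rep_l2 (fourier v)"
  let ?c = "1 / (2 * pi) * (1 / (2 * pi))"
  have cL: "integrable lborel (conv ?U ?V)" "sq_integrable (conv ?U ?V)"
    by (intro integrable_conv u v, intro Young_L1_L2(1) u sq_integrable_rep_l2)
  have fs: "sq_integrable (\<lambda>x. ft (conv ?U ?V) (- x))"
    by (intro sq_integrable_uminus_arg ft_L2 cL)
  have ae: "AE x in lborel. ?c *\<^sub>R ft (conv ?U ?V) (- x) = rep_l2 u x * rep_l2 v x"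
    using rep_l2_eq_ft[OF u] rep_l2_eq_ft[OF v]
  proof eventually_elim
    case (elim x)
    show ?case unfolding elim ft_conv[OF u v] by (simp add: scaleR_conv_of_real)
  qed
  have m: "(\<lambda>x. rep_l2 u x * rep_l2 v x) \<in> borel_measurable borel" by measurable
  show "sq_integrable (\<lambda>x. rep_l2 u x * rep_l2 v x)"
    by (rule sq_integrable_cong_AE[OF sq_integrable_scaleR[OF fs] m ae])
  have "to_l2 (\<lambda>x. rep_l2 u x * rep_l2 v x) = to_l2 (\<lambda>x. ?c *\<^sub>R ft (conv ?U ?V) (- x))"
    by (rule to_l2_cong_AE[OF sq_integrable_measurable[OF sq_integrable_scaleR[OF fs]] m ae, symmetric])
  also have "\<dots> = ?c *\<^sub>R l2_reflect (fourier (to_l2 (conv ?U ?V)))"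
    by (simp only: to_l2_scaleR[OF fs] fourier_to_l2[OF cL] l2_reflect_to_l2[OF ft_L2(1)[OF cL]])
  also have "\<dots> = (1 / (2 * pi)) *\<^sub>R fourier_inv (to_l2 (conv ?U ?V))"
    by (simp add: fourier_inv_def)
  finally have "fourier (to_l2 (\<lambda>x. rep_l2 u x * rep_l2 v x))
    = fourier ((1 / (2 * pi)) *\<^sub>R fourier_inv (to_l2 (conv ?U ?V)))" by simp
  then show "fourier (to_l2 (\<lambda>x. rep_l2 u x * rep_l2 v x)) = (1 / (2 * pi)) *\<^sub>R to_l2 (conv ?U ?V)"
    by (simp only: linear_cmul[OF bounded_linear.linear[OF bounded_linear_fourier]] fourier_fourier_inv)
qed

section \<open>Weighted convolution estimates\<close>

text \<open>
  The power \<open>r\<close> of the bracket \<open>(1 + \<xi>\<^sup>2)\<^bsup>1/2\<^esup>\<close>; \<open>jc\<close> is the same weight with complex values.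
\<close>

definition jp :: "real \<Rightarrow> real \<Rightarrow> real" where
  "jp r \<xi> = (1 + \<xi>\<^sup>2) powr (r / 2)"

lemma jp_pos [simp]: "0 < jp r \<xi>"
proof -
  have "0 < 1 + \<xi>\<^sup>2" by (simp add: add_pos_nonneg)
  then show ?thesis by (simp add: jp_def)
qed

lemma jp_nonneg [simp]: "0 \<le> jp r \<xi>"
  using jp_pos[of r \<xi>] by linarith

lemma jp_add: "jp (r + s) \<xi> = jp r \<xi> * jp s \<xi>"
  by (simp add: jp_def add_divide_distrib powr_add)

lemma jp_0 [simp]: "jp 0 \<xi> = 1"
proof -
  have "0 < 1 + \<xi>\<^sup>2" by (simp add: add_pos_nonneg)
  then show ?thesis by (simp add: jp_def)
qed

lemma jp_cancel: "jp r \<xi> * jp (- r) \<xi> = 1" "jp (- r) \<xi> * jp r \<xi> = 1"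
  by (simp_all flip: jp_add)

lemma jp_minus [simp]: "jp r (- \<xi>) = jp r \<xi>"
  by (simp add: jp_def)

lemma jp_mono: "r \<le> s \<Longrightarrow> jp r \<xi> \<le> jp s \<xi>"
  by (simp add: jp_def powr_mono)

lemma jp_le_1: "r \<le> 0 \<Longrightarrow> jp r \<xi> \<le> 1"
  using jp_mono[of r 0 \<xi>] by simp

lemma jp_ge_1: "r \<ge> 0 \<Longrightarrow> 1 \<le> jp r \<xi>"
  using jp_mono[of 0 r \<xi>] by simp

lemma jp_2: "jp 2 \<xi> = 1 + \<xi>\<^sup>2"
proof -
  have "0 < 1 + \<xi>\<^sup>2" by (simp add: add_pos_nonneg)
  then show ?thesis by (simp add: jp_def)
qed

lemma abs_le_jp_1: "\<bar>\<xi>\<bar> \<le> jp 1 \<xi>"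
proof -
  have "(jp 1 \<xi>)\<^sup>2 = 1 + \<xi>\<^sup>2"
    using jp_add[of 1 1 \<xi>] jp_2[of \<xi>] by (simp add: power2_eq_square)
  then have "\<bar>\<xi>\<bar>\<^sup>2 \<le> (jp 1 \<xi>)\<^sup>2" by simp
  then show ?thesis by (rule power2_le_imp_le) simp
qed

lemma jp_measurable [measurable (raw)]:
  "f \<in> borel_measurable M \<Longrightarrow> (\<lambda>x. jp r (f x)) \<in> borel_measurable M"
  unfolding jp_def by measurable

lemma jp_square: "(jp r \<xi>)\<^sup>2 = (1 + \<xi>\<^sup>2) powr r"
proof -
  have "(jp r \<xi>)\<^sup>2 = jp (r + r) \<xi>" unfolding jp_add by (simp add: power2_eq_square)
  then show ?thesis by (simp add: jp_def)
qed

text \<open>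
  One of \<open>\<bar>y\<bar>\<close>, \<open>\<bar>\<xi> - y\<bar>\<close> is at least \<open>\<bar>\<xi>\<bar>/2\<close>. This is how a weight on a convolution is shifted
  onto one of the factors.
\<close>

lemma jp_subadditive:
  assumes "r \<ge> 0" shows "jp r \<xi> \<le> 2 powr r * (jp r y + jp r (\<xi> - y))"
proof -
  have pos: "0 < 1 + t\<^sup>2" for t :: real by (simp add: add_pos_nonneg)
  have "\<xi>\<^sup>2 \<le> 2 * y\<^sup>2 + 2 * (\<xi> - y)\<^sup>2"
    using zero_le_power2[of "\<xi> - 2 * y"] by (simp add: power2_eq_square algebra_simps)
  then have "1 + \<xi>\<^sup>2 \<le> 4 * max (1 + y\<^sup>2) (1 + (\<xi> - y)\<^sup>2)"
    by (cases "y\<^sup>2 \<le> (\<xi> - y)\<^sup>2") (auto simp: max_def)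
  then have "jp r \<xi> \<le> (4 * max (1 + y\<^sup>2) (1 + (\<xi> - y)\<^sup>2)) powr (r / 2)"
    unfolding jp_def using assms pos[of \<xi>] by (intro powr_mono2) auto
  also have "\<dots> = 4 powr (r / 2) * max (1 + y\<^sup>2) (1 + (\<xi> - y)\<^sup>2) powr (r / 2)"
    by (rule powr_mult)
  also have "4 powr (r / 2) = (2::real) powr r"
    using powr_powr[of 2 2 "r / 2"] by simp
  also have "max (1 + y\<^sup>2) (1 + (\<xi> - y)\<^sup>2) powr (r / 2) \<le> jp r y + jp r (\<xi> - y)"
    using jp_nonneg[of r y] jp_nonneg[of r "\<xi> - y"] by (auto simp: max_def jp_def)
  finally show ?thesis by simp
qed

definition jc :: "real \<Rightarrow> real \<Rightarrow> complex" where
  "jc r \<xi> = of_real (jp r \<xi>)"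

lemma jc_measurable [measurable (raw)]:
  "f \<in> borel_measurable M \<Longrightarrow> (\<lambda>x. jc r (f x)) \<in> borel_measurable M"
  unfolding jc_def by measurable

lemma norm_jc [simp]: "cmod (jc r \<xi>) = jp r \<xi>"
  by (simp add: jc_def)

lemma jc_add: "jc (r + s) \<xi> = jc r \<xi> * jc s \<xi>"
  by (simp add: jc_def jp_add)

lemma jc_0 [simp]: "jc 0 \<xi> = 1"
  by (simp add: jc_def)

lemma jc_minus [simp]: "jc r (- \<xi>) = jc r \<xi>"
  by (simp add: jc_def)

lemma cnj_jc [simp]: "cnj (jc r \<xi>) = jc r \<xi>"
  by (simp add: jc_def)

lemma jc_cancel: "jc r \<xi> * jc (- r) \<xi> = 1" "jc (- r) \<xi> * jc r \<xi> = 1"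
  by (simp_all flip: jc_add)

lemma jc_cancel_left: "jc r \<xi> * (jc (- r) \<xi> * z) = z" "jc (- r) \<xi> * (jc r \<xi> * z) = z"
  by (simp_all only: mult.assoc[symmetric] jc_cancel mult_1_left)

lemma bdd_symbol_jc [simp]: "r \<le> 0 \<Longrightarrow> bdd_symbol (jc r)"
  by (intro bdd_symbolI[where C=1]) (simp_all add: jp_le_1 jc_measurable)

lemma sq_integrable_jc_minus_1: "sq_integrable (jc (- 1))"
proof -
  have "(cmod (jc (- 1) \<xi>))\<^sup>2 = inverse (1 + \<xi>\<^sup>2)" for \<xi>
  proof -
    have "0 < 1 + \<xi>\<^sup>2" by (simp add: add_pos_nonneg)
    then show ?thesis by (simp add: jp_square powr_minus)
  qed
  moreover have "integrable lborel (\<lambda>\<xi>::real. inverse (1 + \<xi>\<^sup>2))"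
    using integrable_inverse_1_plus_square by (simp add: set_integrable_def)
  ultimately show ?thesis by (simp add: sq_integrable_def)
qed

text \<open>
  The constant of the embedding of the Sobolev space of order \<open>1\<close> into the functions with integrable transform.
\<close>

definition jK :: real where
  "jK = norm (to_l2 (jc (- 1)))"

lemma jK_nonneg [simp]: "0 \<le> jK"
  by (simp add: jK_def)

lemma integrable_of_weight_1:
  assumes "f \<in> borel_measurable borel" "sq_integrable (\<lambda>\<xi>. jc 1 \<xi> * f \<xi>)"
  shows "integrable lborel f"
    and "(LINT \<xi>|lborel. cmod (f \<xi>)) \<le> jK * norm (to_l2 (\<lambda>\<xi>. jc 1 \<xi> * f \<xi>))"
  using integrable_mult_sq_integrable[OF sq_integrable_jc_minus_1 assms(2)]
    norm_integral_mult_le[OF sq_integrable_jc_minus_1 assms(2)]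
  by (simp_all add: jc_cancel_left jK_def)

text \<open>
  Shifting the weight onto the factors by \<open>jp_subadditive\<close> leaves two convolutions of an integrable with
  a square integrable function. The bound is linear in the weighted norms; the other factor enters only
  through its \<open>L\<^sup>1\<close> norm.
\<close>

lemma weighted_conv:
  assumes r: "0 \<le> r" and f: "integrable lborel f" "sq_integrable (\<lambda>\<xi>. jc r \<xi> * f \<xi>)"
    and g: "integrable lborel g" "sq_integrable (\<lambda>\<xi>. jc r \<xi> * g \<xi>)"
  shows "sq_integrable (\<lambda>\<xi>. jc r \<xi> * conv f g \<xi>)"
    and "norm (to_l2 (\<lambda>\<xi>. jc r \<xi> * conv f g \<xi>))
      \<le> 2 powr r * ((LINT \<xi>|lborel. cmod (f \<xi>)) * norm (to_l2 (\<lambda>\<xi>. jc r \<xi> * g \<xi>))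
                    + norm (to_l2 (\<lambda>\<xi>. jc r \<xi> * f \<xi>)) * (LINT \<xi>|lborel. cmod (g \<xi>)))"
proof -
  have [measurable]: "f \<in> borel_measurable borel" "g \<in> borel_measurable borel" using f g by auto
  \<comment> \<open>the pointwise bound \<open>pt\<close> below is a sum of two convolutions of absolute values\<close>
  let ?n = "\<lambda>h \<xi>. complex_of_real (cmod (h \<xi>))"
  let ?F = "\<lambda>\<xi>. jc r \<xi> * f \<xi>" and ?G = "\<lambda>\<xi>. jc r \<xi> * g \<xi>"
  have nsq: "sq_integrable (?n h)" "norm (to_l2 (?n h)) = norm (to_l2 h)" if "sq_integrable h" for h
  proof -
    show s: "sq_integrable (?n h)" using that by (auto simp: sq_integrable_def)
    show "norm (to_l2 (?n h)) = norm (to_l2 h)"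
      by (rule power2_eq_imp_eq) (simp_all add: norm_to_l2_sq s that)
  qed
  have weaken: "sq_integrable h" if "sq_integrable (\<lambda>\<xi>. jc r \<xi> * h \<xi>)" "h \<in> borel_measurable borel" for h
  proof (rule sq_integrable_bound[OF that])
    show "AE x in lborel. cmod (h x) \<le> 1 * cmod (jc r x * h x)"
      using jp_ge_1[OF r] by (intro AE_I2) (simp add: norm_mult mult_le_cancel_right1)
  qed
  have f2: "sq_integrable f" by (rule weaken[OF f(2)]) measurable
  have g2: "sq_integrable g" by (rule weaken[OF g(2)]) measurable
  let ?H = "\<lambda>\<xi>. conv (?n f) (?n ?G) \<xi> + conv (?n g) (?n ?F) \<xi>"
  have nf1: "integrable lborel (?n f)" "integrable lborel (?n g)" using f g by auto
  note Y1 = Young_L1_L2[OF nf1(1) nsq(1)[OF g(2)]] and Y2 = Young_L1_L2[OF nf1(2) nsq(1)[OF f(2)]]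
  have H: "sq_integrable ?H" by (rule sq_integrable_add[OF Y1(1) Y2(1)])
  have nH: "norm (to_l2 ?H) \<le> (LINT \<xi>|lborel. cmod (f \<xi>)) * norm (to_l2 ?G) + norm (to_l2 ?F) * (LINT \<xi>|lborel. cmod (g \<xi>))"
  proof -
    have "norm (to_l2 ?H) \<le> norm (to_l2 (conv (?n f) (?n ?G))) + norm (to_l2 (conv (?n g) (?n ?F)))"
      unfolding to_l2_add[OF Y1(1) Y2(1)] by (rule norm_triangle_ineq)
    also have "\<dots> \<le> (LINT \<xi>|lborel. cmod (f \<xi>)) * norm (to_l2 ?G) + (LINT \<xi>|lborel. cmod (g \<xi>)) * norm (to_l2 ?F)"
      using Y1(2) Y2(2) by (simp add: nsq(2)[OF f(2)] nsq(2)[OF g(2)])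
    finally show ?thesis by (simp add: mult.commute)
  qed
  have pt: "cmod (jc r \<xi> * conv f g \<xi>) \<le> 2 powr r * cmod (?H \<xi>)" for \<xi>
  proof -
    let ?p = "\<lambda>y. cmod (f y) * cmod (?G (\<xi> - y))" and ?q = "\<lambda>y. cmod (?F y) * cmod (g (\<xi> - y))"
    have ip: "integrable lborel ?p"
      using integrable_norm[OF integrable_conv_integrand[OF f2 g(2), of \<xi>]] by (simp add: norm_mult)
    have iq: "integrable lborel ?q"
      using integrable_norm[OF integrable_conv_integrand[OF f(2) g2, of \<xi>]] by (simp add: norm_mult)
    have i0: "integrable lborel (\<lambda>y. cmod (f y * g (\<xi> - y)))"
      by (rule integrable_norm[OF integrable_conv_integrand[OF f2 g2]])
    have le: "cmod (conv f g \<xi>) \<le> (LINT y|lborel. cmod (f y * g (\<xi> - y)))"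
      unfolding conv_def by (rule integral_norm_bound)
    have "cmod (jc r \<xi> * conv f g \<xi>) = jp r \<xi> * cmod (conv f g \<xi>)"
      by (simp only: norm_mult norm_jc)
    also have "\<dots> \<le> jp r \<xi> * (LINT y|lborel. cmod (f y * g (\<xi> - y)))"
      by (rule mult_left_mono[OF le jp_nonneg])
    also have "\<dots> = (LINT y|lborel. jp r \<xi> * cmod (f y * g (\<xi> - y)))" by simp
    also have "\<dots> \<le> (LINT y|lborel. 2 powr r * (?q y + ?p y))"
    proof (rule integral_mono)
      show "integrable lborel (\<lambda>y. jp r \<xi> * cmod (f y * g (\<xi> - y)))" by (rule integrable_mult_right[OF i0])
      show "integrable lborel (\<lambda>y. 2 powr r * (?q y + ?p y))"
        by (intro integrable_mult_right Bochner_Integration.integrable_add ip iq)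
      fix y
      have "jp r \<xi> * cmod (f y * g (\<xi> - y)) \<le> 2 powr r * (jp r y + jp r (\<xi> - y)) * cmod (f y * g (\<xi> - y))"
        by (rule mult_right_mono[OF jp_subadditive[OF r]]) simp
      also have "\<dots> = 2 powr r * (?q y + ?p y)"
        by (simp add: norm_mult algebra_simps)
      finally show "jp r \<xi> * cmod (f y * g (\<xi> - y)) \<le> 2 powr r * (?q y + ?p y)" .
    qed
    also have "\<dots> = 2 powr r * ((LINT y|lborel. ?p y) + (LINT y|lborel. ?q y))"
      using ip iq by simp
    also have "(LINT y|lborel. ?p y) + (LINT y|lborel. ?q y) = Re (?H \<xi>)"
    proof -
      have "conv (?n f) (?n ?G) \<xi> = of_real (LINT y|lborel. ?p y)"
        unfolding conv_def of_real_mult[symmetric] by (rule integral_complex_of_real)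
      moreover have "conv (?n g) (?n ?F) \<xi> = of_real (LINT y|lborel. ?q y)"
        unfolding conv_commute[of "?n g"] unfolding conv_def of_real_mult[symmetric] by (rule integral_complex_of_real)
      ultimately show ?thesis by simp
    qed
    also have "2 powr r * Re (?H \<xi>) \<le> 2 powr r * cmod (?H \<xi>)"
      by (intro mult_left_mono complex_Re_le_cmod) simp
    finally show ?thesis .
  qed
  have m: "(\<lambda>\<xi>. jc r \<xi> * conv f g \<xi>) \<in> borel_measurable borel" by measurable
  have ae: "AE \<xi> in lborel. cmod (jc r \<xi> * conv f g \<xi>) \<le> 2 powr r * cmod (?H \<xi>)"
    by (rule AE_I2) (rule pt)
  show S: "sq_integrable (\<lambda>\<xi>. jc r \<xi> * conv f g \<xi>)"
    by (rule sq_integrable_bound[OF H m ae])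
  have "norm (to_l2 (\<lambda>\<xi>. jc r \<xi> * conv f g \<xi>)) \<le> 2 powr r * norm (to_l2 ?H)"
    by (rule norm_to_l2_le[OF S H _ ae]) simp
  also have "\<dots> \<le> 2 powr r * ((LINT \<xi>|lborel. cmod (f \<xi>)) * norm (to_l2 ?G) + norm (to_l2 ?F) * (LINT \<xi>|lborel. cmod (g \<xi>)))"
    by (intro mult_left_mono nH) simp
  finally show "norm (to_l2 (\<lambda>\<xi>. jc r \<xi> * conv f g \<xi>))
      \<le> 2 powr r * ((LINT \<xi>|lborel. cmod (f \<xi>)) * norm (to_l2 ?G) + norm (to_l2 ?F) * (LINT \<xi>|lborel. cmod (g \<xi>)))" .
qed

text \<open>
  If \<open>a\<close> is the weighted transform of a function of Sobolev order \<open>r\<close>, then \<open>unw r a\<close> is its transform.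
  Accordingly \<open>wprod r\<close> is the pointwise product of two such functions seen through their weighted transforms, up to
  the factor \<open>2\<pi>\<close> (see \<open>product_low\<close> below).
\<close>

definition unw :: "real \<Rightarrow> l2 \<Rightarrow> real \<Rightarrow> complex" where
  "unw r a \<xi> = jc (- r) \<xi> * rep_l2 a \<xi>"

definition unw_L1 :: "real \<Rightarrow> l2 \<Rightarrow> real" where
  "unw_L1 r a = (LINT \<xi>|lborel. cmod (unw r a \<xi>))"

definition wprod :: "real \<Rightarrow> l2 \<Rightarrow> l2 \<Rightarrow> l2" where
  "wprod r a b = to_l2 (\<lambda>\<xi>. jc r \<xi> * conv (unw r a) (unw r b) \<xi>)"

lemma unw_measurable [measurable]: "unw r a \<in> borel_measurable borel"
  unfolding unw_def by measurable

lemma jc_unw: "jc r \<xi> * unw r a \<xi> = rep_l2 a \<xi>"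
  by (simp add: unw_def jc_cancel_left)

lemma jc_unw': "jc t \<xi> * unw r a \<xi> = jc (t - r) \<xi> * rep_l2 a \<xi>"
  unfolding unw_def using jc_add[of t "- r" \<xi>] by (simp add: mult.assoc)

lemma sq_integrable_jc_unw: "t \<le> r \<Longrightarrow> sq_integrable (\<lambda>\<xi>. jc t \<xi> * unw r a \<xi>)"
  unfolding jc_unw' by (rule sq_integrable_mult_rep) simp

lemma sq_integrable_unw: "0 \<le> r \<Longrightarrow> sq_integrable (unw r a)"
  using sq_integrable_jc_unw[of 0 r a] by simp

lemma integrable_unw: "1 \<le> r \<Longrightarrow> integrable lborel (unw r a)"
  by (rule integrable_of_weight_1(1)[OF unw_measurable sq_integrable_jc_unw])

lemma unw_L1_nonneg [simp]: "0 \<le> unw_L1 r a"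
  by (simp add: unw_L1_def)

lemma unw_L1_le: "1 \<le> r \<Longrightarrow> unw_L1 r a \<le> jK * norm (l2_mult (jc (1 - r)) a)"
  using integrable_of_weight_1(2)[OF unw_measurable sq_integrable_jc_unw[of 1 r a]]
  by (simp add: unw_L1_def l2_mult_def jc_unw')

lemma unw_L1_le_norm: "1 \<le> r \<Longrightarrow> unw_L1 r a \<le> jK * norm a"
proof -
  assume r: "1 \<le> r"
  have "norm (l2_mult (jc (1 - r)) a) \<le> 1 * norm a"
    using r by (intro norm_l2_mult_le) (simp_all add: jc_measurable jp_le_1)
  then have "jK * norm (l2_mult (jc (1 - r)) a) \<le> jK * norm a"
    by (intro mult_left_mono) simp_all
  then show ?thesis using unw_L1_le[OF r, of a] by linarith
qed

lemma sq_integrable_wprod: "1 \<le> r \<Longrightarrow> sq_integrable (\<lambda>\<xi>. jc r \<xi> * conv (unw r a) (unw r b) \<xi>)"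
  by (intro weighted_conv(1) integrable_unw sq_integrable_jc_unw) simp_all

text \<open>
  The tame form of the algebra property; \<open>unw_L1_wprod_le\<close> is its companion for iterated products.
\<close>

lemma norm_wprod_le:
  assumes r: "1 \<le> r"
  shows "norm (wprod r a b) \<le> 2 powr r * (unw_L1 r a * norm b + norm a * unw_L1 r b)"
proof -
  have r0: "0 \<le> r" using r by simp
  show ?thesis
    using weighted_conv(2)[OF r0 integrable_unw[OF r, of a] sq_integrable_jc_unw[OF order_refl]
        integrable_unw[OF r, of b] sq_integrable_jc_unw[OF order_refl]]
    by (simp add: wprod_def unw_L1_def jc_unw)
qed

lemma unw_wprod:
  assumes "1 \<le> r"
  shows "AE \<xi> in lborel. unw r (wprod r a b) \<xi> = conv (unw r a) (unw r b) \<xi>"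
  using rep_l2_to_l2[OF sq_integrable_wprod[OF assms, of a b]]
proof eventually_elim
  case (elim \<xi>)
  have "unw r (wprod r a b) \<xi> = jc (- r) \<xi> * rep_l2 (wprod r a b) \<xi>" by (rule unw_def)
  also have "\<dots> = conv (unw r a) (unw r b) \<xi>"
    unfolding wprod_def by (simp only: elim jc_cancel_left)
  finally show ?case .
qed

lemma unw_L1_wprod_le:
  assumes r: "1 \<le> r" shows "unw_L1 r (wprod r a b) \<le> unw_L1 r a * unw_L1 r b"
proof -
  have "unw_L1 r (wprod r a b) = (LINT \<xi>|lborel. cmod (conv (unw r a) (unw r b) \<xi>))"
    unfolding unw_L1_def
  proof (rule integral_cong_AE)
    show "AE \<xi> in lborel. cmod (unw r (wprod r a b) \<xi>) = cmod (conv (unw r a) (unw r b) \<xi>)"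
      using unw_wprod[OF r, of a b] by eventually_elim simp
  qed measurable
  also have "\<dots> \<le> unw_L1 r a * unw_L1 r b"
    unfolding unw_L1_def by (intro integral_norm_conv_le integrable_unw r)
  finally show ?thesis .
qed

lemma wprod_commute: "wprod r a b = wprod r b a"
  by (simp add: wprod_def conv_commute[of "unw r a"])

lemma conv_unw_cong:
  assumes "AE \<xi> in lborel. unw r a \<xi> = f \<xi>" "f \<in> borel_measurable borel"
  shows "conv (unw r a) (unw r b) \<xi> = conv f (unw r b) \<xi>"
  using assms by (intro conv_cong_AE unw_measurable) auto

lemma wprod_add_left:
  assumes r: "1 \<le> r" shows "wprod r (a + a') b = wprod r a b + wprod r a' b"
proof -
  have r0: "0 \<le> r" using r by simp
  have "AE \<xi> in lborel. unw r (a + a') \<xi> = unw r a \<xi> + unw r a' \<xi>"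
    using rep_l2_add[of a a'] by eventually_elim (simp add: unw_def distrib_left)
  then have "conv (unw r (a + a')) (unw r b) \<xi> = conv (\<lambda>y. unw r a y + unw r a' y) (unw r b) \<xi>" for \<xi>
    by (rule conv_unw_cong) measurable
  then have "conv (unw r (a + a')) (unw r b) \<xi> = conv (unw r a) (unw r b) \<xi> + conv (unw r a') (unw r b) \<xi>" for \<xi>
    by (simp only: conv_add_left sq_integrable_unw[OF r0])
  then show ?thesis
    unfolding wprod_def to_l2_add[OF sq_integrable_wprod[OF r] sq_integrable_wprod[OF r], symmetric]
    by (simp only: distrib_left)
qed

lemma wprod_scaleR_left:
  assumes r: "1 \<le> r" shows "wprod r (c *\<^sub>R a) b = c *\<^sub>R wprod r a b"
proof -
  have "AE \<xi> in lborel. unw r (c *\<^sub>R a) \<xi> = of_real c * unw r a \<xi>"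
    using rep_l2_scaleR[of c a] by eventually_elim (simp add: unw_def scaleR_conv_of_real)
  then have "conv (unw r (c *\<^sub>R a)) (unw r b) \<xi> = conv (\<lambda>y. of_real c * unw r a y) (unw r b) \<xi>" for \<xi>
    by (rule conv_unw_cong) measurable
  then have "conv (unw r (c *\<^sub>R a)) (unw r b) \<xi> = of_real c * conv (unw r a) (unw r b) \<xi>" for \<xi>
    by (simp only: conv_cmult_left)
  then show ?thesis
    unfolding wprod_def to_l2_scaleR[OF sq_integrable_wprod[OF r], symmetric]
    by (simp only: scaleR_conv_of_real mult.left_commute)
qed

lemma bounded_bilinear_wprod:
  assumes r: "1 \<le> r" shows "bounded_bilinear (wprod r)"
proof (unfold_locales)
  fix a a' b b' :: l2 and c :: real
  show "wprod r (a + a') b = wprod r a b + wprod r a' b" by (rule wprod_add_left[OF r])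
  show "wprod r a (b + b') = wprod r a b + wprod r a b'"
    by (simp only: wprod_commute[of r a] wprod_add_left[OF r])
  show "wprod r (c *\<^sub>R a) b = c *\<^sub>R wprod r a b" by (rule wprod_scaleR_left[OF r])
  show "wprod r a (c *\<^sub>R b) = c *\<^sub>R wprod r a b"
    by (simp only: wprod_commute[of r a] wprod_scaleR_left[OF r])
  show "\<exists>K. \<forall>a b. norm (wprod r a b) \<le> norm a * norm b * K"
  proof (intro exI allI)
    fix a b
    have "norm (wprod r a b) \<le> 2 powr r * (unw_L1 r a * norm b + norm a * unw_L1 r b)"
      by (rule norm_wprod_le[OF r])
    also have "\<dots> \<le> 2 powr r * (jK * norm a * norm b + norm a * (jK * norm b))"
      by (intro mult_left_mono add_mono mult_right_mono unw_L1_le_norm r) simp_all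
    also have "\<dots> = norm a * norm b * (2 powr r * (2 * jK))"
      by (simp add: algebra_simps)
    finally show "norm (wprod r a b) \<le> norm a * norm b * (2 powr r * (2 * jK))" .
  qed
qed

subsection \<open>Hermitian symmetry\<close>

text \<open>
  Complex conjugation of functions as it appears on their transforms (\<open>fourier_l2_cnj\<close>): the fixed points are the
  transforms of the real-valued functions.
\<close>

definition l2_star :: "l2 \<Rightarrow> l2" where
  "l2_star f = l2_reflect (l2_cnj f)"

lemma bounded_linear_l2_star: "bounded_linear l2_star"
  unfolding l2_star_def[abs_def]
  by (rule bounded_linear_compose[OF bounded_linear_l2_reflect bounded_linear_l2_cnj])

lemma norm_l2_star [simp]: "norm (l2_star f) = norm f"
  by (simp add: l2_star_def)

lemma fourier_l2_cnj: "fourier (l2_cnj f) = l2_star (fourier f)"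
  by (simp add: l2_star_def fourier_cnj)

lemma l2_star_to_l2: "sq_integrable f \<Longrightarrow> l2_star (to_l2 f) = to_l2 (\<lambda>x. cnj (f (- x)))"
  unfolding l2_star_def by (simp add: l2_cnj_to_l2 l2_reflect_to_l2 sq_integrable_cnj)

lemma rep_l2_star: "AE x in lborel. rep_l2 (l2_star f) x = cnj (rep_l2 f (- x))"
  using rep_l2_to_l2[OF sq_integrable_cnj[OF sq_integrable_uminus_arg[OF sq_integrable_rep_l2[of f]]]]
    l2_star_to_l2[OF sq_integrable_rep_l2[of f]] by simp

lemma l2_real_valued_iff: "l2_real_valued f \<longleftrightarrow> l2_cnj f = f"
proof -
  have "l2_cnj f = f \<longleftrightarrow> to_l2 (\<lambda>x. cnj (rep_l2 f x)) = to_l2 (rep_l2 f)"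
    by (simp add: l2_cnj_def)
  also have "\<dots> \<longleftrightarrow> (AE x in lborel. cnj (rep_l2 f x) = rep_l2 f x)"
    by (rule to_l2_eq_iff[OF sq_integrable_cnj[OF sq_integrable_rep_l2] sq_integrable_rep_l2])
  also have "\<dots> \<longleftrightarrow> l2_real_valued f"
    by (simp add: l2_real_valued_def Reals_cnj_iff)
  finally show ?thesis by simp
qed

lemma l2_real_valued_iff_star: "l2_real_valued f \<longleftrightarrow> l2_star (fourier f) = fourier f"
proof -
  have "l2_cnj f = f \<longleftrightarrow> fourier (l2_cnj f) = fourier f"
    using fourier_inject by metis
  then show ?thesis by (simp only: l2_real_valued_iff fourier_l2_cnj)
qed

lemma l2_star_mult:
  assumes "bdd_symbol m"
  shows "l2_star (l2_mult m f) = l2_mult (\<lambda>\<xi>. cnj (m (- \<xi>))) (l2_star f)"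
proof -
  have [measurable]: "m \<in> borel_measurable borel" using assms by simp
  have "l2_star (l2_mult m f) = to_l2 (\<lambda>\<xi>. cnj (m (- \<xi>) * rep_l2 f (- \<xi>)))"
    unfolding l2_mult_def[of m] by (rule l2_star_to_l2[OF sq_integrable_mult_rep[OF assms]])
  also have "\<dots> = l2_mult (\<lambda>\<xi>. cnj (m (- \<xi>))) (l2_star f)"
    unfolding l2_mult_def
  proof (rule to_l2_cong_AE)
    show "AE \<xi> in lborel. cnj (m (- \<xi>) * rep_l2 f (- \<xi>)) = cnj (m (- \<xi>)) * rep_l2 (l2_star f) \<xi>"
      using rep_l2_star[of f] by eventually_elim simp
  qed measurable
  finally show ?thesis .
qed

lemma conv_star: "conv (\<lambda>y. cnj (f (- y))) (\<lambda>y. cnj (g (- y))) \<xi> = cnj (conv f g (- \<xi>))"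
proof -
  have "conv (\<lambda>y. cnj (f (- y))) (\<lambda>y. cnj (g (- y))) \<xi> = (LINT y|lborel. cnj (f (0 - y) * g (- \<xi> - (0 - y))))"
    unfolding conv_def by (intro Bochner_Integration.integral_cong refl) simp
  also have "\<dots> = (LINT y|lborel. cnj (f y * g (- \<xi> - y)))"
    by (rule integral_lborel_reflect[of "\<lambda>y. cnj (f y * g (- \<xi> - y))" 0])
  also have "\<dots> = cnj (conv f g (- \<xi>))"
    unfolding conv_def by (rule Bochner_Integration.integral_cnj)
  finally show ?thesis .
qed

lemma unw_star: "AE \<xi> in lborel. unw r (l2_star a) \<xi> = cnj (unw r a (- \<xi>))"
  using rep_l2_star[of a] by eventually_elim (simp add: unw_def)

lemma l2_star_wprod:
  assumes r: "1 \<le> r" shows "l2_star (wprod r a b) = wprod r (l2_star a) (l2_star b)"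
proof -
  have "conv (unw r (l2_star a)) (unw r (l2_star b)) \<xi> = conv (\<lambda>y. cnj (unw r a (- y))) (\<lambda>y. cnj (unw r b (- y))) \<xi>" for \<xi>
    by (intro conv_cong_AE unw_star) measurable
  then have "conv (unw r (l2_star a)) (unw r (l2_star b)) \<xi> = cnj (conv (unw r a) (unw r b) (- \<xi>))" for \<xi>
    by (simp only: conv_star)
  then show ?thesis
    unfolding wprod_def l2_star_to_l2[OF sq_integrable_wprod[OF r]] by simp
qed

section \<open>Evolution equations in Banach spaces\<close>

text \<open>
  The function \<open>e\<^bsup>-Lt\<^esup> (A + L \<integral> f)\<close> is nonincreasing.
\<close>

lemma gronwall:
  fixes f :: "real \<Rightarrow> real"
  assumes f: "continuous_on {0..T} f" and L: "0 \<le> L"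
    and le: "\<And>t. t \<in> {0..T} \<Longrightarrow> f t \<le> A + L * integral {0..t} f" and t: "t \<in> {0..T}"
  shows "f t \<le> A * exp (L * t)"
proof -
  define F where "F x = integral {0..x} f" for x
  define G where "G x = exp (- (L * x)) * (A + L * F x)" for x
  have F': "(F has_real_derivative f x) (at x within {0..T})" if "x \<in> {0..T}" for x
    unfolding F_def by (rule integral_has_real_derivative[OF f that])
  have G': "(G has_real_derivative exp (- (L * x)) * (L * (f x - (A + L * F x)))) (at x within {0..T})"
    if "x \<in> {0..T}" for x
    unfolding G_def by (auto intro!: derivative_eq_intros F'[OF that] simp: algebra_simps)
  have cG: "continuous_on {0..T} G" by (rule DERIV_continuous_on[OF G'])
  have "G t \<le> G 0"
  proof (rule DERIV_nonpos_imp_decreasing_open[where f=G and a=0 and b=t])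
    show "0 \<le> t" using t by simp
    show "continuous_on {0..t} G"
      by (rule continuous_on_subset[OF cG]) (use t in auto)
    fix x assume x: "0 < x" "x < t"
    then have xT: "x \<in> {0..T}" "0 < x" "x < T" using t by auto
    have "(G has_real_derivative exp (- (L * x)) * (L * (f x - (A + L * F x)))) (at x)"
      using G'[OF xT(1)] at_within_Icc_at[OF xT(2,3)] by simp
    moreover have "exp (- (L * x)) * (L * (f x - (A + L * F x))) \<le> 0"
      using le[OF xT(1)] L by (intro mult_nonneg_nonpos mult_nonneg_nonpos) (simp_all add: F_def)
    ultimately show "\<exists>y. (G has_real_derivative y) (at x) \<and> y \<le> 0" by blast
  qed
  also have "G 0 = A" by (simp add: G_def F_def)
  finally have "exp (L * t) * G t \<le> exp (L * t) * A" by (rule mult_left_mono) simp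
  moreover have "exp (L * t) * G t = A + L * F t"
    by (simp add: G_def exp_minus)
  ultimately have "A + L * F t \<le> exp (L * t) * A" by linarith
  then have "A + L * F t \<le> A * exp (L * t)" by (simp only: mult.commute)
  then show ?thesis using le[OF t] by (simp add: F_def)
qed

lemma norm_integral_le:
  fixes f :: "real \<Rightarrow> 'a::banach"
  assumes "continuous_on {a..b} f" "continuous_on {a..b} g" "\<And>r. r \<in> {a..b} \<Longrightarrow> norm (f r) \<le> g r"
  shows "norm (integral {a..b} f) \<le> integral {a..b} g"
  by (rule integral_norm_bound_integral)
     (use assms integrable_continuous_interval in auto)

lemma integral_exp_le:
  fixes K t :: real
  assumes "0 < K" "0 \<le> t"
  shows "exp (- (K * t)) * integral {0..t} (\<lambda>r. exp (K * r)) \<le> 1 / K"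
proof -
  have "((\<lambda>r. exp (K * r)) has_integral (exp (K * t) / K - exp (K * 0) / K)) {0..t}"
    using assms
    by (intro fundamental_theorem_of_calculus[where f="\<lambda>r. exp (K * r) / K"])
       (auto simp: has_real_derivative_iff_has_vector_derivative[symmetric] intro!: derivative_eq_intros)
  then have "integral {0..t} (\<lambda>r. exp (K * r)) = exp (K * t) / K - 1 / K"
    by (simp add: integral_unique)
  then have "exp (- (K * t)) * integral {0..t} (\<lambda>r. exp (K * r)) = (exp (- (K * t)) * exp (K * t) - exp (- (K * t))) / K"
    by (simp only: right_diff_distrib times_divide_eq_right mult_1_right diff_divide_distrib)
  also have "exp (- (K * t)) * exp (K * t) = 1" by (simp flip: exp_add)
  finally have "exp (- (K * t)) * integral {0..t} (\<lambda>r. exp (K * r)) = (1 - exp (- (K * t))) / K" .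
  also have "\<dots> \<le> 1 / K" using assms by (intro divide_right_mono) auto
  finally show ?thesis .
qed

text \<open>
  The unknown is \<open>e\<^bsup>-Kt\<^esup> z(t)\<close>. In its supremum norm the integral operator has Lipschitz constant
  \<open>L/K\<close>, whatever \<open>T\<close> is, so one application of the contraction principle covers the whole interval.
\<close>

lemma picard_global:
  fixes G :: "real \<Rightarrow> 'a::banach \<Rightarrow> 'a"
  assumes T: "0 \<le> T" and L: "0 \<le> L"
    and cont: "\<And>z. continuous_on {0..T} z \<Longrightarrow> continuous_on {0..T} (\<lambda>r. G r (z r))"
    and lip: "\<And>r x y. r \<in> {0..T} \<Longrightarrow> norm (G r x - G r y) \<le> L * norm (x - y)"
  shows "\<exists>z. continuous_on {0..T} z \<and> (\<forall>t\<in>{0..T}. z t = z0 + integral {0..t} (\<lambda>r. G r (z r)))"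
proof -
  \<comment> \<open>any \<open>K\<close> above \<open>L\<close> makes \<open>L/K < 1\<close>; this one is positive also for \<open>L = 0\<close>\<close>
  define K where "K = 2 * L + 1"
  have K: "0 < K" "L / K \<le> 1 / 2" using L by (auto simp: K_def field_simps)
  \<comment> \<open>bounded continuous functions live on the whole line; clamping the time extends paths constantly\<close>
  define cl where "cl t = max 0 (min T t)" for t
  have cl: "cl t \<in> {0..T}" for t using T by (auto simp: cl_def)
  have cl_id: "cl t = t" if "t \<in> {0..T}" for t using that by (auto simp: cl_def)
  have cl_cont: "continuous_on UNIV cl" unfolding cl_def by (intro continuous_intros)
  define N where "N w r = G r (exp (K * r) *\<^sub>R apply_bcontfun w r)" for w r
  have N: "continuous_on {0..T} (N w)" for w
    unfolding N_def by (intro cont continuous_intros continuous_on_apply_bcontfun)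
  define H where "H w t = exp (- (K * t)) *\<^sub>R (z0 + integral {0..t} (N w))" for w t
  have H: "continuous_on {0..T} (H w)" for w
    unfolding H_def
    by (intro continuous_intros indefinite_integral_continuous_1 integrable_continuous_interval N)
  have Hcl: "(\<lambda>t. H w (cl t)) \<in> bcontfun" for w
  proof -
    have "continuous_on UNIV (\<lambda>t. H w (cl t))"
      by (rule continuous_on_compose2[OF H cl_cont]) (use cl in auto)
    moreover have "bounded (range (\<lambda>t. H w (cl t)))"
      by (rule bounded_subset[OF compact_imp_bounded[OF compact_continuous_image[OF H compact_Icc]]])
         (use cl in auto)
    ultimately show ?thesis by (simp add: bcontfun_def)
  qed
  define \<Phi> where "\<Phi> w = Bcontfun (\<lambda>t. H w (cl t))" for w
  have \<Phi>: "apply_bcontfun (\<Phi> w) t = H w (cl t)" for w t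
    unfolding \<Phi>_def by (simp add: Bcontfun_inverse[OF Hcl])
  have "\<exists>!w. \<Phi> w = w"
  proof (rule banach_fix_type)
    show "0 \<le> (1/2::real)" "(1/2::real) < 1" by simp_all
    show "\<forall>w v. dist (\<Phi> w) (\<Phi> v) \<le> 1/2 * dist w v"
    proof (intro allI dist_bound)
      fix w v t
      define s where "s = cl t"
      have s: "s \<in> {0..T}" "0 \<le> s" using cl[of t] by (auto simp: s_def)
      have sub: "{0..s} \<subseteq> {0..T}" using s by auto
      have Nw: "continuous_on {0..s} (N w)" "continuous_on {0..s} (N v)"
        using N continuous_on_subset[OF _ sub] by blast+
      have "dist (apply_bcontfun (\<Phi> w) t) (apply_bcontfun (\<Phi> v) t) = norm (H w s - H v s)"
        by (simp add: \<Phi> dist_norm s_def)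
      also have "H w s - H v s = exp (- (K * s)) *\<^sub>R (integral {0..s} (N w) - integral {0..s} (N v))"
        by (simp add: H_def algebra_simps)
      also have "integral {0..s} (N w) - integral {0..s} (N v) = integral {0..s} (\<lambda>r. N w r - N v r)"
        by (rule Henstock_Kurzweil_Integration.integral_diff[symmetric]) (intro integrable_continuous_interval Nw)+
      also have "norm (exp (- (K * s)) *\<^sub>R integral {0..s} (\<lambda>r. N w r - N v r))
          = exp (- (K * s)) * norm (integral {0..s} (\<lambda>r. N w r - N v r))"
        by simp
      also have "norm (integral {0..s} (\<lambda>r. N w r - N v r)) \<le> integral {0..s} (\<lambda>r. L * dist w v * exp (K * r))"
      proof (rule norm_integral_le)
        show "continuous_on {0..s} (\<lambda>r. N w r - N v r)" by (intro continuous_on_diff Nw)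
        show "continuous_on {0..s} (\<lambda>r. L * dist w v * exp (K * r))" by (intro continuous_intros)
        fix r assume r: "r \<in> {0..s}"
        have "norm (N w r - N v r) \<le> L * norm (exp (K * r) *\<^sub>R apply_bcontfun w r - exp (K * r) *\<^sub>R apply_bcontfun v r)"
          unfolding N_def using r sub by (intro lip) auto
        also have "\<dots> = L * (exp (K * r) * dist (apply_bcontfun w r) (apply_bcontfun v r))"
          by (simp add: dist_norm flip: scaleR_diff_right)
        also have "\<dots> \<le> L * (exp (K * r) * dist w v)"
          by (intro mult_left_mono dist_bounded L) simp
        finally show "norm (N w r - N v r) \<le> L * dist w v * exp (K * r)" by (simp add: mult_ac)
      qed
      also have "integral {0..s} (\<lambda>r. L * dist w v * exp (K * r)) = L * dist w v * integral {0..s} (\<lambda>r. exp (K * r))"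
        by simp
      also have "exp (- (K * s)) * (L * dist w v * integral {0..s} (\<lambda>r. exp (K * r)))
          = L * dist w v * (exp (- (K * s)) * integral {0..s} (\<lambda>r. exp (K * r)))"
        by (simp only: mult_ac)
      also have "\<dots> \<le> L * dist w v * (1 / K)"
        by (intro mult_left_mono integral_exp_le K s mult_nonneg_nonneg L) simp
      also have "\<dots> = L / K * dist w v" by simp
      also have "\<dots> \<le> 1/2 * dist w v" by (intro mult_right_mono K) simp
      finally show "dist (apply_bcontfun (\<Phi> w) t) (apply_bcontfun (\<Phi> v) t) \<le> 1/2 * dist w v"
        by simp
    qed
  qed
  then obtain w where w: "\<Phi> w = w" by blast
  define z where "z t = exp (K * t) *\<^sub>R apply_bcontfun w t" for t
  have "continuous_on {0..T} z"
    unfolding z_def by (intro continuous_intros continuous_on_apply_bcontfun)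
  moreover have "z t = z0 + integral {0..t} (\<lambda>r. G r (z r))" if t: "t \<in> {0..T}" for t
  proof -
    have "apply_bcontfun w t = H w t" using \<Phi>[of w t] w cl_id[OF t] by simp
    then have "z t = z0 + integral {0..t} (N w)"
      by (simp add: z_def H_def exp_minus)
    then show ?thesis by (simp add: N_def[abs_def] z_def)
  qed
  ultimately show ?thesis by blast
qed

subsection \<open>Locally Lipschitz maps\<close>

definition loc_lip :: "('a::real_normed_vector \<Rightarrow> 'b::real_normed_vector) \<Rightarrow> bool" where
  "loc_lip f \<longleftrightarrow> (\<forall>R. \<exists>L\<ge>0. \<forall>x y. norm x \<le> R \<longrightarrow> norm y \<le> R \<longrightarrow> norm (f x - f y) \<le> L * norm (x - y))"

lemma loc_lipD:
  assumes "loc_lip f"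
  obtains L where "0 \<le> L" "\<And>x y. norm x \<le> R \<Longrightarrow> norm y \<le> R \<Longrightarrow> norm (f x - f y) \<le> L * norm (x - y)"
  using assms unfolding loc_lip_def by meson

lemma loc_lip_bounded:
  fixes f :: "'a::real_normed_vector \<Rightarrow> 'b::real_normed_vector"
  assumes "loc_lip f"
  obtains C where "0 \<le> C" "\<And>x. norm x \<le> R \<Longrightarrow> norm (f x) \<le> C"
proof -
  obtain L where L: "0 \<le> L" "\<And>x y. norm x \<le> \<bar>R\<bar> \<Longrightarrow> norm y \<le> \<bar>R\<bar> \<Longrightarrow> norm (f x - f y) \<le> L * norm (x - y)"
    using loc_lipD[OF assms, where R="\<bar>R\<bar>"] by blast
  show thesis
  proof (rule that[of "norm (f 0) + L * \<bar>R\<bar>"])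
    show "0 \<le> norm (f 0) + L * \<bar>R\<bar>" using L(1) by simp
    fix x :: 'a assume x: "norm x \<le> R"
    have "norm (f x) \<le> norm (f 0) + norm (f x - f 0)" using norm_triangle_sub by blast
    also have "norm (f x - f 0) \<le> L * norm x" using L(2)[of x 0] x by simp
    also have "L * norm x \<le> L * \<bar>R\<bar>" using x L(1) by (intro mult_left_mono) auto
    finally show "norm (f x) \<le> norm (f 0) + L * \<bar>R\<bar>" by simp
  qed
qed

lemma loc_lip_linear_comp:
  assumes "bounded_linear S" "loc_lip f" shows "loc_lip (\<lambda>x. S (f x))"
  unfolding loc_lip_def
proof
  fix R
  obtain L where L: "0 \<le> L" "\<And>x y. norm x \<le> R \<Longrightarrow> norm y \<le> R \<Longrightarrow> norm (f x - f y) \<le> L * norm (x - y)"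
    using loc_lipD[OF assms(2)] by blast
  obtain K where K: "0 < K" "\<And>x. norm (S x) \<le> norm x * K"
    using bounded_linear.pos_bounded[OF assms(1)] by blast
  have "norm (S (f x) - S (f y)) \<le> (L * K) * norm (x - y)" if "norm x \<le> R" "norm y \<le> R" for x y
  proof -
    have "norm (S (f x) - S (f y)) = norm (S (f x - f y))"
      by (simp only: linear_diff[OF bounded_linear.linear[OF assms(1)]])
    also have "\<dots> \<le> norm (f x - f y) * K" by (rule K(2))
    also have "\<dots> \<le> L * norm (x - y) * K" using L(2)[OF that] K(1) by (intro mult_right_mono) auto
    finally show ?thesis by (simp add: mult_ac)
  qed
  then show "\<exists>L\<ge>0. \<forall>x y. norm x \<le> R \<longrightarrow> norm y \<le> R \<longrightarrow> norm (S (f x) - S (f y)) \<le> L * norm (x - y)"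
    using L(1) K(1) by (intro exI[of _ "L * K"]) auto
qed

lemma loc_lip_id: "loc_lip (\<lambda>x. x)"
  unfolding loc_lip_def by (intro allI exI[of _ 1]) auto

lemma loc_lip_bilinear_comp:
  assumes "bounded_bilinear P" "loc_lip f" "loc_lip g" shows "loc_lip (\<lambda>x. P (f x) (g x))"
  unfolding loc_lip_def
proof
  fix R
  obtain L where L: "0 \<le> L" "\<And>x y. norm x \<le> R \<Longrightarrow> norm y \<le> R \<Longrightarrow> norm (f x - f y) \<le> L * norm (x - y)"
    using loc_lipD[OF assms(2)] by blast
  obtain L' where L': "0 \<le> L'" "\<And>x y. norm x \<le> R \<Longrightarrow> norm y \<le> R \<Longrightarrow> norm (g x - g y) \<le> L' * norm (x - y)"
    using loc_lipD[OF assms(3)] by blast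
  obtain C where C: "0 \<le> C" "\<And>x. norm x \<le> R \<Longrightarrow> norm (f x) \<le> C"
    using loc_lip_bounded[OF assms(2)] by blast
  obtain C' where C': "0 \<le> C'" "\<And>x. norm x \<le> R \<Longrightarrow> norm (g x) \<le> C'"
    using loc_lip_bounded[OF assms(3)] by blast
  obtain K where K: "0 < K" "\<And>a b. norm (P a b) \<le> norm a * norm b * K"
    using bounded_bilinear.pos_bounded[OF assms(1)] by blast
  have "norm (P (f x) (g x) - P (f y) (g y)) \<le> ((L * C' + C * L') * K) * norm (x - y)"
    if xy: "norm x \<le> R" "norm y \<le> R" for x y
  proof -
    have "P (f x) (g x) - P (f y) (g y) = P (f x - f y) (g x) + P (f y) (g x - g y)"
      by (simp add: bounded_bilinear.diff_left[OF assms(1)] bounded_bilinear.diff_right[OF assms(1)])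
    also have "norm \<dots> \<le> norm (P (f x - f y) (g x)) + norm (P (f y) (g x - g y))"
      by (rule norm_triangle_ineq)
    also have "\<dots> \<le> norm (f x - f y) * norm (g x) * K + norm (f y) * norm (g x - g y) * K"
      by (intro add_mono K(2))
    also have "\<dots> \<le> (L * norm (x - y)) * C' * K + C * (L' * norm (x - y)) * K"
      using xy K(1) C(1) L(1)
      by (intro add_mono mult_right_mono mult_mono L(2) L'(2) C(2) C'(2)) auto
    also have "\<dots> = ((L * C' + C * L') * K) * norm (x - y)" by (simp add: algebra_simps)
    finally show ?thesis .
  qed
  then show "\<exists>L\<ge>0. \<forall>x y. norm x \<le> R \<longrightarrow> norm y \<le> R \<longrightarrow>
      norm (P (f x) (g x) - P (f y) (g y)) \<le> L * norm (x - y)"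
    using L(1) K(1) L'(1) C(1) C'(1) by (intro exI[of _ "(L * C' + C * L') * K"]) auto
qed

lemma loc_lip_diff:
  assumes "loc_lip f" "loc_lip g" shows "loc_lip (\<lambda>x. f x - g x)"
  unfolding loc_lip_def
proof
  fix R
  obtain L where L: "0 \<le> L" "\<And>x y. norm x \<le> R \<Longrightarrow> norm y \<le> R \<Longrightarrow> norm (f x - f y) \<le> L * norm (x - y)"
    using loc_lipD[OF assms(1)] by blast
  obtain L' where L': "0 \<le> L'" "\<And>x y. norm x \<le> R \<Longrightarrow> norm y \<le> R \<Longrightarrow> norm (g x - g y) \<le> L' * norm (x - y)"
    using loc_lipD[OF assms(2)] by blast
  have "norm ((f x - g x) - (f y - g y)) \<le> (L + L') * norm (x - y)" if xy: "norm x \<le> R" "norm y \<le> R" for x y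
  proof -
    have "(f x - g x) - (f y - g y) = (f x - f y) - (g x - g y)" by simp
    also have "norm \<dots> \<le> norm (f x - f y) + norm (g x - g y)" by (rule norm_triangle_ineq4)
    also have "\<dots> \<le> L * norm (x - y) + L' * norm (x - y)" by (intro add_mono L(2) L'(2) xy)
    finally show ?thesis by (simp add: distrib_right)
  qed
  then show "\<exists>L\<ge>0. \<forall>x y. norm x \<le> R \<longrightarrow> norm y \<le> R \<longrightarrow>
      norm ((f x - g x) - (f y - g y)) \<le> L * norm (x - y)"
    using L(1) L'(1) by (intro exI[of _ "L + L'"]) auto
qed

lemma continuous_on_loc_lip:
  fixes f :: "'a::real_normed_vector \<Rightarrow> 'b::real_normed_vector"
  assumes "loc_lip f" shows "continuous_on S f"
proof (rule continuous_at_imp_continuous_on, rule ballI)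
  fix x :: 'a
  obtain L where L: "0 \<le> L" "\<And>u v. norm u \<le> norm x + 1 \<Longrightarrow> norm v \<le> norm x + 1 \<Longrightarrow> norm (f u - f v) \<le> L * norm (u - v)"
    using loc_lipD[OF assms] by blast
  have "((\<lambda>y. L * norm (y - x)) \<longlongrightarrow> L * norm (x - x)) (at x)" by (intro tendsto_intros)
  then have z: "((\<lambda>y. L * norm (y - x)) \<longlongrightarrow> 0) (at x)" by simp
  have "\<forall>\<^sub>F y in at x. dist y x < 1" by (rule eventually_at_ball'[of 1 x UNIV, THEN eventually_mono]) (auto simp: dist_commute)
  then have "\<forall>\<^sub>F y in at x. norm (f y - f x) \<le> L * norm (y - x)"
  proof eventually_elim
    case (elim y)
    then have "norm y \<le> norm x + 1" using norm_triangle_sub[of y x] by (simp add: dist_norm)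
    then show ?case by (intro L(2)) auto
  qed
  from Lim_null_comparison[OF this z] have "(f \<longlongrightarrow> f x) (at x)" by (rule LIM_zero_cancel)
  then show "isCont f x" by (simp add: isCont_def)
qed

subsection \<open>Radial truncation\<close>

text \<open>
  The scalar by which the radial projection onto the ball of radius \<open>R\<close> multiplies \<open>x\<close>. It is always
  positive, which is what lets the truncated equation inherit the energy identity.
\<close>

definition radial :: "real \<Rightarrow> 'a::real_normed_vector \<Rightarrow> real" where
  "radial R x = R / max R (norm x)"

lemma radial_bounds:
  assumes "0 < R" shows "0 < radial R x" "radial R x \<le> 1"
proof -
  have "0 < max R (norm x)" using assms by (simp add: less_max_iff_disj)
  then show "0 < radial R x" "radial R x \<le> 1"
    using assms by (simp_all add: radial_def divide_le_eq_1)
qed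

lemma radial_eq_1: "0 < R \<Longrightarrow> norm x \<le> R \<Longrightarrow> radial R x = 1"
  by (simp add: radial_def max_def)

lemma norm_radial_le:
  assumes "0 < R" shows "norm (radial R x *\<^sub>R x) \<le> R"
proof -
  have m: "0 < max R (norm x)" using assms by (simp add: less_max_iff_disj)
  have "norm (radial R x *\<^sub>R x) = R * (norm x / max R (norm x))"
    using m assms by (simp add: radial_def)
  also have "\<dots> \<le> R * 1" using m assms by (intro mult_left_mono) (simp_all add: divide_le_eq_1)
  finally show ?thesis by simp
qed

lemma radial_lipschitz:
  assumes R: "0 < R" shows "norm (radial R x *\<^sub>R x - radial R y *\<^sub>R y) \<le> 2 * norm (x - y)"
proof -
  let ?m = "\<lambda>x. max R (norm x)"
  have m: "0 < ?m x" "R \<le> ?m x" "norm x \<le> ?m x" for x :: 'a using R by (auto simp: max_def)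
  have e: "radial R x *\<^sub>R x - radial R y *\<^sub>R y = radial R x *\<^sub>R (x - y) + (radial R x - radial R y) *\<^sub>R y"
    by (simp add: algebra_simps)
  have "\<bar>?m y - ?m x\<bar> \<le> norm (x - y)"
    using norm_triangle_ineq2[of x y] norm_triangle_ineq2[of y x] norm_minus_commute[of x y]
    by (auto simp: max_def)
  moreover have "radial R x - radial R y = R * (?m y - ?m x) / (?m x * ?m y)"
    using m(1)[of x] m(1)[of y] by (simp add: radial_def field_simps)
  then have "\<bar>radial R x - radial R y\<bar> * norm y = (R / ?m x) * (norm y / ?m y) * \<bar>?m y - ?m x\<bar>"
    using m(1)[of x] m(1)[of y] R by (simp add: abs_mult)
  moreover have "(R / ?m x) * (norm y / ?m y) * \<bar>?m y - ?m x\<bar> \<le> 1 * 1 * \<bar>?m y - ?m x\<bar>"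
    using m[of x] m[of y] R by (intro mult_right_mono mult_mono) (auto simp: divide_le_eq_1)
  ultimately have 2: "norm ((radial R x - radial R y) *\<^sub>R y) \<le> norm (x - y)" by simp
  have "norm (radial R x *\<^sub>R (x - y)) \<le> 1 * norm (x - y)"
    unfolding norm_scaleR using radial_bounds[OF R, of x] by (intro mult_right_mono) auto
  then show ?thesis unfolding e using 2 norm_triangle_ineq[of "radial R x *\<^sub>R (x - y)" "(radial R x - radial R y) *\<^sub>R y"]
    by linarith
qed

section \<open>Semilinear equations with a conserved energy\<close>

text \<open>
  The abstract shape of the problem: a unitary group \<open>U\<close>, a locally Lipschitz nonlinearity \<open>M\<close>, a
  conjugation \<open>star\<close> whose fixed points are the admissible states, and a quadratic energy \<open>B x \<bullet> x\<close> that \<open>U\<close>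
  preserves, to which \<open>M\<close> is tangential, and that controls a weaker quantity \<open>q\<close>. The assumption
  \<open>M_tame\<close> says that \<open>M\<close> grows linearly where \<open>q\<close> is bounded; so control of \<open>q\<close> is enough to exclude
  blow-up.
\<close>

locale conservative_flow =
  fixes U :: "real \<Rightarrow> 'a::{banach, real_inner} \<Rightarrow> 'a"
    and M :: "'a \<Rightarrow> 'a" and star :: "'a \<Rightarrow> 'a" and B :: "'a \<Rightarrow> 'a"
    and q :: "'a \<Rightarrow> real" and \<kappa> :: real
  assumes U_linear: "\<And>t. bounded_linear (U t)"
    and U_norm: "\<And>t x. norm (U t x) = norm x"
    and U_0: "\<And>x. U 0 x = x"
    and U_add: "\<And>s t x. U s (U t x) = U (s + t) x"
    and U_adjoint: "\<And>t x y. U t x \<bullet> y = x \<bullet> U (- t) y"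
    and U_cont: "\<And>x. continuous_on UNIV (\<lambda>t. U t x)"
    and M_lip: "loc_lip M"
    and M_tame: "\<And>\<rho>. \<exists>K\<ge>0. \<forall>x. q x \<le> \<rho> \<longrightarrow> norm (M x) \<le> K * norm x"
    and q_scaleR: "\<And>c x. 0 \<le> c \<Longrightarrow> c \<le> 1 \<Longrightarrow> q (c *\<^sub>R x) \<le> q x"
    and star_linear: "bounded_linear star"
    and star_norm: "\<And>x. norm (star x) = norm x"
    and star_U: "\<And>t x. star (U t x) = U t (star x)"
    and star_M: "\<And>x. star (M x) = M (star x)"
    and B_linear: "bounded_linear B"
    and B_symmetric: "\<And>x y. B x \<bullet> y = x \<bullet> B y"
    and B_U: "\<And>t x. B (U t x) = U t (B x)"
    and \<kappa>_pos: "0 < \<kappa>"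
    and B_coercive: "\<And>x. \<kappa> * (q x)\<^sup>2 \<le> B x \<bullet> x"
    and energy: "\<And>x. star x = x \<Longrightarrow> B x \<bullet> M x = 0"
begin

definition mild :: "('a \<Rightarrow> 'a) \<Rightarrow> real \<Rightarrow> 'a \<Rightarrow> (real \<Rightarrow> 'a) \<Rightarrow> bool" where
  "mild F T w0 w \<longleftrightarrow> continuous_on {0..T} w \<and> (\<forall>t\<in>{0..T}. star (w t) = w t) \<and>
     (\<forall>t\<in>{0..T}. w t = U t w0 + integral {0..t} (\<lambda>r. U (t - r) (F (w r))))"

lemma U_diff: "U t (x - y) = U t x - U t y"
  by (rule linear_diff[OF bounded_linear.linear[OF U_linear]])

lemma U_plus: "U t (x + y) = U t x + U t y"
  by (rule linear_add[OF bounded_linear.linear[OF U_linear]])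

lemma U_inverse: "U (- t) (U t x) = x" "U t (U (- t) x) = x"
  by (simp_all add: U_add U_0)

lemma continuous_on_U:
  assumes g: "continuous_on S g" and y: "continuous_on S y"
  shows "continuous_on S (\<lambda>r. U (g r) (y r))"
  unfolding continuous_on_def
proof
  fix t assume t: "t \<in> S"
  have y': "(y \<longlongrightarrow> y t) (at t within S)" and g': "(g \<longlongrightarrow> g t) (at t within S)"
    using y g t by (auto simp: continuous_on_def)
  have "((\<lambda>r. U (g r) (y r - y t)) \<longlongrightarrow> 0) (at t within S)"
  proof (rule tendsto_norm_zero_cancel)
    have "((\<lambda>r. norm (y r - y t)) \<longlongrightarrow> norm (y t - y t)) (at t within S)" by (intro tendsto_intros y')
    then show "((\<lambda>r. norm (U (g r) (y r - y t))) \<longlongrightarrow> 0) (at t within S)" by (simp add: U_norm)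
  qed
  moreover have "((\<lambda>r. U (g r) (y t)) \<longlongrightarrow> U (g t) (y t)) (at t within S)"
    using U_cont[of "y t"] by (intro continuous_on_tendsto_compose[OF _ g']) auto
  ultimately have "((\<lambda>r. U (g r) (y r - y t) + U (g r) (y t)) \<longlongrightarrow> 0 + U (g t) (y t)) (at t within S)"
    by (rule tendsto_add)
  then show "((\<lambda>r. U (g r) (y r)) \<longlongrightarrow> U (g t) (y t)) (at t within S)"
    by (simp add: U_plus[symmetric])
qed

lemma integral_bounded_linear_comp:
  fixes f :: "real \<Rightarrow> 'a"
  assumes "bounded_linear S" "continuous_on {0..t} f"
  shows "integral {0..t} (\<lambda>r. S (f r)) = S (integral {0..t} f)"
  using integral_linear[OF integrable_continuous_interval[OF assms(2)] assms(1)] by (simp add: o_def)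

text \<open>
  Differentiating \<open>w\<close> itself would require states in the domain of the generator of \<open>U\<close>. The function
  \<open>U(-t) w(t)\<close> is the integral of a continuous function.
\<close>

lemma interaction_picture:
  assumes w: "continuous_on {0..T} w" and F: "continuous_on UNIV F" and t: "t \<in> {0..T}"
  shows "w t = U t w0 + integral {0..t} (\<lambda>r. U (t - r) (F (w r))) \<longleftrightarrow>
    U (- t) (w t) = w0 + integral {0..t} (\<lambda>r. U (- r) (F (w r)))"
proof -
  have Fw: "continuous_on {0..t} (\<lambda>r. F (w r))"
    using w t by (intro continuous_on_compose2[OF F] continuous_on_subset[OF w]) auto
  have c: "continuous_on {0..t} (\<lambda>r. U (- r) (F (w r)))"
    by (intro continuous_on_U Fw continuous_intros)
  have "integral {0..t} (\<lambda>r. U (t - r) (F (w r))) = U t (integral {0..t} (\<lambda>r. U (- r) (F (w r))))"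
    using integral_bounded_linear_comp[OF U_linear c, of t] by (simp add: U_add)
  then have e: "U t w0 + integral {0..t} (\<lambda>r. U (t - r) (F (w r)))
      = U t (w0 + integral {0..t} (\<lambda>r. U (- r) (F (w r))))"
    by (simp add: U_plus)
  show ?thesis
    unfolding e using U_inverse by metis
qed

lemma difference_bound:
  assumes cw: "continuous_on {0..T} w"
    and w: "\<And>t. t \<in> {0..T} \<Longrightarrow> w t = U t w0 + integral {0..t} (\<lambda>r. U (t - r) (F (w r)))"
    and cv: "continuous_on {0..T} v"
    and v: "\<And>t. t \<in> {0..T} \<Longrightarrow> v t = U t v0 + integral {0..t} (\<lambda>r. U (t - r) (F (v r)))"
    and F: "continuous_on UNIV F" and L: "0 \<le> L"
    and lip: "\<And>t. t \<in> {0..T} \<Longrightarrow> norm (F (w t) - F (v t)) \<le> L * norm (w t - v t)"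
    and t: "t \<in> {0..T}"
  shows "norm (w t - v t) \<le> norm (w0 - v0) * exp (L * t)"
proof (rule gronwall[OF _ L _ t])
  show "continuous_on {0..T} (\<lambda>t. norm (w t - v t))" by (intro continuous_intros cw cv)
  fix s assume s: "s \<in> {0..T}"
  then have sub: "{0..s} \<subseteq> {0..T}" by auto
  have c: "continuous_on {0..s} (\<lambda>r. U (s - r) (F (u r)))" if "continuous_on {0..T} u" for u
    by (intro continuous_on_U continuous_on_compose2[OF F] continuous_on_subset[OF that sub] continuous_intros) auto
  have "w s - v s = U s (w0 - v0) + (integral {0..s} (\<lambda>r. U (s - r) (F (w r))) - integral {0..s} (\<lambda>r. U (s - r) (F (v r))))"
    using arg_cong2[OF w[OF s] v[OF s], of "(-)"] by (simp add: U_diff)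
  also have "integral {0..s} (\<lambda>r. U (s - r) (F (w r))) - integral {0..s} (\<lambda>r. U (s - r) (F (v r)))
      = integral {0..s} (\<lambda>r. U (s - r) (F (w r)) - U (s - r) (F (v r)))"
    by (rule Henstock_Kurzweil_Integration.integral_diff[symmetric]) (intro integrable_continuous_interval c cw cv)+
  also have "norm (U s (w0 - v0) + \<dots>) \<le> norm (w0 - v0) + norm (integral {0..s} (\<lambda>r. U (s - r) (F (w r)) - U (s - r) (F (v r))))"
    using norm_triangle_ineq[of "U s (w0 - v0)"] by (simp add: U_norm)
  also have "norm (integral {0..s} (\<lambda>r. U (s - r) (F (w r)) - U (s - r) (F (v r)))) \<le> integral {0..s} (\<lambda>r. L * norm (w r - v r))"
  proof (rule norm_integral_le)
    show "continuous_on {0..s} (\<lambda>r. U (s - r) (F (w r)) - U (s - r) (F (v r)))"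
      by (intro continuous_on_diff c cw cv)
    show "continuous_on {0..s} (\<lambda>r. L * norm (w r - v r))"
      by (intro continuous_intros continuous_on_subset[OF cw sub] continuous_on_subset[OF cv sub])
    fix r assume "r \<in> {0..s}"
    then show "norm (U (s - r) (F (w r)) - U (s - r) (F (v r))) \<le> L * norm (w r - v r)"
      using lip[of r] sub by (auto simp: U_norm simp flip: U_diff)
  qed
  finally show "norm (w s - v s) \<le> norm (w0 - v0) + L * integral {0..s} (\<lambda>t. norm (w t - v t))"
    by simp
qed

text \<open>
  Scaling both arguments of the energy identity by \<open>c\<close> and cancelling one factor.
\<close>

lemma energy_rescaled:
  assumes "star x = x" "0 < c" shows "B x \<bullet> M (c *\<^sub>R x) = 0"
proof -
  have "star (c *\<^sub>R x) = c *\<^sub>R x"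
    using linear_cmul[OF bounded_linear.linear[OF star_linear], of c x] assms(1) by simp
  from energy[OF this] have "c * (B x \<bullet> M (c *\<^sub>R x)) = 0"
    by (simp add: linear_cmul[OF bounded_linear.linear[OF B_linear]])
  then show ?thesis using assms(2) by simp
qed

text \<open>
  The energy is the same for \<open>w(t)\<close> and \<open>U(-t) w(t)\<close>, and the latter is differentiable with derivative
  \<open>U(-t) F(w(t))\<close>; by the symmetry of \<open>B\<close> the energy has the derivative \<open>2 (B (w t) \<bullet> F (w t)) = 0\<close>.
\<close>

lemma energy_conserved:
  assumes w: "mild F T w0 w" and F: "continuous_on UNIV F"
    and orth: "\<And>x. star x = x \<Longrightarrow> B x \<bullet> F x = 0" and t: "t \<in> {0..T}"
  shows "B (w t) \<bullet> w t = B w0 \<bullet> w0"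
proof -
  define z where "z s = U (- s) (w s)" for s
  define g where "g s = U (- s) (F (w s))" for s
  have cw: "continuous_on {0..T} w" using w by (simp add: mild_def)
  have g: "continuous_on {0..T} g"
    unfolding g_def by (intro continuous_on_U continuous_on_compose2[OF F] cw continuous_intros) auto
  have z: "z s = w0 + integral {0..s} g" if "s \<in> {0..T}" for s
    using interaction_picture[OF cw F that, of w0] w that by (simp add: mild_def z_def g_def[abs_def])
  have z': "(z has_vector_derivative g s) (at s within {0..T})" if s: "s \<in> {0..T}" for s
  proof -
    have "((\<lambda>s. w0 + integral {0..s} g) has_vector_derivative 0 + g s) (at s within {0..T})"
      by (intro has_vector_derivative_add has_vector_derivative_const integral_has_vector_derivative g s)
    then have "((\<lambda>s. w0 + integral {0..s} g) has_vector_derivative g s) (at s within {0..T})" by simp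
    then show ?thesis
      by (rule has_vector_derivative_transform[OF s, rotated]) (simp add: z)
  qed
  define E where "E s = B (z s) \<bullet> z s" for s
  have E_eq: "E s = B (w s) \<bullet> w s" for s
    by (simp add: E_def z_def B_U U_adjoint U_inverse)
  have E': "(E has_vector_derivative 0) (at s within {0..T})" if s: "s \<in> {0..T}" for s
  proof -
    have Bz: "((\<lambda>s. B (z s)) has_vector_derivative B (g s)) (at s within {0..T})"
      by (rule bounded_linear.has_vector_derivative[OF B_linear z'[OF s]])
    have "(E has_vector_derivative (B (z s) \<bullet> g s + B (g s) \<bullet> z s)) (at s within {0..T})"
      unfolding E_def by (rule bounded_bilinear.has_vector_derivative[OF bounded_bilinear_inner Bz z'[OF s]])
    moreover have "B (g s) \<bullet> z s = B (z s) \<bullet> g s"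
      by (subst B_symmetric) (rule inner_commute)
    moreover have "B (z s) \<bullet> g s = B (w s) \<bullet> F (w s)"
      by (simp add: z_def g_def B_U U_adjoint U_inverse)
    moreover have "B (w s) \<bullet> F (w s) = 0"
      using w s unfolding mild_def by (intro orth) blast
    ultimately show ?thesis by simp
  qed
  have "convex {0..T}" by simp
  then obtain c where c: "\<And>s. s \<in> {0..T} \<Longrightarrow> E s = c"
    using has_vector_derivative_zero_constant[OF _ E'] by metis
  have "0 \<in> {0..T}" using t by auto
  then have "E t = E 0" using c[OF t] c[of 0] by (simp only:)
  also have "E 0 = B w0 \<bullet> w0"
    using z[of 0] \<open>0 \<in> {0..T}\<close> by (simp add: E_def)
  finally show ?thesis by (simp add: E_eq)
qed

text \<open>
  The bound \<open>R\<close> is uniform over all rescalings \<open>F x = M (c x \<cdot> x)\<close> of the nonlinearity. The radius of a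
  truncation can therefore be chosen after \<open>R\<close>, and \<open>c = 1\<close> is the equation itself.
\<close>

definition confines :: "real \<Rightarrow> real \<Rightarrow> real \<Rightarrow> bool" where
  "confines R0 T R \<longleftrightarrow> (\<forall>F c w0 w t. continuous_on UNIV F \<longrightarrow>
     (\<forall>x. 0 < c x \<and> c x \<le> 1 \<and> F x = M (c x *\<^sub>R x)) \<longrightarrow>
     norm w0 \<le> R0 \<longrightarrow> mild F T w0 w \<longrightarrow> t \<in> {0..T} \<longrightarrow> norm (w t) \<le> R)"

lemma confinesD:
  assumes "confines R0 T R" "continuous_on UNIV F"
    and "\<And>x. 0 < c x" "\<And>x. c x \<le> 1" "\<And>x. F x = M (c x *\<^sub>R x)"
    and "norm w0 \<le> R0" "mild F T w0 w" "t \<in> {0..T}"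
  shows "norm (w t) \<le> R"
proof -
  have "\<forall>x. 0 < c x \<and> c x \<le> 1 \<and> F x = M (c x *\<^sub>R x)" by (intro allI conjI assms)
  from assms(1)[unfolded confines_def, rule_format, OF assms(2) this[rule_format] assms(6-8)] show ?thesis .
qed

text \<open>
  Conservation of energy bounds \<open>q\<close> along the solution. Then \<open>M_tame\<close> makes the nonlinearity of linear
  growth, and Gronwall's inequality applies.
\<close>

lemma a_priori_bound: "\<exists>R>0. confines R0 T R"
proof -
  obtain b where b: "0 < b" "\<And>x. norm (B x) \<le> norm x * b"
    using bounded_linear.pos_bounded[OF B_linear] by blast
  \<comment> \<open>the largest \<open>q\<close> that the energy of the data permits\<close>
  define \<rho> where "\<rho> = sqrt (b * R0\<^sup>2 / \<kappa>)"
  obtain K where K: "0 \<le> K" "\<And>x. q x \<le> \<rho> \<Longrightarrow> norm (M x) \<le> K * norm x"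
    using M_tame[of \<rho>] by blast
  \<comment> \<open>the summand \<open>1\<close> keeps \<open>R\<close> positive when \<open>R0 = 0\<close>\<close>
  define R where "R = \<bar>R0\<bar> * exp (K * \<bar>T\<bar>) + 1"
  have R: "0 < R" unfolding R_def by (simp add: add_nonneg_pos)
  have main: "norm (w t) \<le> R"
    if F: "continuous_on UNIV F" and c: "\<And>x. 0 < c x" "\<And>x. c x \<le> 1" "\<And>x. F x = M (c x *\<^sub>R x)"
      and w0: "norm w0 \<le> R0" and w: "mild F T w0 w" and t: "t \<in> {0..T}" for F c w0 w t
  proof -
    have cw: "continuous_on {0..T} w" using w by (simp add: mild_def)
    have orth: "B x \<bullet> F x = 0" if "star x = x" for x
      using c(1)[of x] energy_rescaled[OF that] by (simp add: c(3))
    have q: "q (w s) \<le> \<rho>" if s: "s \<in> {0..T}" for s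
    proof -
      have "\<kappa> * (q (w s))\<^sup>2 \<le> B w0 \<bullet> w0"
        using B_coercive[of "w s"] energy_conserved[OF w F orth s] by simp
      also have "\<dots> \<le> norm (B w0) * norm w0" by (rule norm_cauchy_schwarz)
      also have "\<dots> \<le> (norm w0 * b) * norm w0" by (intro mult_right_mono b(2)) simp
      also have "\<dots> = b * (norm w0)\<^sup>2" by (simp add: power2_eq_square)
      also have "\<dots> \<le> b * R0\<^sup>2" using w0 b(1) by (intro mult_left_mono power_mono) auto
      finally have "(q (w s))\<^sup>2 \<le> b * R0\<^sup>2 / \<kappa>" using \<kappa>_pos by (simp add: field_simps)
      then show ?thesis unfolding \<rho>_def by (rule real_le_rsqrt)
    qed
    have Fle: "norm (F (w s)) \<le> K * norm (w s)" if s: "s \<in> {0..T}" for s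
    proof -
      let ?c = "c (w s)"
      have c': "0 < ?c" "?c \<le> 1" "F (w s) = M (?c *\<^sub>R w s)" by (rule c)+
      have "q (?c *\<^sub>R w s) \<le> \<rho>" using q_scaleR[of ?c "w s"] q[OF s] c' by linarith
      from K(2)[OF this] have "norm (F (w s)) \<le> K * norm (?c *\<^sub>R w s)" using c'(3) by simp
      also have "norm (?c *\<^sub>R w s) \<le> 1 * norm (w s)"
        unfolding norm_scaleR using c' by (intro mult_right_mono) auto
      finally show ?thesis using K(1) by (simp add: mult_left_mono)
    qed
    have "norm (w t) \<le> norm w0 * exp (K * t)"
    proof (rule gronwall[OF _ K(1) _ t])
      show "continuous_on {0..T} (\<lambda>t. norm (w t))" by (intro continuous_intros cw)
      fix s assume s: "s \<in> {0..T}"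
      then have sub: "{0..s} \<subseteq> {0..T}" by auto
      have cs: "continuous_on {0..s} w" by (rule continuous_on_subset[OF cw sub])
      have "norm (w s) \<le> norm (U s w0) + norm (integral {0..s} (\<lambda>r. U (s - r) (F (w r))))"
      proof -
        have e: "w s = U s w0 + integral {0..s} (\<lambda>r. U (s - r) (F (w r)))"
          using w s unfolding mild_def by blast
        show ?thesis
          using arg_cong[OF e, of norm] norm_triangle_ineq[of "U s w0" "integral {0..s} (\<lambda>r. U (s - r) (F (w r)))"]
          by linarith
      qed
      also have "norm (integral {0..s} (\<lambda>r. U (s - r) (F (w r)))) \<le> integral {0..s} (\<lambda>r. K * norm (w r))"
      proof (rule norm_integral_le)
        show "continuous_on {0..s} (\<lambda>r. U (s - r) (F (w r)))"
          by (intro continuous_on_U continuous_on_compose2[OF F] cs continuous_intros) auto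
        show "continuous_on {0..s} (\<lambda>r. K * norm (w r))" by (intro continuous_intros cs)
        fix r assume "r \<in> {0..s}"
        then show "norm (U (s - r) (F (w r))) \<le> K * norm (w r)"
          using Fle[of r] sub by (auto simp: U_norm)
      qed
      finally show "norm (w s) \<le> norm w0 + K * integral {0..s} (\<lambda>t. norm (w t))"
        by (simp add: U_norm)
    qed
    also have "\<dots> \<le> \<bar>R0\<bar> * exp (K * \<bar>T\<bar>)"
      using w0 t K(1) by (intro mult_mono iffD2[OF exp_le_cancel_iff] mult_left_mono) auto
    finally show ?thesis by (simp add: R_def)
  qed
  have "confines R0 T R"
    unfolding confines_def
  proof (intro allI impI)
    fix F :: "'a \<Rightarrow> 'a" and c :: "'a \<Rightarrow> real" and w0 :: 'a and w t
    assume F: "continuous_on UNIV F" and c: "\<forall>x. 0 < c x \<and> c x \<le> 1 \<and> F x = M (c x *\<^sub>R x)"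
      and w: "norm w0 \<le> R0" "mild F T w0 w" "t \<in> {0..T}"
    show "norm (w t) \<le> R"
      by (rule main[of F c, OF F _ _ _ w]) (simp_all add: c[rule_format])
  qed
  with R show ?thesis by blast
qed

text \<open>
  Both solutions stay in one ball, on which \<open>M\<close> is Lipschitz.
\<close>

theorem mild_dependence:
  "\<exists>C\<ge>0. \<forall>w0 v0 w v. norm w0 \<le> R0 \<longrightarrow> norm v0 \<le> R0 \<longrightarrow> mild M T w0 w \<longrightarrow> mild M T v0 v \<longrightarrow>
     (\<forall>t\<in>{0..T}. norm (w t - v t) \<le> C * norm (w0 - v0))"
proof -
  obtain R where R: "\<And>w0 w t. norm w0 \<le> R0 \<Longrightarrow> mild M T w0 w \<Longrightarrow> t \<in> {0..T} \<Longrightarrow> norm (w t) \<le> R"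
  proof -
    obtain R where R: "confines R0 T R" using a_priori_bound[of R0 T] by blast
    have "norm (w t) \<le> R" if "norm w0 \<le> R0" "mild M T w0 w" "t \<in> {0..T}" for w0 w t
      by (rule confinesD[OF R continuous_on_loc_lip[OF M_lip], of "\<lambda>_. 1", OF _ _ _ that]) simp_all
    then show thesis by (rule that)
  qed
  obtain L where L: "0 \<le> L" "\<And>x y. norm x \<le> R \<Longrightarrow> norm y \<le> R \<Longrightarrow> norm (M x - M y) \<le> L * norm (x - y)"
    using loc_lipD[OF M_lip] by blast
  have "norm (w t - v t) \<le> exp (L * \<bar>T\<bar>) * norm (w0 - v0)"
    if "norm w0 \<le> R0" "norm v0 \<le> R0" "mild M T w0 w" "mild M T v0 v" "t \<in> {0..T}" for w0 v0 w v t
  proof -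
    have "norm (M (w r) - M (v r)) \<le> L * norm (w r - v r)" if "r \<in> {0..T}" for r
      by (rule L(2)[OF R[OF \<open>norm w0 \<le> R0\<close> \<open>mild M T w0 w\<close> that] R[OF \<open>norm v0 \<le> R0\<close> \<open>mild M T v0 v\<close> that]])
    then have "norm (w t - v t) \<le> norm (w0 - v0) * exp (L * t)"
      using \<open>mild M T w0 w\<close> \<open>mild M T v0 v\<close> \<open>t \<in> {0..T}\<close> unfolding mild_def
      by (intro difference_bound[OF _ _ _ _ continuous_on_loc_lip[OF M_lip] L(1)]) (simp_all only: Ball_def)
    also have "\<dots> \<le> norm (w0 - v0) * exp (L * \<bar>T\<bar>)"
      using that L(1) by (intro mult_left_mono iffD2[OF exp_le_cancel_iff]) auto
    finally show ?thesis by (simp add: mult.commute)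
  qed
  then show ?thesis
    by (intro exI[of _ "exp (L * \<bar>T\<bar>)"] conjI allI impI ballI exp_ge_zero)
qed

text \<open>
  Truncating \<open>M\<close> at the radius \<open>R\<close> of \<open>a_priori_bound\<close> makes it globally Lipschitz. The solution of the
  truncated equation consists of fixed points of \<open>star\<close>, because \<open>star \<circ> w\<close> solves the same equation; hence it conserves the
  energy, obeys the a priori bound, and solves the original equation.
\<close>

theorem mild_exists:
  assumes T: "0 \<le> T" and w0: "star w0 = w0"
  shows "\<exists>w. mild M T w0 w"
proof -
  obtain R where Rpos: "R > 0" and R: "confines (norm w0) T R"
    using a_priori_bound[of "norm w0" T] by blast
  define F where "F x = M (radial R x *\<^sub>R x)" for x
  obtain L where L: "0 \<le> L" "\<And>x y. norm x \<le> R \<Longrightarrow> norm y \<le> R \<Longrightarrow> norm (M x - M y) \<le> L * norm (x - y)"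
    using loc_lipD[OF M_lip] by blast
  have F_lip: "norm (F x - F y) \<le> (L * 2) * norm (x - y)" for x y
  proof -
    have "norm (F x - F y) \<le> L * norm (radial R x *\<^sub>R x - radial R y *\<^sub>R y)"
      unfolding F_def by (intro L(2) norm_radial_le Rpos)
    also have "\<dots> \<le> L * (2 * norm (x - y))" by (intro mult_left_mono radial_lipschitz Rpos L)
    finally show ?thesis by (simp add: mult.assoc)
  qed
  have "loc_lip F" unfolding loc_lip_def using F_lip L(1) by (intro allI exI[of _ "L * 2"]) auto
  then have F: "continuous_on UNIV F" by (rule continuous_on_loc_lip)
  have F_star: "star (F x) = F (star x)" for x
    by (simp add: F_def star_M radial_def star_norm linear_cmul[OF bounded_linear.linear[OF star_linear]])
  have L2: "0 \<le> L * 2" using L(1) by simp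
  have "\<exists>z. continuous_on {0..T} z \<and> (\<forall>t\<in>{0..T}. z t = w0 + integral {0..t} (\<lambda>r. U (- r) (F (U r (z r)))))"
  proof (rule picard_global[OF T L2])
    fix z :: "real \<Rightarrow> 'a" assume "continuous_on {0..T} z"
    then show "continuous_on {0..T} (\<lambda>r. U (- r) (F (U r (z r))))"
      by (intro continuous_on_U continuous_on_compose2[OF F] continuous_intros) auto
  next
    fix r :: real and x y :: 'a
    show "norm (U (- r) (F (U r x)) - U (- r) (F (U r y))) \<le> L * 2 * norm (x - y)"
      using F_lip[of "U r x" "U r y"] by (simp add: U_norm flip: U_diff)
  qed
  then obtain z where z: "continuous_on {0..T} z"
    "\<And>t. t \<in> {0..T} \<Longrightarrow> z t = w0 + integral {0..t} (\<lambda>r. U (- r) (F (U r (z r))))" by blast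
  define w where "w t = U t (z t)" for t
  have cw: "continuous_on {0..T} w" unfolding w_def by (intro continuous_on_U z continuous_intros)
  have duh: "w t = U t w0 + integral {0..t} (\<lambda>r. U (t - r) (F (w r)))" if t: "t \<in> {0..T}" for t
    using interaction_picture[OF cw F t, of w0] z(2)[OF t] by (simp add: w_def U_inverse)
  have csw: "continuous_on {0..T} (\<lambda>t. star (w t))"
    by (rule bounded_linear.continuous_on[OF star_linear cw])
  have star_duh: "star (w t) = U t w0 + integral {0..t} (\<lambda>r. U (t - r) (F (star (w r))))" if t: "t \<in> {0..T}" for t
  proof -
    have c: "continuous_on {0..t} (\<lambda>r. U (t - r) (F (w r)))"
      using t by (intro continuous_on_U continuous_on_compose2[OF F] continuous_on_subset[OF cw] continuous_intros) auto
    have "star (w t) = star (U t w0) + star (integral {0..t} (\<lambda>r. U (t - r) (F (w r))))"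
      unfolding duh[OF t] by (rule linear_add[OF bounded_linear.linear[OF star_linear]])
    also have "\<dots> = U t w0 + integral {0..t} (\<lambda>r. U (t - r) (F (star (w r))))"
      unfolding integral_bounded_linear_comp[OF star_linear c, symmetric] star_U F_star w0 ..
    finally show ?thesis .
  qed
  have "norm (star (w t) - w t) \<le> norm (w0 - w0) * exp (L * 2 * t)" if "t \<in> {0..T}" for t
    by (rule difference_bound[OF csw star_duh cw duh F L2 F_lip that])
  then have sw: "star (w t) = w t" if "t \<in> {0..T}" for t using that by simp
  have mF: "mild F T w0 w" unfolding mild_def using cw sw duh by blast
  have "norm (w t) \<le> R" if "t \<in> {0..T}" for t
    by (rule confinesD[OF R F _ _ _ order_refl mF that, of "radial R"]) (simp_all add: F_def radial_bounds Rpos)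
  then have Fw: "F (w r) = M (w r)" if "r \<in> {0..T}" for r
    using that by (simp add: F_def radial_eq_1 Rpos)
  have "w t = U t w0 + integral {0..t} (\<lambda>r. U (t - r) (M (w r)))" if t: "t \<in> {0..T}" for t
  proof -
    have "integral {0..t} (\<lambda>r. U (t - r) (F (w r))) = integral {0..t} (\<lambda>r. U (t - r) (M (w r)))"
      using t by (intro Henstock_Kurzweil_Integration.integral_cong) (simp add: Fw)
    then show ?thesis using duh[OF t] by simp
  qed
  then have "mild M T w0 w" unfolding mild_def using cw sw by blast
  then show ?thesis by blast
qed

end

section \<open>The trilinear form behind the energy identity\<close>

text \<open>
  This is the integral of \<open>a(x) b(y) c(z)\<close> over the plane \<open>x + y + z = 0\<close>, and thus symmetric in its
  three arguments. For transforms of functions it is a multiple of the integral of their product.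
\<close>

definition tri :: "(real \<Rightarrow> complex) \<Rightarrow> (real \<Rightarrow> complex) \<Rightarrow> (real \<Rightarrow> complex) \<Rightarrow> complex" where
  "tri a b c = (LINT \<xi>|lborel. c (- \<xi>) * conv a b \<xi>)"

lemma tri_commute: "tri a b c = tri b a c"
  by (simp add: tri_def conv_commute[of a b])

lemma integrable_tri:
  assumes "sq_integrable a" "integrable lborel b" "sq_integrable c"
  shows "integrable lborel (\<lambda>\<xi>. c (- \<xi>) * conv a b \<xi>)"
proof -
  have "conv a b = conv b a" by (rule ext) (rule conv_commute)
  then have "sq_integrable (conv a b)" using Young_L1_L2(1)[OF assms(2,1)] by simp
  then show ?thesis by (intro integrable_mult_sq_integrable sq_integrable_uminus_arg assms)
qed

lemma tri_swap:
  assumes a: "sq_integrable a" and b: "integrable lborel b" and c: "sq_integrable c"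
  shows "tri a b c = tri c b a"
proof -
  have [measurable]: "a \<in> borel_measurable borel" "b \<in> borel_measurable borel" "c \<in> borel_measurable borel"
    using a b c by auto
  let ?F = "\<lambda>y x. a y * b (x - y) * c (- x)"
  \<comment> \<open>\<open>\<bar>a c b\<bar> \<le> (\<bar>a\<bar>\<^sup>2 + \<bar>c\<bar>\<^sup>2) \<bar>b\<bar>\<close>, and either part is a convolution kernel of two integrable functions\<close>
  have i1: "integrable (lborel \<Otimes>\<^sub>M lborel) (\<lambda>(y, x). (cmod (a y))\<^sup>2 * cmod (b (x - y)))"
    using integrable_conv_kernel[of "\<lambda>y. (cmod (a y))\<^sup>2" "\<lambda>x. cmod (b x)"] sq_integrableD[OF a] b by simp
  have "integrable lborel (\<lambda>x. (cmod (c (- x)))\<^sup>2)"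
    using sq_integrableD[OF sq_integrable_uminus_arg[OF c]] .
  moreover have "integrable lborel (\<lambda>x. cmod (b (- x)))"
    using b integrable_lborel_reflect_iff[of b 0] by auto
  ultimately have i2': "integrable (lborel \<Otimes>\<^sub>M lborel) (\<lambda>(x, y). (cmod (c (- x)))\<^sup>2 * cmod (b (- (y - x))))"
    by (rule integrable_conv_kernel[of "\<lambda>x. (cmod (c (- x)))\<^sup>2" "\<lambda>t. cmod (b (- t))"])
  have i2: "integrable (lborel \<Otimes>\<^sub>M lborel) (\<lambda>(y, x). (cmod (c (- x)))\<^sup>2 * cmod (b (x - y)))"
    using lborel_pair.integrable_product_swap[OF i2'] by simp
  have i: "integrable (lborel \<Otimes>\<^sub>M lborel) (case_prod ?F)"
  proof (rule Bochner_Integration.integrable_bound[OF Bochner_Integration.integrable_add[OF i1 i2]])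
    show "case_prod ?F \<in> borel_measurable (lborel \<Otimes>\<^sub>M lborel)" by measurable
    have "norm (?F y x) \<le> (cmod (a y))\<^sup>2 * cmod (b (x - y)) + (cmod (c (- x)))\<^sup>2 * cmod (b (x - y))" for x y
    proof -
      have "cmod (a y) * cmod (c (- x)) \<le> (cmod (a y))\<^sup>2 + (cmod (c (- x)))\<^sup>2"
        using sum_squares_bound[of "cmod (a y)" "cmod (c (- x))"]
          mult_nonneg_nonneg[OF norm_ge_zero[of "a y"] norm_ge_zero[of "c (- x)"]] by linarith
      then have "cmod (a y) * cmod (c (- x)) * cmod (b (x - y)) \<le> ((cmod (a y))\<^sup>2 + (cmod (c (- x)))\<^sup>2) * cmod (b (x - y))"
        by (rule mult_right_mono) simp
      then show ?thesis by (simp add: norm_mult algebra_simps)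
    qed
    note le = this
    show "AE z in lborel \<Otimes>\<^sub>M lborel. norm (case_prod ?F z)
      \<le> norm ((case z of (y, x) \<Rightarrow> (cmod (a y))\<^sup>2 * cmod (b (x - y))) + (case z of (y, x) \<Rightarrow> (cmod (c (- x)))\<^sup>2 * cmod (b (x - y))))"
    proof (rule AE_I2)
      fix z :: "real \<times> real"
      obtain y x where z: "z = (y, x)" by (cases z)
      show "norm (case_prod ?F z)
      \<le> norm ((case z of (y, x) \<Rightarrow> (cmod (a y))\<^sup>2 * cmod (b (x - y))) + (case z of (y, x) \<Rightarrow> (cmod (c (- x)))\<^sup>2 * cmod (b (x - y))))"
        unfolding z prod.case real_norm_def by (rule order_trans[OF le abs_ge_self])
    qed
  qed
  have "tri a b c = (LINT x|lborel. LINT y|lborel. ?F y x)"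
    unfolding tri_def conv_def by (simp flip: Bochner_Integration.integral_mult_right_zero add: mult_ac)
  also have "\<dots> = (LINT y|lborel. LINT x|lborel. ?F y x)"
    using lborel_pair.Fubini_integral[OF i] .
  also have "\<dots> = (LINT y|lborel. a y * conv c b (- y))"
  proof (rule Bochner_Integration.integral_cong[OF refl])
    fix y
    have "(LINT x|lborel. ?F y x) = (LINT x|lborel. a y * (c (0 - x) * b (- y - (0 - x))))"
      by (rule Bochner_Integration.integral_cong) (simp_all add: mult_ac)
    also have "\<dots> = a y * (LINT x|lborel. c (0 - x) * b (- y - (0 - x)))" by simp
    also have "(LINT x|lborel. c (0 - x) * b (- y - (0 - x))) = conv c b (- y)"
      unfolding conv_def by (rule integral_lborel_reflect[of "\<lambda>x. c x * b (- y - x)" 0])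
    finally show "(LINT x|lborel. ?F y x) = a y * conv c b (- y)" .
  qed
  also have "\<dots> = tri c b a"
    using integral_lborel_reflect[of "\<lambda>y. a y * conv c b (- y)" 0] by (simp add: tri_def)
  finally show ?thesis .
qed

text \<open>
  Differentiation on the Fourier side, up to the factor \<open>\<i>\<close>.
\<close>

definition mom :: "(real \<Rightarrow> complex) \<Rightarrow> real \<Rightarrow> complex" where
  "mom f \<xi> = of_real \<xi> * f \<xi>"

lemma mom_measurable [measurable (raw)]:
  assumes [measurable]: "f \<in> borel_measurable borel"
  shows "mom f \<in> borel_measurable borel"
  unfolding mom_def by measurable

lemma conv_Leibniz:
  assumes "sq_integrable a" "sq_integrable b" "sq_integrable (mom a)" "sq_integrable (mom b)"
  shows "of_real \<xi> * conv a b \<xi> = conv (mom a) b \<xi> + conv a (mom b) \<xi>"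
proof -
  have "of_real \<xi> * conv a b \<xi> = (LINT y|lborel. of_real \<xi> * (a y * b (\<xi> - y)))"
    by (simp add: conv_def)
  also have "\<dots> = (LINT y|lborel. mom a y * b (\<xi> - y) + a y * mom b (\<xi> - y))"
    by (intro Bochner_Integration.integral_cong refl) (simp add: mom_def algebra_simps)
  also have "\<dots> = conv (mom a) b \<xi> + conv a (mom b) \<xi>"
    unfolding conv_def
    by (intro Bochner_Integration.integral_add integrable_conv_integrand assms)
  finally show ?thesis .
qed

text \<open>
  What the transform of a function of Sobolev order \<open>2\<close> satisfies. In every trilinear expression below at most
  one argument is \<open>D2\<close>, the other two being integrable as well, so all integrals converge
  absolutely.
\<close>

locale moments =
  fixes f :: "real \<Rightarrow> complex"
  assumes L1: "integrable lborel f" "integrable lborel (mom f)"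
    and L2: "sq_integrable f" "sq_integrable (mom f)" "sq_integrable (mom (mom f))"
begin

abbreviation "D \<equiv> mom f"
abbreviation "D2 \<equiv> mom (mom f)"

lemma conv_f_f: "of_real \<xi> * conv f f \<xi> = 2 * conv D f \<xi>"
  by (simp add: conv_Leibniz L2 conv_commute[of f D])

text \<open>
  The Fourier form of \<open>\<integral> u\<^sup>2 u\<^sub>x = 0\<close>: by the Leibniz rule and symmetry the expression equals \<open>-2\<close> times itself.
\<close>

lemma tri_f_f_D: "tri f f D = 0"
proof -
  have "tri f f D = (LINT \<xi>|lborel. (- 2) * (f (- \<xi>) * conv D f \<xi>))"
    unfolding tri_def
  proof (rule Bochner_Integration.integral_cong[OF refl])
    fix \<xi>
    have "D (- \<xi>) * conv f f \<xi> = - (f (- \<xi>) * (of_real \<xi> * conv f f \<xi>))" by (simp add: mom_def)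
    then show "D (- \<xi>) * conv f f \<xi> = (- 2) * (f (- \<xi>) * conv D f \<xi>)" by (simp add: conv_f_f)
  qed
  also have "\<dots> = (- 2) * tri D f f" by (simp only: tri_def Bochner_Integration.integral_mult_right_zero)
  also have "tri D f f = tri f f D" by (rule tri_swap[OF L2(2) L1(1) L2(1)])
  finally have "3 * tri f f D = 0" by simp
  then show ?thesis by simp
qed

text \<open>
  The Fourier form of \<open>2 \<integral> u u\<^sub>x u\<^sub>x\<^sub>x = - \<integral> u\<^sub>x\<^sup>3\<close>: one frequency of \<open>D2\<close> is minus the sum of the other
  two frequencies.
\<close>

lemma tri_D_f_D2: "2 * tri D f D2 = - tri D D D"
proof -
  have "tri D f D2 = (LINT \<xi>|lborel. - (D (- \<xi>) * conv D2 f \<xi> + D (- \<xi>) * conv D D \<xi>))"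
    unfolding tri_def
  proof (rule Bochner_Integration.integral_cong[OF refl])
    fix \<xi>
    have "D2 (- \<xi>) * conv D f \<xi> = - (D (- \<xi>) * (of_real \<xi> * conv D f \<xi>))" by (simp add: mom_def)
    then show "D2 (- \<xi>) * conv D f \<xi> = - (D (- \<xi>) * conv D2 f \<xi> + D (- \<xi>) * conv D D \<xi>)"
      by (simp add: conv_Leibniz L2 distrib_left)
  qed
  also have "\<dots> = - (tri D2 f D + tri D D D)"
    unfolding tri_def integral_minus
    by (simp add: Bochner_Integration.integral_add integrable_tri L1 L2)
  also have "tri D2 f D = tri D f D2" by (rule tri_swap[OF L2(3) L1(1) L2(2)])
  finally have "tri D f D2 + (tri D f D2 + tri D D D) = 0" by (simp only: eq_neg_iff_add_eq_0)
  then show ?thesis by (simp only: eq_neg_iff_add_eq_0 mult_2 add.assoc)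
qed

text \<open>
  The Fourier form of \<open>\<integral> u\<^sup>3 u\<^sub>x = 0\<close>, read as \<open>\<integral> q q\<^sub>x = 0\<close> for \<open>q = u\<^sup>2\<close>: after moving the derivative
  onto \<open>q\<close> the integrand is odd.
\<close>

lemma tri_cubic: "tri f (conv f f) D = 0"
proof -
  let ?Q = "conv f f"
  have Q1: "integrable lborel ?Q" and Q2: "sq_integrable ?Q"
    by (rule integrable_conv[OF L1(1) L1(1)], rule Young_L1_L2(1)[OF L1(1) L2(1)])
  let ?g = "\<lambda>\<xi>. ?Q (- \<xi>) * (of_real \<xi> * ?Q \<xi>)"
  have odd: "integral\<^sup>L lborel ?g = 0"
  proof -
    have "integral\<^sup>L lborel ?g = (LINT \<xi>|lborel. ?g (0 - \<xi>))"
      by (rule integral_lborel_reflect[of ?g 0, symmetric])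
    also have "\<dots> = (LINT \<xi>|lborel. - ?g \<xi>)"
      by (rule Bochner_Integration.integral_cong) simp_all
    finally have "integral\<^sup>L lborel ?g = - integral\<^sup>L lborel ?g" by simp
    then show ?thesis by simp
  qed
  have "tri f ?Q D = tri D ?Q f" by (rule tri_swap[OF L2(1) Q1 L2(2)])
  also have "\<dots> = tri ?Q D f" by (rule tri_commute)
  also have "\<dots> = tri f D ?Q" by (rule tri_swap[OF Q2 L1(2) L2(1)])
  also have "\<dots> = tri D f ?Q" by (rule tri_commute)
  also have "2 * \<dots> = integral\<^sup>L lborel ?g"
    unfolding conv_f_f tri_def by (simp flip: Bochner_Integration.integral_mult_right_zero add: mult_ac)
  finally show ?thesis using odd by simp
qed

end

section \<open>The evolution equation in Fourier variables\<close>

text \<open>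
  The state \<open>w\<close> is the weighted transform of \<open>u\<close> at order \<open>s\<close>. Products are formed at order \<open>r = s - 1\<close>,
  where \<open>u\<close> and \<open>u\<^sub>x\<close> both live.
\<close>

locale wave =
  fixes p :: wave_params and s :: real
  assumes s2: "2 \<le> s" and g1: "0 < gamma1 p" and d1: "0 < delta1 p" and g0: "gamma0 p = 7/48"
begin

definition r :: real where "r = s - 1"
definition \<kappa> :: real where "\<kappa> = min 1 (min (gamma1 p / 2) (delta1 p))"

lemma r1: "1 \<le> r" using s2 by (simp add: r_def)
lemma s_bounds: "0 \<le> s" "1 \<le> s" using s2 by auto
lemma \<kappa>_pos: "0 < \<kappa>" using g1 d1 by (simp add: \<kappa>_def)

lemma jp_4: "jp 4 \<xi> = 1 + 2 * \<xi>\<^sup>2 + \<xi> ^ 4"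
  using jp_add[of 2 2 \<xi>] by (simp add: jp_2 power4_eq_xxxx power2_eq_square algebra_simps)

text \<open>
  Positivity of \<open>\<gamma>\<^sub>1\<close> and \<open>\<delta>\<^sub>1\<close> makes the symbol elliptic of order \<open>4\<close>; this gives the orders of \<open>\<psi>\<close> and
  \<open>\<tau>\<close> as well as the coercivity of the energy.
\<close>

lemma varphi_lower: "\<kappa> * jp 4 \<xi> \<le> varphi_sym p \<xi>"
proof -
  have k: "\<kappa> \<le> 1" "2 * \<kappa> \<le> gamma1 p" "\<kappa> \<le> delta1 p" by (auto simp: \<kappa>_def)
  have "\<kappa> * jp 4 \<xi> = \<kappa> + (2 * \<kappa>) * \<xi>\<^sup>2 + \<kappa> * \<xi> ^ 4" by (simp add: jp_4 algebra_simps)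
  also have "\<dots> \<le> 1 + gamma1 p * \<xi>\<^sup>2 + delta1 p * \<xi> ^ 4"
    by (intro add_mono mult_right_mono k) simp_all
  finally show ?thesis by (simp add: varphi_sym_def)
qed

lemma varphi_pos: "0 < varphi_sym p \<xi>"
  using varphi_lower[of \<xi>] mult_pos_pos[OF \<kappa>_pos jp_pos[of 4 \<xi>]] by linarith

lemma varphi_upper: "varphi_sym p \<xi> \<le> (1 + gamma1 p + delta1 p) * jp 4 \<xi>"
proof -
  have "1 * 1 \<le> 1 * jp 4 \<xi>" using jp_ge_1[of 4 \<xi>] by simp
  moreover have "gamma1 p * \<xi>\<^sup>2 \<le> gamma1 p * jp 4 \<xi>" using g1 by (intro mult_left_mono) (simp_all add: jp_4)
  moreover have "delta1 p * \<xi> ^ 4 \<le> delta1 p * jp 4 \<xi>"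
    using d1 zero_le_power2[of \<xi>] by (intro mult_left_mono) (simp_all add: jp_4)
  ultimately show ?thesis by (simp add: varphi_sym_def distrib_right)
qed

lemma sym_measurable [measurable (raw)]:
  assumes [measurable]: "g \<in> borel_measurable N"
  shows "(\<lambda>x. varphi_sym p (g x)) \<in> borel_measurable N" "(\<lambda>x. phi_sym p (g x)) \<in> borel_measurable N"
    "(\<lambda>x. tau_sym p (g x)) \<in> borel_measurable N" "(\<lambda>x. psi_sym p (g x)) \<in> borel_measurable N"
  unfolding varphi_sym_def phi_sym_def tau_sym_def psi_sym_def by measurable

lemma sym_odd:
  "varphi_sym p (- \<xi>) = varphi_sym p \<xi>" "phi_sym p (- \<xi>) = - phi_sym p \<xi>"
  "tau_sym p (- \<xi>) = - tau_sym p \<xi>" "psi_sym p (- \<xi>) = - psi_sym p \<xi>"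
  by (simp_all add: varphi_sym_def phi_sym_def tau_sym_def psi_sym_def divide_simps)

lemma psi_bound: "\<bar>psi_sym p \<xi>\<bar> * jp 1 \<xi> \<le> 1 / \<kappa>"
proof -
  have "\<bar>\<xi>\<bar> * jp 1 \<xi> \<le> jp 1 \<xi> * jp 1 \<xi>" by (intro mult_right_mono abs_le_jp_1) simp
  also have "\<dots> = jp 2 \<xi>" by (simp flip: jp_add)
  also have "\<dots> \<le> jp 4 \<xi>" by (rule jp_mono) simp
  finally have "\<kappa> * (\<bar>\<xi>\<bar> * jp 1 \<xi>) \<le> varphi_sym p \<xi>"
    using \<kappa>_pos varphi_lower[of \<xi>] by (meson less_imp_le mult_left_mono order_trans)
  then show ?thesis
    using \<kappa>_pos varphi_pos[of \<xi>] by (simp add: psi_sym_def abs_mult field_simps)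
qed

lemma tau_bound: "\<bar>tau_sym p \<xi>\<bar> * jp 1 \<xi> \<le> (3 + 4 * \<bar>gamma0 p\<bar>) / (4 * \<kappa>)"
proof -
  let ?c = "3 + 4 * \<bar>gamma0 p\<bar>"
  have 1: "\<bar>\<xi>\<bar> \<le> jp 3 \<xi>" using abs_le_jp_1[of \<xi>] jp_mono[of 1 3 \<xi>] by simp
  have "\<bar>\<xi>\<bar> ^ 3 \<le> (jp 1 \<xi>) ^ 3" by (intro power_mono abs_le_jp_1) simp
  also have "\<dots> = jp 3 \<xi>" using jp_add[of 1 2 \<xi>] jp_add[of 1 1 \<xi>] by (simp add: power3_eq_cube)
  finally have 3: "\<bar>\<xi>\<bar> ^ 3 \<le> jp 3 \<xi>" .
  have "\<bar>3 * \<xi> - 4 * gamma0 p * \<xi> ^ 3\<bar> \<le> 3 * \<bar>\<xi>\<bar> + 4 * \<bar>gamma0 p\<bar> * \<bar>\<xi>\<bar> ^ 3"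
    using abs_triangle_ineq4[of "3 * \<xi>" "4 * gamma0 p * \<xi> ^ 3"] by (simp add: abs_mult power_abs)
  also have "\<dots> \<le> 3 * jp 3 \<xi> + 4 * \<bar>gamma0 p\<bar> * jp 3 \<xi>"
    by (intro add_mono mult_left_mono 1 3) simp_all
  also have "\<dots> = ?c * jp 3 \<xi>" by (simp add: distrib_right)
  finally have "\<bar>3 * \<xi> - 4 * gamma0 p * \<xi> ^ 3\<bar> * jp 1 \<xi> \<le> ?c * jp 3 \<xi> * jp 1 \<xi>"
    by (intro mult_right_mono) simp_all
  also have "\<dots> = ?c * jp 4 \<xi>" using jp_add[of 3 1 \<xi>] by simp
  finally have "\<kappa> * (\<bar>3 * \<xi> - 4 * gamma0 p * \<xi> ^ 3\<bar> * jp 1 \<xi>) \<le> \<kappa> * (?c * jp 4 \<xi>)"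
    using \<kappa>_pos by (intro mult_left_mono) simp_all
  also have "\<dots> = ?c * (\<kappa> * jp 4 \<xi>)" by (simp only: mult_ac)
  also have "\<dots> \<le> ?c * varphi_sym p \<xi>" by (intro mult_left_mono varphi_lower) simp
  finally show ?thesis
    using \<kappa>_pos varphi_pos[of \<xi>] by (simp add: tau_sym_def abs_mult field_simps)
qed

text \<open>
  The symbols as they act on weighted transforms. The extra weight \<open>jc 1\<close> in \<open>kt\<close> and \<open>kp\<close> is the passage from
  order \<open>r\<close> back to order \<open>s\<close>, and \<open>jc (- 1)\<close> in \<open>ks\<close> the passage from \<open>s\<close> to \<open>r\<close>; \<open>kb\<close> is the energy
  density relative to the weight of order \<open>s\<close>. The factor \<open>- \<i>\<close> of the integral equation is part of \<open>kt\<close> and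
  \<open>kp\<close>, which makes them compatible with \<open>l2_star\<close> (see \<open>k_star\<close>).
\<close>

definition kt :: "real \<Rightarrow> complex" where "kt \<xi> = - \<i> * of_real (tau_sym p \<xi>) * jc 1 \<xi>"
definition kp :: "real \<Rightarrow> complex" where "kp \<xi> = - \<i> * of_real (psi_sym p \<xi>) * jc 1 \<xi>"
definition ks :: "real \<Rightarrow> complex" where "ks \<xi> = \<i> * of_real \<xi> * jc (- 1) \<xi>"
definition kb :: "real \<Rightarrow> complex" where "kb \<xi> = of_real (varphi_sym p \<xi>) * jc (- (2 * s)) \<xi>"
definition ku :: "real \<Rightarrow> real \<Rightarrow> complex" where "ku t \<xi> = chr (phi_sym p \<xi> * t)"

lemma k_measurable [measurable]:
  "kt \<in> borel_measurable borel" "kp \<in> borel_measurable borel" "ks \<in> borel_measurable borel"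
  "kb \<in> borel_measurable borel" "ku t \<in> borel_measurable borel"
  unfolding kt_def kp_def ks_def kb_def ku_def by measurable

text \<open>
  The count of orders: \<open>-1\<close> and \<open>-3\<close> for \<open>\<tau>\<close> and \<open>\<psi>\<close> against the weight \<open>jc 1\<close>, and \<open>4\<close> for the energy
  against \<open>2 s \<ge> 4\<close>.
\<close>

lemma bdd_k [simp]: "bdd_symbol kt" "bdd_symbol kp" "bdd_symbol ks" "bdd_symbol kb" "bdd_symbol (ku t)"
proof -
  have "cmod (kt \<xi>) = \<bar>tau_sym p \<xi>\<bar> * jp 1 \<xi>" "cmod (kp \<xi>) = \<bar>psi_sym p \<xi>\<bar> * jp 1 \<xi>" for \<xi>
    by (simp_all add: kt_def kp_def norm_mult)
  note n = this
  show "bdd_symbol kt"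
    by (rule bdd_symbolI[OF k_measurable(1)], unfold n, rule tau_bound)
  show "bdd_symbol kp"
    by (rule bdd_symbolI[OF k_measurable(2)], unfold n, rule psi_bound)
  have "\<bar>\<xi>\<bar> * jp (- 1) \<xi> \<le> 1" for \<xi>
    using mult_right_mono[OF abs_le_jp_1[of \<xi>] jp_nonneg[of "- 1" \<xi>]] by (simp add: jp_cancel)
  then show "bdd_symbol ks"
    by (intro bdd_symbolI[OF k_measurable(3), where C=1]) (simp add: ks_def norm_mult)
  have "varphi_sym p \<xi> * jp (- (2 * s)) \<xi> \<le> 1 + gamma1 p + delta1 p" for \<xi>
  proof -
    have "varphi_sym p \<xi> * jp (- (2 * s)) \<xi> \<le> ((1 + gamma1 p + delta1 p) * jp 4 \<xi>) * jp (- (2 * s)) \<xi>"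
      by (intro mult_right_mono varphi_upper) simp
    also have "\<dots> = (1 + gamma1 p + delta1 p) * jp (4 + - (2 * s)) \<xi>"
      by (simp only: jp_add mult.assoc)
    also have "\<dots> \<le> (1 + gamma1 p + delta1 p) * 1"
      using s2 g1 d1 by (intro mult_left_mono jp_le_1) simp_all
    finally show ?thesis by simp
  qed
  then show "bdd_symbol kb"
    using varphi_pos by (intro bdd_symbolI[OF k_measurable(4), where C="1 + gamma1 p + delta1 p"])
      (simp add: kb_def norm_mult less_imp_le)
  show "bdd_symbol (ku t)"
    by (rule bdd_symbolI[OF k_measurable(5), where C=1]) (simp add: ku_def)
qed

lemma k_star:
  "cnj (kt (- \<xi>)) = kt \<xi>" "cnj (kp (- \<xi>)) = kp \<xi>" "cnj (ks (- \<xi>)) = ks \<xi>"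
  "cnj (kb \<xi>) = kb \<xi>" "cnj (ku t (- \<xi>)) = ku t \<xi>" "cnj (ku t \<xi>) = ku (- t) \<xi>"
  by (simp_all add: kt_def kp_def ks_def kb_def ku_def sym_odd)

text \<open>
  The weighted transforms at order \<open>r\<close> of \<open>u\<close> and of \<open>u\<^sub>x\<close>.
\<close>

definition a0 :: "l2 \<Rightarrow> l2" where "a0 w = l2_mult (jc (- 1)) w"
definition a1 :: "l2 \<Rightarrow> l2" where "a1 w = l2_mult ks w"
definition U :: "real \<Rightarrow> l2 \<Rightarrow> l2" where "U t = l2_mult (ku t)"
definition B :: "l2 \<Rightarrow> l2" where "B = l2_mult kb"
definition q :: "l2 \<Rightarrow> real" where "q w = norm (l2_mult (jc (2 - s)) w)"

definition M :: "l2 \<Rightarrow> l2" where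
  "M w = (1 / (2 * pi)) *\<^sub>R l2_mult kt (wprod r (a0 w) (a0 w))
     - (1/8 * (1 / (2 * pi))\<^sup>2) *\<^sub>R l2_mult kp (wprod r (a0 w) (wprod r (a0 w) (a0 w)))
     - (7/48 * (1 / (2 * pi))) *\<^sub>R l2_mult kp (wprod r (a1 w) (a1 w))"

lemma bounded_linear_a: "bounded_linear a0" "bounded_linear a1"
  unfolding a0_def[abs_def] a1_def[abs_def] by (intro bounded_linear_l2_mult; simp)+

lemma M_loc_lip: "loc_lip M"
  unfolding M_def[abs_def]
  by (intro loc_lip_diff loc_lip_linear_comp[OF bounded_linear_scaleR_right]
        loc_lip_linear_comp[OF bounded_linear_l2_mult] loc_lip_bilinear_comp[OF bounded_bilinear_wprod[OF r1]]
        loc_lip_linear_comp[OF bounded_linear_a(1)] loc_lip_linear_comp[OF bounded_linear_a(2)] loc_lip_id bdd_k)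

lemma l2_mult_commute: "bdd_symbol m \<Longrightarrow> bdd_symbol n \<Longrightarrow> l2_mult m (l2_mult n f) = l2_mult n (l2_mult m f)"
  by (simp add: l2_mult_l2_mult mult.commute)

lemma norm_a_le: "norm (a0 w) \<le> norm w" "norm (a1 w) \<le> norm w"
proof -
  have "norm (a0 w) \<le> 1 * norm w"
    unfolding a0_def by (rule norm_l2_mult_le) (simp_all add: jp_le_1 jc_measurable)
  then show "norm (a0 w) \<le> norm w" by simp
  have "\<bar>\<xi>\<bar> * jp (- 1) \<xi> \<le> 1" for \<xi>
    using mult_right_mono[OF abs_le_jp_1[of \<xi>] jp_nonneg[of "- 1" \<xi>]] by (simp add: jp_cancel)
  then have "norm (a1 w) \<le> 1 * norm w"
    unfolding a1_def by (intro norm_l2_mult_le k_measurable) (simp add: ks_def norm_mult)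
  then show "norm (a1 w) \<le> norm w" by simp
qed

text \<open>
  The \<open>L\<^sup>1\<close> norms of the transforms of \<open>u\<close> and \<open>u\<^sub>x\<close> need only the norm of order \<open>2\<close> of \<open>u\<close>, which is \<open>q\<close>.
\<close>

lemma unw_L1_a_le: "unw_L1 r (a0 w) \<le> jK * q w" "unw_L1 r (a1 w) \<le> jK * q w"
proof -
  have e: "1 - r = 2 - s" by (simp add: r_def)
  have b: "bdd_symbol (jc (2 - s))" using s2 by simp
  have "l2_mult (jc (2 - s)) (a0 w) = a0 (l2_mult (jc (2 - s)) w)"
    unfolding a0_def by (rule l2_mult_commute[OF b]) simp
  then have "norm (l2_mult (jc (1 - r)) (a0 w)) \<le> q w"
    using norm_a_le(1)[of "l2_mult (jc (2 - s)) w"] by (simp add: e q_def)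
  then show "unw_L1 r (a0 w) \<le> jK * q w"
    using unw_L1_le[OF r1, of "a0 w"] mult_left_mono[OF _ jK_nonneg] order_trans by blast
  have "l2_mult (jc (2 - s)) (a1 w) = a1 (l2_mult (jc (2 - s)) w)"
    unfolding a1_def by (rule l2_mult_commute[OF b]) simp
  then have "norm (l2_mult (jc (1 - r)) (a1 w)) \<le> q w"
    using norm_a_le(2)[of "l2_mult (jc (2 - s)) w"] by (simp add: e q_def)
  then show "unw_L1 r (a1 w) \<le> jK * q w"
    using unw_L1_le[OF r1, of "a1 w"] mult_left_mono[OF _ jK_nonneg] order_trans by blast
qed

lemma wprod_tame:
  assumes "unw_L1 r a \<le> n" "unw_L1 r b \<le> m" "norm a \<le> A" "norm b \<le> C"
  shows "norm (wprod r a b) \<le> 2 powr r * (n * C + A * m)"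
proof -
  have nn: "0 \<le> n" "0 \<le> A"
    using assms(1) unw_L1_nonneg[of r a] assms(3) norm_ge_zero[of a] by linarith+
  have "norm (wprod r a b) \<le> 2 powr r * (unw_L1 r a * norm b + norm a * unw_L1 r b)"
    by (rule norm_wprod_le[OF r1])
  also have "\<dots> \<le> 2 powr r * (n * C + A * m)"
    using nn by (intro mult_left_mono add_mono mult_mono assms) simp_all
  finally show ?thesis .
qed

lemma M_tame: "\<exists>K\<ge>0. \<forall>w. q w \<le> \<rho> \<longrightarrow> norm (M w) \<le> K * norm w"
proof -
  obtain Ct where Ct: "0 < Ct" "\<And>x. norm (l2_mult kt x) \<le> norm x * Ct"
    using bounded_linear.pos_bounded[OF bounded_linear_l2_mult[OF bdd_k(1)]] by blast
  obtain Cp where Cp: "0 < Cp" "\<And>x. norm (l2_mult kp x) \<le> norm x * Cp"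
    using bounded_linear.pos_bounded[OF bounded_linear_l2_mult[OF bdd_k(2)]] by blast
  \<comment> \<open>bounds the \<open>L\<^sup>1\<close> norms of the transforms of \<open>u\<close> and \<open>u\<^sub>x\<close>; by Young also \<open>n\<^sup>2\<close> bounds that of the convolution of the transform of \<open>u\<close> with itself\<close>
  define n where "n = jK * \<bar>\<rho>\<bar>"
  define P where "P = 2 powr r"
  have P: "0 \<le> P" and n: "0 \<le> n" by (simp_all add: P_def n_def)
  define K where "K = (1 / (2 * pi)) * (P * (2 * n) * Ct)
     + (1/8 * (1 / (2 * pi))\<^sup>2) * (P * (n * (P * (2 * n)) + n * n) * Cp)
     + (7/48 * (1 / (2 * pi))) * (P * (2 * n) * Cp)"
  have K: "0 \<le> K"
    unfolding K_def using P n Ct(1) Cp(1) by (intro add_nonneg_nonneg mult_nonneg_nonneg) simp_all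
  have "norm (M w) \<le> K * norm w" if w: "q w \<le> \<rho>" for w
  proof -
    let ?N = "norm w"
    have "jK * q w \<le> n" unfolding n_def using w by (intro mult_left_mono) simp_all
    then have L: "unw_L1 r (a0 w) \<le> n" "unw_L1 r (a1 w) \<le> n"
      using unw_L1_a_le[of w] by linarith+
    have 0: "norm (wprod r (a0 w) (a0 w)) \<le> P * (n * ?N + ?N * n)"
      unfolding P_def by (rule wprod_tame[OF L(1) L(1) norm_a_le(1) norm_a_le(1)])
    have 1: "norm (wprod r (a1 w) (a1 w)) \<le> P * (n * ?N + ?N * n)"
      unfolding P_def by (rule wprod_tame[OF L(2) L(2) norm_a_le(2) norm_a_le(2)])
    have "unw_L1 r (wprod r (a0 w) (a0 w)) \<le> unw_L1 r (a0 w) * unw_L1 r (a0 w)" by (rule unw_L1_wprod_le[OF r1])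
    also have "\<dots> \<le> n * n" by (intro mult_mono L n) simp
    finally have L2: "unw_L1 r (wprod r (a0 w) (a0 w)) \<le> n * n" .
    have 2: "norm (wprod r (a0 w) (wprod r (a0 w) (a0 w))) \<le> P * (n * (P * (n * ?N + ?N * n)) + ?N * (n * n))"
      unfolding P_def by (rule wprod_tame[OF L(1) L2 norm_a_le(1) 0[unfolded P_def]])
    let ?x = "l2_mult kt (wprod r (a0 w) (a0 w))" and ?y = "l2_mult kp (wprod r (a0 w) (wprod r (a0 w) (a0 w)))"
      and ?z = "l2_mult kp (wprod r (a1 w) (a1 w))"
    have x: "norm ?x \<le> P * (n * ?N + ?N * n) * Ct"
      by (rule order_trans[OF Ct(2) mult_right_mono[OF 0 less_imp_le[OF Ct(1)]]])
    have y: "norm ?y \<le> P * (n * (P * (n * ?N + ?N * n)) + ?N * (n * n)) * Cp"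
      by (rule order_trans[OF Cp(2) mult_right_mono[OF 2 less_imp_le[OF Cp(1)]]])
    have z: "norm ?z \<le> P * (n * ?N + ?N * n) * Cp"
      by (rule order_trans[OF Cp(2) mult_right_mono[OF 1 less_imp_le[OF Cp(1)]]])
    let ?c1 = "1 / (2 * pi)" and ?c2 = "1/8 * (1 / (2 * pi))\<^sup>2" and ?c3 = "7/48 * (1 / (2 * pi))"
    have c: "0 \<le> ?c1" "0 \<le> ?c2" "0 \<le> ?c3" by simp_all
    have "norm (M w) \<le> norm (?c1 *\<^sub>R ?x) + norm (?c2 *\<^sub>R ?y) + norm (?c3 *\<^sub>R ?z)"
      unfolding M_def
      using norm_triangle_ineq4[of "?c1 *\<^sub>R ?x - ?c2 *\<^sub>R ?y" "?c3 *\<^sub>R ?z"] norm_triangle_ineq4[of "?c1 *\<^sub>R ?x" "?c2 *\<^sub>R ?y"]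
      by linarith
    also have "\<dots> = ?c1 * norm ?x + ?c2 * norm ?y + ?c3 * norm ?z"
      by (simp only: norm_scaleR abs_of_nonneg[OF c(1)] abs_of_nonneg[OF c(2)] abs_of_nonneg[OF c(3)])
    also have "\<dots> \<le> ?c1 * (P * (n * ?N + ?N * n) * Ct)
        + ?c2 * (P * (n * (P * (n * ?N + ?N * n)) + ?N * (n * n)) * Cp) + ?c3 * (P * (n * ?N + ?N * n) * Cp)"
      by (intro add_mono mult_left_mono x y z c)
    also have "\<dots> = K * ?N"
    proof -
      have "c1 * (P * (n * m + m * n) * Ct) + c2 * (P * (n * (P * (n * m + m * n)) + m * (n * n)) * Cp)
          + c3 * (P * (n * m + m * n) * Cp)
        = (c1 * (P * (2 * n) * Ct) + c2 * (P * (n * (P * (2 * n)) + n * n) * Cp) + c3 * (P * (2 * n) * Cp)) * m"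
        for c1 c2 c3 m :: real
        by (simp add: algebra_simps)
      then show ?thesis unfolding K_def .
    qed
    finally show ?thesis .
  qed
  with K show ?thesis by blast
qed

lemma U_continuous: "continuous_on UNIV (\<lambda>t. U t w)"
  unfolding continuous_on_sequentially
proof (intro allI ballI impI)
  fix x :: "nat \<Rightarrow> real" and t assume x: "(\<forall>n. x n \<in> UNIV) \<and> x \<longlonglongrightarrow> t"
  have "(\<lambda>n. l2_mult (ku (x n)) w) \<longlonglongrightarrow> l2_mult (ku t) w"
  proof (rule tendsto_l2_mult[where C=1])
    show "AE \<xi> in lborel. (\<lambda>n. ku (x n) \<xi>) \<longlonglongrightarrow> ku t \<xi>"
      unfolding ku_def chr_def using x by (intro AE_I2 tendsto_intros) auto
  qed (simp_all add: ku_def[abs_def] k_measurable[unfolded ku_def[abs_def]])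
  then show "((\<lambda>t. U t w) \<circ> x) \<longlonglongrightarrow> U t w" by (simp add: U_def o_def)
qed

lemma star_lin: "l2_star (f - g) = l2_star f - l2_star g" "l2_star (c *\<^sub>R f) = c *\<^sub>R l2_star f"
  by (simp_all add: linear_diff linear_cmul bounded_linear.linear[OF bounded_linear_l2_star])

lemma star_M: "l2_star (M w) = M (l2_star w)"
  by (simp add: M_def star_lin l2_star_mult l2_star_wprod[OF r1] a0_def a1_def k_star)

lemma B_coercive: "\<kappa> * (q w)\<^sup>2 \<le> B w \<bullet> w"
proof -
  have b: "bdd_symbol (jc (2 - s))" using s2 by simp
  have "(q w)\<^sup>2 = (LINT \<xi>|lborel. (cmod (jc (2 - s) \<xi> * rep_l2 w \<xi>))\<^sup>2)"
    unfolding q_def l2_mult_def by (rule norm_to_l2_sq[OF sq_integrable_mult_rep[OF b]])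
  then have "\<kappa> * (q w)\<^sup>2 = (LINT \<xi>|lborel. \<kappa> * (cmod (jc (2 - s) \<xi> * rep_l2 w \<xi>))\<^sup>2)" by simp
  also have "\<dots> \<le> (LINT \<xi>|lborel. (kb \<xi> * rep_l2 w \<xi>) \<bullet> rep_l2 w \<xi>)"
  proof (rule integral_mono)
    show "integrable lborel (\<lambda>\<xi>. \<kappa> * (cmod (jc (2 - s) \<xi> * rep_l2 w \<xi>))\<^sup>2)"
      by (intro integrable_mult_right sq_integrableD sq_integrable_mult_rep b)
    show "integrable lborel (\<lambda>\<xi>. (kb \<xi> * rep_l2 w \<xi>) \<bullet> rep_l2 w \<xi>)"
      by (intro integrable_inner_sq_integrable sq_integrable_mult_rep sq_integrable_rep_l2 bdd_k)
    fix \<xi>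
    have e: "(kb \<xi> * rep_l2 w \<xi>) \<bullet> rep_l2 w \<xi> = varphi_sym p \<xi> * jp (- (2 * s)) \<xi> * (cmod (rep_l2 w \<xi>))\<^sup>2"
    proof -
      have "(of_real x * z) \<bullet> z = x * (cmod z)\<^sup>2" for x and z :: complex
        by (simp add: scaleR_conv_of_real[symmetric] power2_norm_eq_inner)
      then show ?thesis unfolding kb_def jc_def of_real_mult[symmetric] .
    qed
    have "(jp (2 - s) \<xi>)\<^sup>2 = jp (2 - s + (2 - s)) \<xi>"
      by (simp only: jp_add power2_eq_square)
    also have "2 - s + (2 - s) = 4 + - (2 * s)" by simp
    finally have "(cmod (jc (2 - s) \<xi> * rep_l2 w \<xi>))\<^sup>2 = jp 4 \<xi> * jp (- (2 * s)) \<xi> * (cmod (rep_l2 w \<xi>))\<^sup>2"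
      by (simp only: norm_mult norm_jc power_mult_distrib jp_add)
    then have "\<kappa> * (cmod (jc (2 - s) \<xi> * rep_l2 w \<xi>))\<^sup>2 = (\<kappa> * jp 4 \<xi>) * jp (- (2 * s)) \<xi> * (cmod (rep_l2 w \<xi>))\<^sup>2"
      by simp
    also have "\<dots> \<le> varphi_sym p \<xi> * jp (- (2 * s)) \<xi> * (cmod (rep_l2 w \<xi>))\<^sup>2"
      by (intro mult_right_mono varphi_lower) simp_all
    finally show "\<kappa> * (cmod (jc (2 - s) \<xi> * rep_l2 w \<xi>))\<^sup>2 \<le> (kb \<xi> * rep_l2 w \<xi>) \<bullet> rep_l2 w \<xi>"
      unfolding e .
  qed
  also have "\<dots> = B w \<bullet> w" unfolding B_def by (rule inner_l2_mult[OF bdd_k(4), symmetric])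
  finally show ?thesis .
qed

lemma moments_unw: "moments (unw s w)"
proof -
  let ?f = "unw s w"
  have j: "sq_integrable (\<lambda>\<xi>. jc 1 \<xi> * ?f \<xi>)" "sq_integrable (\<lambda>\<xi>. jc 2 \<xi> * ?f \<xi>)"
    using s2 by (auto intro: sq_integrable_jc_unw)
  have D: "sq_integrable (mom ?f)"
    by (rule sq_integrable_bound[OF j(1), where C=1])
       (auto simp: mom_def norm_mult intro!: AE_I2 mult_right_mono abs_le_jp_1, measurable)
  have m: "(\<lambda>\<xi>. jc 1 \<xi> * mom ?f \<xi>) \<in> borel_measurable borel" by measurable
  have jj: "jp 1 \<xi> * \<bar>\<xi>\<bar> \<le> jp 2 \<xi>" "\<bar>\<xi>\<bar> * \<bar>\<xi>\<bar> \<le> jp 2 \<xi>" for \<xi>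
    using mult_left_mono[OF abs_le_jp_1[of \<xi>] jp_nonneg[of 1 \<xi>]] jp_add[of 1 1 \<xi>]
    by (simp_all add: jp_2 flip: power2_eq_square)
  have jD: "sq_integrable (\<lambda>\<xi>. jc 1 \<xi> * mom ?f \<xi>)"
  proof (rule sq_integrable_bound[OF j(2) m, where C=1], rule AE_I2)
    fix \<xi>
    have "jp 1 \<xi> * \<bar>\<xi>\<bar> * cmod (?f \<xi>) \<le> jp 2 \<xi> * cmod (?f \<xi>)" by (intro mult_right_mono jj) simp
    then show "cmod (jc 1 \<xi> * mom ?f \<xi>) \<le> 1 * cmod (jc 2 \<xi> * ?f \<xi>)"
      by (simp add: mom_def norm_mult mult.assoc)
  qed
  have m2: "mom (mom ?f) \<in> borel_measurable borel" by measurable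
  have D2: "sq_integrable (mom (mom ?f))"
  proof (rule sq_integrable_bound[OF j(2) m2, where C=1], rule AE_I2)
    fix \<xi>
    have "\<bar>\<xi>\<bar> * \<bar>\<xi>\<bar> * cmod (?f \<xi>) \<le> jp 2 \<xi> * cmod (?f \<xi>)" by (intro mult_right_mono jj) simp
    then show "cmod (mom (mom ?f) \<xi>) \<le> 1 * cmod (jc 2 \<xi> * ?f \<xi>)"
      by (simp add: mom_def norm_mult mult.assoc)
  qed
  show ?thesis
  proof
    show "integrable lborel ?f" by (rule integrable_unw) (use s2 in simp)
    show "integrable lborel (mom ?f)" by (rule integrable_of_weight_1(1)[OF _ jD]) measurable
    show "sq_integrable ?f" by (rule sq_integrable_unw) (use s2 in simp)
  qed (rule D D2)+
qed

lemma unw_a0: "AE \<xi> in lborel. unw r (a0 w) \<xi> = unw s w \<xi>"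
proof -
  have "bdd_symbol (jc (- 1))" by simp
  from rep_l2_mult[OF this, of w] show ?thesis
  proof eventually_elim
    case (elim \<xi>)
    then show ?case
      using jc_add[of "- r" "- 1" \<xi>] by (simp add: unw_def r_def a0_def mult.assoc)
  qed
qed

lemma unw_a1: "AE \<xi> in lborel. unw r (a1 w) \<xi> = \<i> * mom (unw s w) \<xi>"
  using rep_l2_mult[OF bdd_k(3), of w]
proof eventually_elim
  case (elim \<xi>)
  then show ?case
    using jc_add[of "- r" "- 1" \<xi>] by (simp add: unw_def r_def a1_def mom_def ks_def mult_ac)
qed

text \<open>
  The weights of \<open>B\<close>, of \<open>wprod r\<close> and of the symbol \<open>k\<close> cancel, since \<open>- 2 s + s + 1 + r = 0\<close>. The Hermitian symmetry of \<open>w\<close> replaces the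
  conjugate in the inner product by a reflection, which is the form that \<open>tri\<close> has. Multiplying
  by \<open>varphi_sym\<close> clears the denominator of the symbol.
\<close>

lemma inner_B_term:
  assumes k: "bdd_symbol k" "\<And>\<xi>. k \<xi> = - \<i> * of_real (\<sigma> \<xi>) * jc 1 \<xi>"
    and star: "l2_star w = w" and P: "\<And>\<xi>. varphi_sym p \<xi> * \<sigma> \<xi> = P \<xi>"
    and P_meas: "P \<in> borel_measurable borel"
    and f: "AE \<xi> in lborel. unw r a \<xi> = g \<xi>" "AE \<xi> in lborel. unw r b \<xi> = h \<xi>"
      "g \<in> borel_measurable borel" "h \<in> borel_measurable borel"
  shows "B w \<bullet> l2_mult k (wprod r a b)
    = Re (- \<i> * (LINT \<xi>|lborel. of_real (P \<xi>) * unw s w (- \<xi>) * conv g h \<xi>))"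
proof -
  have [measurable]: "P \<in> borel_measurable borel" "g \<in> borel_measurable borel" "h \<in> borel_measurable borel"
    by fact+
  let ?x = "l2_mult k (wprod r a b)" and ?C = "conv (unw r a) (unw r b)"
  have C: "?C \<xi> = conv g h \<xi>" for \<xi>
    by (rule conv_cong_AE) (use f in measurable)
  let ?h = "\<lambda>\<xi>. cnj (kb \<xi> * rep_l2 w \<xi>) * rep_l2 ?x \<xi>"
  have hi: "integrable lborel ?h"
    by (intro integrable_mult_sq_integrable sq_integrable_cnj sq_integrable_mult_rep sq_integrable_rep_l2 bdd_k)
  have "B w \<bullet> ?x = (LINT \<xi>|lborel. (kb \<xi> * rep_l2 w \<xi>) \<bullet> rep_l2 ?x \<xi>)"
    unfolding B_def by (rule inner_l2_mult[OF bdd_k(4)])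
  also have "\<dots> = (LINT \<xi>|lborel. Re (?h \<xi>))"
  proof (intro Bochner_Integration.integral_cong refl)
    have "u \<bullet> v = Re (cnj u * v)" for u v by (simp add: inner_complex_def)
    then show "(kb \<xi> * rep_l2 w \<xi>) \<bullet> rep_l2 ?x \<xi> = Re (?h \<xi>)" for \<xi> .
  qed
  also have "\<dots> = Re (integral\<^sup>L lborel ?h)" by (rule Bochner_Integration.integral_Re[OF hi])
  also have "integral\<^sup>L lborel ?h = (LINT \<xi>|lborel. - \<i> * (of_real (P \<xi>) * unw s w (- \<xi>) * conv g h \<xi>))"
  proof (rule integral_cong_AE)
    have 1: "AE \<xi> in lborel. rep_l2 ?x \<xi> = k \<xi> * rep_l2 (wprod r a b) \<xi>" by (rule rep_l2_mult[OF k(1)])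
    have 2: "AE \<xi> in lborel. rep_l2 (wprod r a b) \<xi> = jc r \<xi> * ?C \<xi>"
      unfolding wprod_def by (rule rep_l2_to_l2[OF sq_integrable_wprod[OF r1]])
    have 3: "AE \<xi> in lborel. unw s w \<xi> = cnj (unw s w (- \<xi>))"
      using unw_star[of s w] star by simp
    show "AE \<xi> in lborel. ?h \<xi> = - \<i> * (of_real (P \<xi>) * unw s w (- \<xi>) * conv g h \<xi>)"
      using 1 2 3
    proof eventually_elim
      case (elim \<xi>)
      have w: "cnj (rep_l2 w \<xi>) = jc s \<xi> * unw s w (- \<xi>)"
      proof -
        have "rep_l2 w \<xi> = jc s \<xi> * unw s w \<xi>" by (rule jc_unw[symmetric])
        also have "\<dots> = jc s \<xi> * cnj (unw s w (- \<xi>))" using elim(3) by simp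
        finally show ?thesis by simp
      qed
      have j: "jc (- (2 * s)) \<xi> * jc s \<xi> * (jc 1 \<xi> * jc r \<xi>) = 1"
      proof -
        have "jc (- (2 * s)) \<xi> * jc s \<xi> * (jc 1 \<xi> * jc r \<xi>) = jc (- (2 * s) + s + (1 + r)) \<xi>"
          by (simp only: jc_add)
        also have "- (2 * s) + s + (1 + r) = 0" by (simp add: r_def)
        finally show ?thesis by simp
      qed
      have kb: "cnj (kb \<xi>) = of_real (varphi_sym p \<xi>) * jc (- (2 * s)) \<xi>"
        unfolding k_star(4) by (rule kb_def)
      have "?h \<xi> = cnj (kb \<xi>) * cnj (rep_l2 w \<xi>) * (k \<xi> * (jc r \<xi> * conv g h \<xi>))"
        using elim(1,2) C[of \<xi>] by simp
      also have "\<dots> = - \<i> * of_real (varphi_sym p \<xi> * \<sigma> \<xi>) * unw s w (- \<xi>) * conv g h \<xi>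
          * (jc (- (2 * s)) \<xi> * jc s \<xi> * (jc 1 \<xi> * jc r \<xi>))"
        unfolding w kb k(2) of_real_mult by (simp only: mult_ac)
      finally show ?case unfolding j P by (simp add: mult_ac)
    qed
  qed measurable
  also have "\<dots> = - \<i> * (LINT \<xi>|lborel. of_real (P \<xi>) * unw s w (- \<xi>) * conv g h \<xi>)"
    by (rule Bochner_Integration.integral_mult_right_zero)
  finally show ?thesis .
qed

text \<open>
  The terms with \<open>u\<^sup>3\<close> and with the first derivative of \<open>u\<^sup>2\<close> vanish separately. The third derivative of
  \<open>u\<^sup>2\<close> contributes \<open>\<gamma>\<close> times \<open>tri D D D\<close> by \<open>tri_D_f_D2\<close>, and the term with \<open>u\<^sub>x\<^sup>2\<close> contributes \<open>- 7/48\<close>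
  times the same quantity.
\<close>

lemma energy:
  assumes star: "l2_star w = w"
  shows "B w \<bullet> M w = 0"
proof -
  define f where "f = unw s w"
  interpret moments f unfolding f_def by (rule moments_unw)
  have [measurable]: "f \<in> borel_measurable borel" unfolding f_def by measurable
  \<comment> \<open>the only use of the value of \<open>\<gamma>\<close>\<close>
  have vt: "varphi_sym p \<xi> * tau_sym p \<xi> = 3/4 * \<xi> - 7/48 * \<xi> ^ 3" for \<xi>
    using varphi_pos[of \<xi>] by (simp add: tau_sym_def g0 field_simps)
  have vp: "varphi_sym p \<xi> * psi_sym p \<xi> = \<xi>" for \<xi>
    using varphi_pos[of \<xi>] by (simp add: psi_sym_def)
  have u0: "AE \<xi> in lborel. unw r (a0 w) \<xi> = f \<xi>" unfolding f_def by (rule unw_a0)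
  have u1: "AE \<xi> in lborel. unw r (a1 w) \<xi> = \<i> * D \<xi>" unfolding f_def by (rule unw_a1)
  have u2: "AE \<xi> in lborel. unw r (wprod r (a0 w) (a0 w)) \<xi> = conv f f \<xi>"
  proof -
    have "conv (unw r (a0 w)) (unw r (a0 w)) \<xi> = conv f f \<xi>" for \<xi>
      by (rule conv_cong_AE) (use u0 in measurable)
    then show ?thesis using unw_wprod[OF r1, of "a0 w" "a0 w"] by simp
  qed
  have mP: "(\<lambda>\<xi>::real. 3/4 * \<xi> - 7/48 * \<xi> ^ 3) \<in> borel_measurable borel" "(\<lambda>\<xi>::real. \<xi>) \<in> borel_measurable borel"
    by measurable
  have mf: "f \<in> borel_measurable borel" "conv f f \<in> borel_measurable borel" "(\<lambda>\<xi>. \<i> * D \<xi>) \<in> borel_measurable borel"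
    by measurable
  have I1: "(LINT \<xi>|lborel. of_real (3/4 * \<xi> - 7/48 * \<xi> ^ 3) * f (- \<xi>) * conv f f \<xi>) = 7/48 * tri D D D"
  proof -
    have "(LINT \<xi>|lborel. of_real (3/4 * \<xi> - 7/48 * \<xi> ^ 3) * f (- \<xi>) * conv f f \<xi>)
      = (LINT \<xi>|lborel. (- 3/4) * (D (- \<xi>) * conv f f \<xi>) + (- 7/24) * (D2 (- \<xi>) * conv D f \<xi>))"
    proof (rule Bochner_Integration.integral_cong[OF refl])
      fix \<xi>
      have "of_real (3/4 * \<xi> - 7/48 * \<xi> ^ 3) * f (- \<xi>) * conv f f \<xi>
        = (- 3/4) * (D (- \<xi>) * conv f f \<xi>) + (- 7/48) * (D2 (- \<xi>) * (of_real \<xi> * conv f f \<xi>))"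
        by (simp add: mom_def power3_eq_cube algebra_simps)
      then show "of_real (3/4 * \<xi> - 7/48 * \<xi> ^ 3) * f (- \<xi>) * conv f f \<xi>
        = (- 3/4) * (D (- \<xi>) * conv f f \<xi>) + (- 7/24) * (D2 (- \<xi>) * conv D f \<xi>)"
        by (simp add: conv_f_f)
    qed
    also have "\<dots> = (- 3/4) * tri f f D + (- 7/24) * tri D f D2"
      unfolding tri_def
      by (subst Bochner_Integration.integral_add)
         (simp_all only: Bochner_Integration.integral_mult_right_zero integrable_mult_right integrable_tri L1 L2)
    also have "\<dots> = 7/48 * tri D D D"
      using tri_D_f_D2 by (simp add: tri_f_f_D)
    finally show ?thesis .
  qed
  have I2: "(LINT \<xi>|lborel. of_real \<xi> * f (- \<xi>) * conv f (conv f f) \<xi>) = 0"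
  proof -
    have "(LINT \<xi>|lborel. of_real \<xi> * f (- \<xi>) * conv f (conv f f) \<xi>) = (LINT \<xi>|lborel. (- 1) * (D (- \<xi>) * conv f (conv f f) \<xi>))"
      by (rule Bochner_Integration.integral_cong) (simp_all add: mom_def)
    also have "\<dots> = (- 1) * tri f (conv f f) D"
      unfolding tri_def by (rule Bochner_Integration.integral_mult_right_zero)
    finally show ?thesis by (simp add: tri_cubic)
  qed
  have I3: "(LINT \<xi>|lborel. of_real \<xi> * f (- \<xi>) * conv (\<lambda>\<xi>. \<i> * D \<xi>) (\<lambda>\<xi>. \<i> * D \<xi>) \<xi>) = tri D D D"
    unfolding tri_def
  proof (rule Bochner_Integration.integral_cong[OF refl])
    fix \<xi>
    have "conv (\<lambda>\<xi>. \<i> * D \<xi>) (\<lambda>\<xi>. \<i> * D \<xi>) \<xi> = - conv D D \<xi>"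
      by (simp add: conv_cmult_left conv_cmult_right)
    then show "of_real \<xi> * f (- \<xi>) * conv (\<lambda>\<xi>. \<i> * D \<xi>) (\<lambda>\<xi>. \<i> * D \<xi>) \<xi> = D (- \<xi>) * conv D D \<xi>"
      by (simp add: mom_def[of f "- \<xi>"])
  qed
  have e1: "B w \<bullet> l2_mult kt (wprod r (a0 w) (a0 w)) = Re (- \<i> * (7/48 * tri D D D))"
    using inner_B_term[OF bdd_k(1) kt_def star vt mP(1) u0 u0 mf(1) mf(1), folded f_def] unfolding I1 .
  have e2: "B w \<bullet> l2_mult kp (wprod r (a0 w) (wprod r (a0 w) (a0 w))) = Re (- \<i> * 0)"
    using inner_B_term[OF bdd_k(2) kp_def star vp mP(2) u0 u2 mf(1) mf(2), folded f_def] unfolding I2 .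
  have e3: "B w \<bullet> l2_mult kp (wprod r (a1 w) (a1 w)) = Re (- \<i> * tri D D D)"
    using inner_B_term[OF bdd_k(2) kp_def star vp mP(2) u1 u1 mf(3) mf(3), folded f_def] unfolding I3 .
  have e4: "Re (- \<i> * (7/48 * tri D D D)) = 7/48 * Re (- \<i> * tri D D D)" "Re (- \<i> * 0) = 0" by simp_all
  have "c * (7/48 * x) - d * 0 - (7/48 * c) * x = 0" for c d x :: real by simp
  then show ?thesis
    unfolding M_def inner_diff_right inner_scaleR_right e1 e2 e3 e4 .
qed

sublocale conservative_flow U M l2_star B q \<kappa>
proof (rule conservative_flow.intro)
  fix t t' c \<rho> :: real and x y :: l2
  show "bounded_linear (U t)" unfolding U_def by (rule bounded_linear_l2_mult) simp
  show "norm (U t x) = norm x" unfolding U_def by (rule norm_l2_mult_unimodular) (simp_all add: ku_def)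
  show "U 0 x = x" by (simp add: U_def ku_def[abs_def])
  show "U t (U t' x) = U (t + t') x"
    by (simp add: U_def l2_mult_l2_mult) (simp add: ku_def[abs_def] chr_add distrib_left)
  show "U t x \<bullet> y = x \<bullet> U (- t) y"
    unfolding U_def by (simp add: inner_l2_mult_cnj k_star)
  show "continuous_on UNIV (\<lambda>t. U t x)" by (rule U_continuous)
  show "loc_lip M" by (rule M_loc_lip)
  show "\<exists>K\<ge>0. \<forall>x. q x \<le> \<rho> \<longrightarrow> norm (M x) \<le> K * norm x" by (rule M_tame)
  show "q (c *\<^sub>R x) \<le> q x" if "0 \<le> c" "c \<le> 1"
  proof -
    have b: "bdd_symbol (jc (2 - s))" using s2 by simp
    have "q (c *\<^sub>R x) = c * q x"
      using that by (simp add: q_def linear_cmul[OF bounded_linear.linear[OF bounded_linear_l2_mult[OF b]]])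
    also have "\<dots> \<le> 1 * q x" using that by (intro mult_right_mono) (simp_all add: q_def)
    finally show ?thesis by simp
  qed
  show "bounded_linear l2_star" by (rule bounded_linear_l2_star)
  show "norm (l2_star x) = norm x" by (rule norm_l2_star)
  show "l2_star (U t x) = U t (l2_star x)" unfolding U_def by (simp only: l2_star_mult bdd_k k_star(5))
  show "l2_star (M x) = M (l2_star x)" by (rule star_M)
  show "bounded_linear B" unfolding B_def by (rule bounded_linear_l2_mult) simp
  show "B x \<bullet> y = x \<bullet> B y" unfolding B_def by (simp add: inner_l2_mult_cnj k_star)
  show "B (U t x) = U t (B x)" unfolding B_def U_def by (rule l2_mult_commute) simp_all
  show "0 < \<kappa>" by (rule \<kappa>_pos)
  show "\<kappa> * (q x)\<^sup>2 \<le> B x \<bullet> x" by (rule B_coercive)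
  show "B x \<bullet> M x = 0" if "l2_star x = x" by (rule energy[OF that])
qed

end

section \<open>Sobolev functions as weighted inverse Fourier transforms\<close>

text \<open>
  Complex homogeneity of the transform, whose linearity as a map of the real space \<^typ>\<open>l2\<close> covers
  only real factors.
\<close>

lemma fourier_l2_mult_const: "fourier (l2_mult (\<lambda>_. c) f) = l2_mult (\<lambda>_. c) (fourier f)"
proof (rule bounded_linear_eq_on_window[where S="\<lambda>f. fourier (l2_mult (\<lambda>_. c) f)" and T="\<lambda>f. l2_mult (\<lambda>_. c) (fourier f)"])
  fix R
  let ?g = "\<lambda>x. window R x * rep_l2 f x"
  have g: "integrable lborel ?g" "sq_integrable ?g"
    by (intro integrable_window_mult sq_integrable_window_mult sq_integrable_rep_l2)+
  have c: "integrable lborel (\<lambda>x. c * ?g x)" "sq_integrable (\<lambda>x. c * ?g x)"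
    by (intro integrable_mult_right g, intro sq_integrable_cmult g)
  have e: "ft (\<lambda>x. c * ?g x) = (\<lambda>\<xi>. c * ft ?g \<xi>)" by (rule ext) (rule ft_cmult)
  have m: "(\<lambda>_::real. c) \<in> borel_measurable borel" by simp
  show "fourier (l2_mult (\<lambda>_. c) (l2_mult (window R) f)) = l2_mult (\<lambda>_. c) (fourier (l2_mult (window R) f))"
    unfolding l2_mult_def[of "window R"] l2_mult_to_l2[OF m g(2)] fourier_to_l2[OF g] fourier_to_l2[OF c]
      l2_mult_to_l2[OF m ft_L2(1)[OF g]] e ..
qed (intro bounded_linear_compose[OF bounded_linear_fourier bounded_linear_l2_mult]
      bounded_linear_compose[OF bounded_linear_l2_mult bounded_linear_fourier] bdd_symbol_const)+

text \<open>
  The function with the weighted transform \<open>a\<close> at order \<open>t\<close>.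
\<close>

definition low :: "real \<Rightarrow> l2 \<Rightarrow> l2" where
  "low t a = fourier_inv (l2_mult (jc (- t)) a)"

lemma bdd_jc_minus: "0 \<le> t \<Longrightarrow> bdd_symbol (jc (- t))"
  by simp

lemma bounded_linear_low: "0 \<le> t \<Longrightarrow> bounded_linear (low t)"
  unfolding low_def[abs_def]
  by (intro bounded_linear_compose[OF bounded_linear_fourier_inv bounded_linear_l2_mult] bdd_jc_minus)

lemma fourier_low: "fourier (low t a) = l2_mult (jc (- t)) a"
  by (simp add: low_def)

lemma rep_fourier_low: "0 \<le> t \<Longrightarrow> AE \<xi> in lborel. rep_l2 (fourier (low t a)) \<xi> = unw t a \<xi>"
  unfolding fourier_low unw_def by (rule rep_l2_mult) simp

lemma low_inject:
  assumes "0 \<le> t" "low t a = low t b" shows "a = b"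
proof -
  have "AE \<xi> in lborel. unw t a \<xi> = unw t b \<xi>"
    using rep_fourier_low[OF assms(1), of a] rep_fourier_low[OF assms(1), of b]
    unfolding assms(2) by eventually_elim simp
  then have "AE \<xi> in lborel. rep_l2 a \<xi> = rep_l2 b \<xi>"
    by eventually_elim (metis jc_unw)
  then show ?thesis by (simp add: l2_eq_iff)
qed

lemma low_mult_const: "0 \<le> t \<Longrightarrow> low t (l2_mult (\<lambda>_. c) a) = l2_mult (\<lambda>_. c) (low t a)"
proof -
  assume t: "0 \<le> t"
  have "fourier (low t (l2_mult (\<lambda>_. c) a)) = fourier (l2_mult (\<lambda>_. c) (low t a))"
    using t by (simp add: fourier_low fourier_l2_mult_const l2_mult_l2_mult mult.commute jc_measurable)
  then show ?thesis by (rule fourier_inject)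
qed

lemma integrable_rep_fourier_low:
  assumes t: "1 \<le> t" shows "integrable lborel (rep_l2 (fourier (low t a)))"
proof (rule integrable_cong_AE_imp[OF integrable_unw[OF t]])
  show "AE \<xi> in lborel. unw t a \<xi> = rep_l2 (fourier (low t a)) \<xi>"
    using rep_fourier_low[OF order_trans[OF zero_le_one t], of a] by eventually_elim simp
qed simp

lemma product_low:
  assumes t: "1 \<le> t"
  shows "to_l2 (\<lambda>x. rep_l2 (low t a) x * rep_l2 (low t b) x) = (1 / (2 * pi)) *\<^sub>R low t (wprod t a b)"
proof (rule fourier_inject)
  have t0: "0 \<le> t" using t by simp
  have c: "conv (rep_l2 (fourier (low t a))) (rep_l2 (fourier (low t b))) \<xi> = conv (unw t a) (unw t b) \<xi>" for \<xi>
    by (intro conv_cong_AE rep_fourier_low t0) measurable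
  have "l2_mult (jc (- t)) (wprod t a b) = to_l2 (\<lambda>\<xi>. jc (- t) \<xi> * (jc t \<xi> * conv (unw t a) (unw t b) \<xi>))"
    unfolding wprod_def by (rule l2_mult_to_l2[OF _ sq_integrable_wprod[OF t]]) measurable
  also have "\<dots> = to_l2 (conv (unw t a) (unw t b))"
    by (simp only: jc_cancel_left)
  finally have w: "l2_mult (jc (- t)) (wprod t a b) = to_l2 (conv (unw t a) (unw t b))" .
  have "fourier (to_l2 (\<lambda>x. rep_l2 (low t a) x * rep_l2 (low t b) x))
    = (1 / (2 * pi)) *\<^sub>R to_l2 (conv (unw t a) (unw t b))"
    using fourier_product(2)[OF integrable_rep_fourier_low[OF t, of a] integrable_rep_fourier_low[OF t, of b]]
    by (simp only: c[abs_def])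
  then show "fourier (to_l2 (\<lambda>x. rep_l2 (low t a) x * rep_l2 (low t b) x)) = fourier ((1 / (2 * pi)) *\<^sub>R low t (wprod t a b))"
    by (simp only: linear_cmul[OF bounded_linear.linear[OF bounded_linear_fourier]] fourier_low w)
qed

text \<open>
  The weight in the definition of the Sobolev norm cancels against that of \<open>low\<close>, and \<open>l2_star\<close> commutes with
  the weight.
\<close>

lemma sobolev_low:
  assumes t: "0 \<le> t"
  shows "sobolev_norm t (low t a) = norm a" and "low t a \<in> sobolev t \<longleftrightarrow> l2_star a = a"
proof -
  have ae: "AE \<xi> in lborel. (1 + \<xi>\<^sup>2) powr t * (cmod (rep_l2 (fourier (low t a)) \<xi>))\<^sup>2 = (cmod (rep_l2 a \<xi>))\<^sup>2"
    using rep_fourier_low[OF t, of a]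
  proof eventually_elim
    case (elim \<xi>)
    have "(1 + \<xi>\<^sup>2) powr t * (cmod (unw t a \<xi>))\<^sup>2 = (cmod (jc t \<xi> * unw t a \<xi>))\<^sup>2"
      by (simp add: norm_mult power_mult_distrib jp_square)
    then show ?case by (simp only: elim jc_unw)
  qed
  have m: "(\<lambda>\<xi>. (1 + \<xi>\<^sup>2) powr t * (cmod (rep_l2 (fourier (low t a)) \<xi>))\<^sup>2) \<in> borel_measurable lborel"
    by measurable
  have "(LINT \<xi>|lborel. (1 + \<xi>\<^sup>2) powr t * (cmod (rep_l2 (fourier (low t a)) \<xi>))\<^sup>2) = (norm a)\<^sup>2"
    unfolding norm_l2_sq by (rule integral_cong_AE[OF m _ ae]) measurable
  then show "sobolev_norm t (low t a) = norm a" by (simp add: sobolev_norm_def)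
  have i: "integrable lborel (\<lambda>\<xi>. (1 + \<xi>\<^sup>2) powr t * (cmod (rep_l2 (fourier (low t a)) \<xi>))\<^sup>2)"
    using ae by (intro integrable_cong_AE_imp[OF integrable_rep_l2[of a] m]) (elim eventually_mono, simp)
  have "l2_star (fourier (low t a)) = fourier (low t (l2_star a))"
    using t by (simp add: fourier_low l2_star_mult)
  then have "l2_real_valued (low t a) \<longleftrightarrow> fourier (low t (l2_star a)) = fourier (low t a)"
    by (simp only: l2_real_valued_iff_star)
  also have "\<dots> \<longleftrightarrow> l2_star a = a"
    using fourier_inject low_inject[OF t] by metis
  finally show "low t a \<in> sobolev t \<longleftrightarrow> l2_star a = a"
    using i by (simp add: sobolev_def)
qed

lemma sobolev_eq_low:
  assumes t: "0 \<le> t" and u: "u \<in> sobolev t"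
  obtains a where "u = low t a" "l2_star a = a"
proof -
  let ?h = "\<lambda>\<xi>. jc t \<xi> * rep_l2 (fourier u) \<xi>"
  have "(cmod (?h \<xi>))\<^sup>2 = (1 + \<xi>\<^sup>2) powr t * (cmod (rep_l2 (fourier u) \<xi>))\<^sup>2" for \<xi>
    by (simp add: norm_mult power_mult_distrib jp_square)
  then have h: "sq_integrable ?h"
    using u by (simp add: sobolev_def sq_integrable_def)
  have m: "jc (- t) \<in> borel_measurable borel" by measurable
  have "l2_mult (jc (- t)) (to_l2 ?h) = fourier u"
    unfolding l2_mult_to_l2[OF m h] jc_cancel_left by simp
  then have e: "u = low t (to_l2 ?h)" unfolding low_def by simp
  have "low t (to_l2 ?h) \<in> sobolev t" using u by (rule subst[OF e])
  then have "l2_star (to_l2 ?h) = to_l2 ?h" by (simp only: sobolev_low(2)[OF t])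
  with e show thesis by (rule that)
qed

context wave
begin

lemma r_nonneg: "0 \<le> r" using r1 by simp

lemma low_s_eq: "low s w = low r (a0 w)"
proof (rule fourier_inject)
  have "jc (- r) \<xi> * jc (- 1) \<xi> = jc (- s) \<xi>" for \<xi>
    by (simp add: r_def flip: jc_add)
  then show "fourier (low s w) = fourier (low r (a0 w))"
    by (simp add: fourier_low a0_def l2_mult_l2_mult jc_measurable)
qed

lemma deriv_low: "l2_deriv (low s w) = low r (a1 w)"
proof -
  let ?m = "\<lambda>\<xi>. \<i> * complex_of_real \<xi>"
  have m: "?m \<in> borel_measurable borel" by measurable
  have ae: "AE \<xi> in lborel. jc (- r) \<xi> * rep_l2 (a1 w) \<xi> = ?m \<xi> * rep_l2 (fourier (low s w)) \<xi>"
    using unw_a1[of w] rep_fourier_low[OF s_bounds(1), of w]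
    by eventually_elim (simp add: unw_def[of r] mom_def mult.assoc)
  have b: "bdd_symbol (jc (- r))" by (rule bdd_jc_minus[OF r_nonneg])
  have ms: "(\<lambda>\<xi>. ?m \<xi> * rep_l2 (fourier (low s w)) \<xi>) \<in> borel_measurable borel" by measurable
  have sq: "sq_integrable (\<lambda>\<xi>. ?m \<xi> * rep_l2 (fourier (low s w)) \<xi>)"
    by (rule sq_integrable_cong_AE[OF sq_integrable_mult_rep[OF b] ms ae])
  have "to_l2 (\<lambda>\<xi>. ?m \<xi> * rep_l2 (fourier (low s w)) \<xi>) = l2_mult (jc (- r)) (a1 w)"
    unfolding l2_mult_def
    by (rule to_l2_cong_AE[OF sq_integrable_measurable[OF sq_integrable_mult_rep[OF b]] ms ae, symmetric])
  then show ?thesis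
    unfolding l2_deriv_def fourier_mult_eq[OF m sq] by (simp only: low_def)
qed

lemma low_scaleR: "low r (c *\<^sub>R a) = c *\<^sub>R low r a" "low s (c *\<^sub>R a) = c *\<^sub>R low s a"
  by (simp_all add: linear_cmul bounded_linear.linear[OF bounded_linear_low] r_nonneg s_bounds)

lemma low_diff: "low s (a - b) = low s a - low s b"
  by (simp add: linear_diff bounded_linear.linear[OF bounded_linear_low] s_bounds)

lemma low_add: "low s (a + b) = low s a + low s b"
  by (simp add: linear_add bounded_linear.linear[OF bounded_linear_low] s_bounds)

lemma l2_power_low_2: "l2_power (low r a) 2 = (1 / (2 * pi)) *\<^sub>R low r (wprod r a a)"
  using product_low[OF r1, of a a] by (simp add: l2_power_def power2_eq_square)

text \<open>
  The cube is the product of \<open>u\<close> with \<open>u\<^sup>2\<close>, and \<open>l2_power_low_2\<close> exhibits \<open>u\<^sup>2\<close> as a function of the same order.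
\<close>

lemma l2_power_low_3: "l2_power (low r a) 3 = (1 / (2 * pi))\<^sup>2 *\<^sub>R low r (wprod r a (wprod r a a))"
proof -
  let ?u = "low r a" and ?c = "1 / (2 * pi)"
  have sq: "sq_integrable (\<lambda>x. rep_l2 ?u x * rep_l2 ?u x)"
    by (rule fourier_product(1)) (rule integrable_rep_fourier_low[OF r1])+
  have v: "to_l2 (\<lambda>x. rep_l2 ?u x * rep_l2 ?u x) = low r (?c *\<^sub>R wprod r a a)"
    using product_low[OF r1, of a a] by (simp only: low_scaleR)
  have "l2_power ?u 3 = to_l2 (\<lambda>x. rep_l2 ?u x * rep_l2 (low r (?c *\<^sub>R wprod r a a)) x)"
    unfolding l2_power_def
  proof (rule to_l2_cong_AE)
    show "AE x in lborel. rep_l2 ?u x ^ 3 = rep_l2 ?u x * rep_l2 (low r (?c *\<^sub>R wprod r a a)) x"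
      using rep_l2_to_l2[OF sq] unfolding v by eventually_elim (simp add: power3_eq_cube mult.assoc)
  qed measurable
  also have "\<dots> = ?c *\<^sub>R low r (wprod r a (?c *\<^sub>R wprod r a a))"
    by (rule product_low[OF r1])
  also have "wprod r a (?c *\<^sub>R wprod r a a) = ?c *\<^sub>R wprod r a (wprod r a a)"
    by (rule bounded_bilinear.scaleR_right[OF bounded_bilinear_wprod[OF r1]])
  finally show ?thesis by (simp add: low_scaleR power2_eq_square)
qed

lemma fourier_mult_low:
  assumes m: "bdd_symbol m" and k: "bdd_symbol k" "\<And>\<xi>. k \<xi> = - \<i> * m \<xi> * jc 1 \<xi>"
  shows "fourier_mult m (low r a) = low s (l2_mult (\<lambda>_. \<i>) (l2_mult k a))"
proof -
  have e: "jc (- s) \<xi> * (\<i> * k \<xi>) = m \<xi> * jc (- r) \<xi>" for \<xi>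
  proof -
    have "\<i> * k \<xi> = m \<xi> * jc 1 \<xi>" by (simp add: k(2) mult.assoc[symmetric])
    then have "jc (- s) \<xi> * (\<i> * k \<xi>) = m \<xi> * (jc (- s) \<xi> * jc 1 \<xi>)"
      by (simp only: mult_ac)
    also have "jc (- s) \<xi> * jc 1 \<xi> = jc (- r) \<xi>" by (simp add: r_def flip: jc_add)
    finally show ?thesis .
  qed
  have bi: "bdd_symbol (\<lambda>\<xi>. \<i> * k \<xi>)" by (intro bdd_symbol_mult bdd_symbol_const k)
  have "fourier_mult m (low r a) = fourier_inv (l2_mult m (l2_mult (jc (- r)) a))"
    by (simp add: fourier_mult_bdd[OF m] fourier_low)
  also have "l2_mult m (l2_mult (jc (- r)) a) = l2_mult (\<lambda>\<xi>. jc (- s) \<xi> * (\<i> * k \<xi>)) a"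
    unfolding e by (rule l2_mult_l2_mult[OF bdd_symbol_measurable[OF m] bdd_jc_minus[OF r_nonneg]])
  also have "\<dots> = l2_mult (jc (- s)) (l2_mult (\<lambda>_. \<i>) (l2_mult k a))"
    using l2_mult_l2_mult[of "jc (- s)", OF _ bi, of a] l2_mult_l2_mult[of "\<lambda>_. \<i>", OF _ k(1), of a]
    by (simp add: jc_measurable)
  finally show ?thesis by (simp only: low_def)
qed

lemma bdd_sym: "bdd_symbol (\<lambda>\<xi>. of_real (tau_sym p \<xi>))" "bdd_symbol (\<lambda>\<xi>. of_real (psi_sym p \<xi>))"
proof -
  have le: "\<bar>x\<bar> \<le> \<bar>x\<bar> * jp 1 \<xi>" for x \<xi>
    using jp_ge_1[of 1 \<xi>] by (simp add: mult_le_cancel_left1)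
  show "bdd_symbol (\<lambda>\<xi>. of_real (tau_sym p \<xi>))"
  proof (rule bdd_symbolI)
    show "cmod (of_real (tau_sym p \<xi>)) \<le> (3 + 4 * \<bar>gamma0 p\<bar>) / (4 * \<kappa>)" for \<xi>
      unfolding norm_of_real by (rule order_trans[OF le tau_bound])
  qed measurable
  show "bdd_symbol (\<lambda>\<xi>. of_real (psi_sym p \<xi>))"
  proof (rule bdd_symbolI)
    show "cmod (of_real (psi_sym p \<xi>)) \<le> 1 / \<kappa>" for \<xi>
      unfolding norm_of_real by (rule order_trans[OF le psi_bound])
  qed measurable
qed

lemma fourier_mult_scaleR:
  "bdd_symbol m \<Longrightarrow> fourier_mult m (c *\<^sub>R f) = c *\<^sub>R fourier_mult m f"
  by (simp add: fourier_mult_bdd linear_cmul[OF bounded_linear.linear] bounded_linear_fourier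
      bounded_linear_fourier_inv bounded_linear_l2_mult)

text \<open>
  The nonlinearity of the equation is \<open>\<i>\<close> times that of the abstract problem; the integral equation
  carries the factor \<open>- \<i>\<close>.
\<close>

lemma nonlinearity_low: "nonlinearity p (low s w) = low s (l2_mult (\<lambda>_. \<i>) (M w))"
proof -
  let ?I = "l2_mult (\<lambda>_. \<i>)" and ?c = "1 / (2 * pi)"
  have I: "?I (a - b) = ?I a - ?I b" "?I (d *\<^sub>R a) = d *\<^sub>R ?I a" for a b d
    by (simp_all add: linear_diff linear_cmul bounded_linear.linear[OF bounded_linear_l2_mult])
  have kt: "kt \<xi> = - \<i> * of_real (tau_sym p \<xi>) * jc 1 \<xi>" and kp: "kp \<xi> = - \<i> * of_real (psi_sym p \<xi>) * jc 1 \<xi>" for \<xi>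
    by (simp_all add: kt_def kp_def)
  have 1: "fourier_mult (\<lambda>\<xi>. of_real (tau_sym p \<xi>)) (l2_power (low s w) 2)
      = low s (?I (?c *\<^sub>R l2_mult kt (wprod r (a0 w) (a0 w))))"
    unfolding low_s_eq[of w] l2_power_low_2 fourier_mult_scaleR[OF bdd_sym(1)] fourier_mult_low[OF bdd_sym(1) bdd_k(1) kt]
    unfolding I low_scaleR ..
  have 2: "fourier_mult (\<lambda>\<xi>. of_real (psi_sym p \<xi>)) (l2_power (low s w) 3)
      = low s (?I (?c\<^sup>2 *\<^sub>R l2_mult kp (wprod r (a0 w) (wprod r (a0 w) (a0 w)))))"
    unfolding low_s_eq[of w] l2_power_low_3 fourier_mult_scaleR[OF bdd_sym(2)] fourier_mult_low[OF bdd_sym(2) bdd_k(2) kp]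
    unfolding I low_scaleR ..
  have 3: "fourier_mult (\<lambda>\<xi>. of_real (psi_sym p \<xi>)) (l2_power (l2_deriv (low s w)) 2)
      = low s (?I (?c *\<^sub>R l2_mult kp (wprod r (a1 w) (a1 w))))"
    unfolding deriv_low l2_power_low_2 fourier_mult_scaleR[OF bdd_sym(2)] fourier_mult_low[OF bdd_sym(2) bdd_k(2) kp]
    unfolding I low_scaleR ..
  show ?thesis
    unfolding nonlinearity_def 1 2 3 M_def I low_diff low_scaleR scaleR_scaleR ..
qed

lemma propagator_low: "propagator p t (low s w) = low s (U t w)"
proof -
  have e: "(\<lambda>\<xi>. exp (- \<i> * of_real (phi_sym p \<xi> * t))) = ku t"
    by (simp add: ku_def[abs_def] chr_def)
  have "l2_mult (ku t) (l2_mult (jc (- s)) w) = l2_mult (jc (- s)) (l2_mult (ku t) w)"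
    by (rule l2_mult_commute) (simp_all add: s_bounds)
  then show ?thesis
    unfolding propagator_def e fourier_mult_bdd[OF bdd_k(5)] fourier_low by (simp only: low_def U_def)
qed

lemma l2_cscale_eq: "l2_cscale c f = l2_mult (\<lambda>_. c) f"
  by (simp add: l2_cscale_def l2_mult_def)

text \<open>
  The integral of the statement is taken in \<^typ>\<open>l2\<close>. As \<open>low s\<close> is bounded and linear, it is the image of the
  integral of the weighted transforms, which exists by continuity.
\<close>

lemma duhamel_low:
  assumes w: "continuous_on {0..T} w" and t: "t \<in> {0..T}"
    and I: "((\<lambda>r. propagator p (t - r) (nonlinearity p (low s (w r)))) has_integral I) {0..t}"
  shows "propagator p t (low s w0) - l2_cscale \<i> I
    = low s (U t w0 + integral {0..t} (\<lambda>r. U (t - r) (M (w r))))"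
proof -
  let ?I = "l2_mult (\<lambda>_. \<i>)" and ?h = "\<lambda>r. U (t - r) (M (w r))"
  have bl: "bounded_linear (\<lambda>x. low s (?I x))"
    by (intro bounded_linear_compose[OF bounded_linear_low bounded_linear_l2_mult] s_bounds) simp
  have c: "continuous_on {0..t} ?h"
    using t by (intro continuous_on_U continuous_on_compose2[OF continuous_on_loc_lip[OF M_lip, of UNIV]]
        continuous_on_subset[OF w] continuous_intros) auto
  have "(?h has_integral integral {0..t} ?h) {0..t}"
    by (intro integrable_integral integrable_continuous_interval c)
  from has_integral_linear[OF this bl]
  have "((\<lambda>r. low s (?I (?h r))) has_integral low s (?I (integral {0..t} ?h))) {0..t}" by (simp add: o_def)
  moreover have "propagator p (t - r) (nonlinearity p (low s (w r))) = low s (?I (?h r))" for r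
    unfolding nonlinearity_low propagator_low U_def
    by (subst l2_mult_commute) simp_all
  ultimately have "I = low s (?I (integral {0..t} ?h))"
    using I by (simp add: has_integral_unique)
  then have "l2_cscale \<i> I = low s (?I (?I (integral {0..t} ?h)))"
    by (simp add: l2_cscale_eq low_mult_const s_bounds)
  also have "?I (?I (integral {0..t} ?h)) = (- 1) *\<^sub>R integral {0..t} ?h"
  proof -
    have "?I (?I x) = l2_mult (\<lambda>_. - 1) x" for x by (simp add: l2_mult_l2_mult)
    also have "\<dots> x = (- 1) *\<^sub>R x" for x
      using to_l2_scaleR[OF sq_integrable_rep_l2[of x], of "- 1"] by (simp add: l2_mult_def)
    finally show ?thesis .
  qed
  finally show ?thesis by (simp only: propagator_low low_add low_scaleR) simp
qed

lemma duhamel_integrable: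
  assumes w: "continuous_on {0..T} w" and t: "t \<in> {0..T}"
  shows "\<exists>I. ((\<lambda>r. propagator p (t - r) (nonlinearity p (low s (w r)))) has_integral I) {0..t}"
proof -
  let ?h = "\<lambda>r. U (t - r) (l2_mult (\<lambda>_. \<i>) (M (w r)))"
  have c: "continuous_on {0..t} ?h"
    using t by (intro continuous_on_U bounded_linear.continuous_on[OF bounded_linear_l2_mult]
        continuous_on_compose2[OF continuous_on_loc_lip[OF M_lip, of UNIV]]
        continuous_on_subset[OF w] continuous_intros) auto
  have "(?h has_integral integral {0..t} ?h) {0..t}"
    by (intro integrable_integral integrable_continuous_interval c)
  from has_integral_linear[OF this bounded_linear_low[OF s_bounds(1)]]
  show ?thesis by (auto simp: o_def nonlinearity_low propagator_low)
qed

lemma continuous_sobolev_low: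
  "continuous_sobolev s T (\<lambda>t. low s (w t)) \<longleftrightarrow>
    (\<forall>t\<in>{0..T}. l2_star (w t) = w t) \<and> continuous_on {0..T} w"
proof -
  have "((\<lambda>r. sobolev_norm s (low s (w r) - low s (w t))) \<longlongrightarrow> 0) F \<longleftrightarrow> (w \<longlongrightarrow> w t) F" for t F
  proof -
    have "((\<lambda>r. sobolev_norm s (low s (w r) - low s (w t))) \<longlongrightarrow> 0) F \<longleftrightarrow> ((\<lambda>r. norm (w r - w t)) \<longlongrightarrow> 0) F"
      unfolding low_diff[symmetric] sobolev_low(1)[OF s_bounds(1)] ..
    also have "\<dots> \<longleftrightarrow> (w \<longlongrightarrow> w t) F"
      using tendsto_norm_zero_iff[of "\<lambda>r. w r - w t" F] LIM_zero_iff[of w "w t" F] by simp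
    finally show ?thesis .
  qed
  then show ?thesis
    by (simp add: continuous_sobolev_def continuous_on_def sobolev_low(2)[OF s_bounds(1)])
qed

lemma is_solution_cong:
  assumes "\<And>t. t \<in> {0..T} \<Longrightarrow> u t = v t"
  shows "is_solution p s T u0 u \<longleftrightarrow> is_solution p s T u0 v"
proof -
  have c: "continuous_sobolev s T u \<longleftrightarrow> continuous_sobolev s T v" if "\<And>t. t \<in> {0..T} \<Longrightarrow> u t = v t" for u v
  proof -
    have "((\<lambda>r. sobolev_norm s (u r - u t)) \<longlongrightarrow> 0) (at t within {0..T}) \<longleftrightarrow>
        ((\<lambda>r. sobolev_norm s (v r - v t)) \<longlongrightarrow> 0) (at t within {0..T})" if "t \<in> {0..T}" for t
      using \<open>\<And>t. t \<in> {0..T} \<Longrightarrow> u t = v t\<close> that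
      by (intro filterlim_cong refl) (auto simp: eventually_at_filter)
    then show ?thesis using that by (simp add: continuous_sobolev_def)
  qed
  have "((\<lambda>r. propagator p (t - r) (nonlinearity p (u r))) has_integral I) {0..t} \<longleftrightarrow>
      ((\<lambda>r. propagator p (t - r) (nonlinearity p (v r))) has_integral I) {0..t}" if "t \<in> {0..T}" for t I
    using assms that by (intro has_integral_cong) auto
  then show ?thesis using c[OF assms] assms by (simp add: is_solution_def)
qed

lemma is_solution_low: "is_solution p s T (low s w0) (\<lambda>t. low s (w t)) \<longleftrightarrow> mild M T w0 w"
proof
  assume L: "is_solution p s T (low s w0) (\<lambda>t. low s (w t))"
  then have c: "continuous_on {0..T} w" and st: "\<forall>t\<in>{0..T}. l2_star (w t) = w t"
    unfolding is_solution_def continuous_sobolev_low by auto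
  have "w t = U t w0 + integral {0..t} (\<lambda>r. U (t - r) (M (w r)))" if t: "t \<in> {0..T}" for t
  proof -
    obtain I where I: "((\<lambda>r. propagator p (t - r) (nonlinearity p (low s (w r)))) has_integral I) {0..t}"
      and e: "low s (w t) = propagator p t (low s w0) - l2_cscale \<i> I"
      using L t unfolding is_solution_def by blast
    show ?thesis
      by (rule low_inject[OF s_bounds(1)]) (simp only: e duhamel_low[OF c t I])
  qed
  then show "mild M T w0 w" using c st by (simp add: mild_def)
next
  assume m: "mild M T w0 w"
  then have c: "continuous_on {0..T} w" by (simp add: mild_def)
  have "\<exists>I. ((\<lambda>r. propagator p (t - r) (nonlinearity p (low s (w r)))) has_integral I) {0..t} \<and>
      low s (w t) = propagator p t (low s w0) - l2_cscale \<i> I" if t: "t \<in> {0..T}" for t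
  proof -
    obtain I where I: "((\<lambda>r. propagator p (t - r) (nonlinearity p (low s (w r)))) has_integral I) {0..t}"
      using duhamel_integrable[OF c t] by blast
    have "w t = U t w0 + integral {0..t} (\<lambda>r. U (t - r) (M (w r)))"
      using m t unfolding mild_def by blast
    then have "low s (w t) = propagator p t (low s w0) - l2_cscale \<i> I"
      unfolding duhamel_low[OF c t I] by (rule arg_cong)
    with I show ?thesis by blast
  qed
  moreover have "continuous_sobolev s T (\<lambda>t. low s (w t))"
    using m unfolding continuous_sobolev_low mild_def by blast
  ultimately show "is_solution p s T (low s w0) (\<lambda>t. low s (w t))"
    by (simp add: is_solution_def)
qed

lemma is_solution_mild:
  assumes u: "is_solution p s T (low s w0) u"
  shows "\<exists>w. mild M T w0 w \<and> (\<forall>t\<in>{0..T}. u t = low s (w t))"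
proof -
  have "\<exists>a. u t = low s a" if "t \<in> {0..T}" for t
    using u that sobolev_eq_low[OF s_bounds(1), of "u t"]
    unfolding is_solution_def continuous_sobolev_def by metis
  then obtain w where w: "\<And>t. t \<in> {0..T} \<Longrightarrow> u t = low s (w t)" by metis
  then have "is_solution p s T (low s w0) (\<lambda>t. low s (w t))"
    using is_solution_cong[of T u "\<lambda>t. low s (w t)" "low s w0"] u by simp
  then have "mild M T w0 w" by (simp only: is_solution_low)
  with w show ?thesis by blast
qed

theorem well_posed: "globally_well_posed p s"
  unfolding globally_well_posed_def
proof (intro conjI ballI allI impI)
  fix u0 T assume u0: "u0 \<in> sobolev s" and T: "(0::real) < T"
  obtain w0 where w0: "u0 = low s w0" "l2_star w0 = w0" using sobolev_eq_low[OF s_bounds(1) u0] .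
  obtain w where w: "mild M T w0 w" using mild_exists[OF less_imp_le[OF T] w0(2)] by blast
  obtain C where C: "\<And>w v t. mild M T w0 w \<Longrightarrow> mild M T w0 v \<Longrightarrow> t \<in> {0..T} \<Longrightarrow> norm (w t - v t) \<le> C * norm (w0 - w0)"
    using mild_dependence[of "norm w0" T] by blast
  show "\<exists>u. is_solution p s T u0 u \<and> (\<forall>v. is_solution p s T u0 v \<longrightarrow> (\<forall>t\<in>{0..T}. v t = u t))"
  proof (intro exI conjI allI impI ballI)
    show "is_solution p s T u0 (\<lambda>t. low s (w t))"
      unfolding w0(1) is_solution_low by (rule w)
    fix v t assume v: "is_solution p s T u0 v" and t: "t \<in> {0..T}"
    obtain w' where w': "mild M T w0 w'" "\<forall>t\<in>{0..T}. v t = low s (w' t)"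
      using is_solution_mild[OF v[unfolded w0(1)]] by (elim exE conjE)
    have "norm (w' t - w t) \<le> C * norm (w0 - w0)" by (rule C[OF w'(1) w t])
    then show "v t = low s (w t)" using bspec[OF w'(2) t] by simp
  qed
next
  fix u0 and T \<epsilon> :: real assume u0: "u0 \<in> sobolev s" and T: "0 < T" and \<epsilon>: "0 < \<epsilon>"
  obtain w0 where w0: "u0 = low s w0" "l2_star w0 = w0" using sobolev_eq_low[OF s_bounds(1) u0] .
  \<comment> \<open>data within distance \<open>1\<close> of \<open>u0\<close> lie in one ball, where a single constant serves\<close>
  obtain C where C0: "0 \<le> C" and C: "\<And>w0' v0 w v t. norm w0' \<le> norm w0 + 1 \<Longrightarrow> norm v0 \<le> norm w0 + 1 \<Longrightarrow>
      mild M T w0' w \<Longrightarrow> mild M T v0 v \<Longrightarrow> t \<in> {0..T} \<Longrightarrow> norm (w t - v t) \<le> C * norm (w0' - v0)"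
    using mild_dependence[of "norm w0 + 1" T] by metis
  define \<delta> where "\<delta> = min 1 (\<epsilon> / (C + 1))"
  have \<delta>: "0 < \<delta>" using \<epsilon> C0 by (simp add: \<delta>_def)
  show "\<exists>\<delta>>0. \<forall>v0\<in>sobolev s. sobolev_norm s (v0 - u0) < \<delta> \<longrightarrow>
        (\<forall>u v. is_solution p s T u0 u \<longrightarrow> is_solution p s T v0 v \<longrightarrow>
           (\<forall>t\<in>{0..T}. sobolev_norm s (v t - u t) < \<epsilon>))"
  proof (intro exI[of _ \<delta>] conjI \<delta> ballI impI allI)
    fix v0 u v t assume v0: "v0 \<in> sobolev s" and less: "sobolev_norm s (v0 - u0) < \<delta>"
      and u: "is_solution p s T u0 u" and v: "is_solution p s T v0 v" and t: "t \<in> {0..T}"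
    obtain x0 where x0: "v0 = low s x0" "l2_star x0 = x0" using sobolev_eq_low[OF s_bounds(1) v0] .
    have d: "norm (x0 - w0) < \<delta>"
      using less unfolding x0(1) w0(1) low_diff[symmetric] sobolev_low(1)[OF s_bounds(1)] .
    then have "norm x0 \<le> norm w0 + 1"
      using norm_triangle_sub[of x0 w0] by (simp add: \<delta>_def)
    obtain w where w: "mild M T w0 w" "\<forall>t\<in>{0..T}. u t = low s (w t)"
      using is_solution_mild[OF u[unfolded w0(1)]] by (elim exE conjE)
    obtain x where x: "mild M T x0 x" "\<forall>t\<in>{0..T}. v t = low s (x t)"
      using is_solution_mild[OF v[unfolded x0(1)]] by (elim exE conjE)
    have "sobolev_norm s (v t - u t) = norm (x t - w t)"
      unfolding bspec[OF w(2) t] bspec[OF x(2) t] low_diff[symmetric] by (rule sobolev_low(1)[OF s_bounds(1)])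
    also have "\<dots> \<le> C * norm (x0 - w0)"
      by (rule C[OF \<open>norm x0 \<le> norm w0 + 1\<close> _ x(1) w(1) t]) simp
    also have "\<dots> \<le> C * (\<epsilon> / (C + 1))"
      using d C0 by (intro mult_left_mono) (simp_all add: \<delta>_def)
    also have "\<dots> < \<epsilon>"
      using C0 \<epsilon> by (simp add: field_simps)
    finally show "sobolev_norm s (v t - u t) < \<epsilon>" .
  qed
qed

end

theorem theorem2:
  fixes p :: wave_params and s :: real
  assumes "0 \<le> theta p" and "theta p \<le> 1"
    and "s \<ge> 2"
    and "gamma1 p > 0" and "delta1 p > 0"
    and "gamma0 p = 7/48"
  shows "globally_well_posed p s"
proof -
  interpret wave p s by (rule wave.intro) (use assms in auto)
  show ?thesis by (rule well_posed)
qed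

end
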